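(* Let $n\in\mathbb{N}$ and let $\mathcal{P}$ be a nonempty finite set of primes. Let $\Gamma=\mathcal{B}_n(\mathbb{Z}[\mathcal{P}^{-1}])$ (discrete), $\Lambda=\mathcal{B}_n(\mathbb{Z})$, and let $G$ be the subgroup of $\mathcal{B}_n(\mathbb{Q}_{\mathcal{P}})$ consisting of the matrices whose diagonal entries lie in $\mathbb{Z}[\mathcal{P}^{-1}]^\times$. Let $N=\{\operatorname{Id}\}$ if $n$ is odd and $N=\{\pm\operatorname{Id}\}$ if $n$ is even. Then the Schlichting completion $\mathcal{G}=\Gamma/\!\!/\Lambda$ of $(\Gamma,\Lambda)$ is given by $\mathcal{G}\cong G/N$, where the structure map $\alpha\colon\Gamma\to\mathcal{G}\cong G/N$ is induced by the inclusion $\Gamma\hookrightarrow G$.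
   Context: $\mathcal{B}_n(R)$ is the group of upper triangular matrices in $\operatorname{SL}_n(R)$. $\mathbb{Z}[\mathcal{P}^{-1}]$ is the subring of $\mathbb{Q}$ generated by $\{1/p\mid p\in\mathcal{P}\}$. $\mathbb{Q}_{\mathcal{P}}=\prod_{p\in\mathcal{P}}\mathbb{Q}_p$ with the product topology; $\mathbb{Z}[\mathcal{P}^{-1}]$ is regarded as a subring of $\mathbb{Q}_{\mathcal{P}}$ via component-wise inclusion. $G$ has the topology induced from the entries in $\mathbb{Q}_{\mathcal{P}}$ (diagonal entries lie in the discrete space $\mathbb{Z}[\mathcal{P}^{-1}]^\times$); it is a totally disconnected locally compact group. $\Lambda$ is commensurated in $\Gamma$ (each conjugate of $\Lambda$ meets $\Lambda$ in a subgroup of finite index in both). The Schlichting completion $\Gamma/\!\!/\Lambda$ is the closure of $\alpha(\Gamma)$ in $\operatorname{Sym}(\Gamma/\Lambda)$ with the topology of pointwise convergence ($\Gamma/\Lambda$ discrete), together with the map $\alpha\colon\Gamma\to\Gamma/\!\!/\Lambda$ given by left multiplication on left cosets. The isomorphism is one of topological groups. *)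

theory Defs
  imports
    "HOL-Analysis.Abstract_Metric_Spaces"
    "HOL-Computational_Algebra.Primes"
    "HOL-Combinatorics.Permutations"
    "HOL-Algebra.Algebraic_Closure_Type"
    "HOL-Algebra.Generated_Rings"
    "HOL-Algebra.QuotRing"
    "HOL-Algebra.Left_Coset"
    "HOL-Algebra.Bij"
begin

definition padic_val :: "nat \<Rightarrow> rat \<Rightarrow> int" where
  "padic_val p x = int (multiplicity (int p) (fst (quotient_of x)))
                 - int (multiplicity (int p) (snd (quotient_of x)))"

definition padic_abs :: "nat \<Rightarrow> rat \<Rightarrow> real" where
  "padic_abs p x = (if x = 0 then 0 else real p powi (- padic_val p x))"

definition padic_cauchy_ring :: "nat \<Rightarrow> (nat \<Rightarrow> rat) ring" where
  "padic_cauchy_ring p =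
     \<lparr>carrier = {s. Metric_space.MCauchy UNIV (\<lambda>x y. padic_abs p (x - y)) s},
      monoid.mult = (\<lambda>s t k. s k * t k), one = (\<lambda>_. 1),
      ring.zero = (\<lambda>_. 0), add = (\<lambda>s t k. s k + t k)\<rparr>"

definition padic_null_ideal :: "nat \<Rightarrow> (nat \<Rightarrow> rat) set" where
  "padic_null_ideal p =
     {s \<in> carrier (padic_cauchy_ring p). (\<lambda>k. padic_abs p (s k)) \<longlonglongrightarrow> 0}"

text \<open>The completion of the rationals with respect to the p-adic absolute value: Cauchy
  sequences modulo null sequences.  It depends on the value \<open>p\<close>, hence is a ring with an explicit
  carrier and not a type.\<close>

definition padic_field :: "nat \<Rightarrow> (nat \<Rightarrow> rat) set ring" where
  "padic_field p = padic_cauchy_ring p Quot padic_null_ideal p"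

definition padic_of_rat :: "nat \<Rightarrow> rat \<Rightarrow> (nat \<Rightarrow> rat) set" where
  "padic_of_rat p x = padic_null_ideal p +>\<^bsub>padic_cauchy_ring p\<^esub> (\<lambda>_. x)"

definition padic_norm :: "nat \<Rightarrow> (nat \<Rightarrow> rat) set \<Rightarrow> real" where
  "padic_norm p a = (THE r. \<forall>s\<in>a. (\<lambda>k. padic_abs p (s k)) \<longlonglongrightarrow> r)"

text \<open>The locale \<^locale>\<open>Metric_space\<close> wants a distance that is symmetric and nonnegative on the
  whole type, hence the default value off the carrier.\<close>

definition padic_dist :: "nat \<Rightarrow> (nat \<Rightarrow> rat) set \<Rightarrow> (nat \<Rightarrow> rat) set \<Rightarrow> real" where
  "padic_dist p a b =
     (if a \<in> carrier (padic_field p) \<and> b \<in> carrier (padic_field p)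
      then padic_norm p (a \<ominus>\<^bsub>padic_field p\<^esub> b) else 0)"

definition padic_topology :: "nat \<Rightarrow> (nat \<Rightarrow> rat) set topology" where
  "padic_topology p = Metric_space.mtopology (carrier (padic_field p)) (padic_dist p)"

abbreviation rat_ring :: "rat ring" where
  "rat_ring \<equiv> ring_of_type_algebra"

definition int_ring :: "rat ring" where
  "int_ring = rat_ring\<lparr>carrier := \<int>\<rparr>"

definition localized_int_ring :: "nat set \<Rightarrow> rat ring" where
  "localized_int_ring P =
     rat_ring\<lparr>carrier := generate_ring rat_ring ((\<lambda>p. 1 / of_nat p) ` P)\<rparr>"

definition product_ring :: "'i set \<Rightarrow> ('i \<Rightarrow> 'a ring) \<Rightarrow> ('i \<Rightarrow> 'a) ring" where
  "product_ring I R =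
     \<lparr>carrier = (\<Pi>\<^sub>E i\<in>I. carrier (R i)),
      monoid.mult = (\<lambda>x y. \<lambda>i\<in>I. x i \<otimes>\<^bsub>R i\<^esub> y i), one = (\<lambda>i\<in>I. \<one>\<^bsub>R i\<^esub>),
      ring.zero = (\<lambda>i\<in>I. \<zero>\<^bsub>R i\<^esub>), add = (\<lambda>x y. \<lambda>i\<in>I. x i \<oplus>\<^bsub>R i\<^esub> y i)\<rparr>"

type_synonym padics = "nat \<Rightarrow> (nat \<Rightarrow> rat) set"

definition padics_ring :: "nat set \<Rightarrow> padics ring" where
  "padics_ring P = product_ring P padic_field"

definition padics_topology :: "nat set \<Rightarrow> padics topology" where
  "padics_topology P = product_topology padic_topology P"

definition padics_of_rat :: "nat set \<Rightarrow> rat \<Rightarrow> padics" where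
  "padics_of_rat P x = (\<lambda>p\<in>P. padic_of_rat p x)"

text \<open>An \<open>n \<times> n\<close> matrix over \<open>R\<close> is an extensional function on the index set
  \<open>{..<n} \<times> {..<n}\<close>.\<close>

type_synonym 'a matrix = "nat \<times> nat \<Rightarrow> 'a"

definition matrices :: "nat \<Rightarrow> ('a, 'b) ring_scheme \<Rightarrow> 'a matrix set" where
  "matrices n R = {..<n} \<times> {..<n} \<rightarrow>\<^sub>E carrier R"

definition mat_mult :: "nat \<Rightarrow> ('a, 'b) ring_scheme \<Rightarrow> 'a matrix \<Rightarrow> 'a matrix \<Rightarrow> 'a matrix" where
  "mat_mult n R A B =
     (\<lambda>(i, j)\<in>{..<n} \<times> {..<n}. \<Oplus>\<^bsub>R\<^esub>k\<in>{..<n}. A (i, k) \<otimes>\<^bsub>R\<^esub> B (k, j))"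

definition mat_scalar :: "nat \<Rightarrow> ('a, 'b) ring_scheme \<Rightarrow> 'a \<Rightarrow> 'a matrix" where
  "mat_scalar n R c = (\<lambda>(i, j)\<in>{..<n} \<times> {..<n}. if i = j then c else \<zero>\<^bsub>R\<^esub>)"

definition mat_det :: "nat \<Rightarrow> ('a, 'b) ring_scheme \<Rightarrow> 'a matrix \<Rightarrow> 'a" where
  "mat_det n R A =
     (\<Oplus>\<^bsub>R\<^esub>\<sigma>\<in>{\<sigma>. \<sigma> permutes {..<n}}.
        (if evenperm \<sigma> then \<one>\<^bsub>R\<^esub> else \<ominus>\<^bsub>R\<^esub> \<one>\<^bsub>R\<^esub>) \<otimes>\<^bsub>R\<^esub> (\<Otimes>\<^bsub>R\<^esub>i\<in>{..<n}. A (i, \<sigma> i)))"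

definition SL :: "nat \<Rightarrow> ('a, 'b) ring_scheme \<Rightarrow> 'a matrix monoid" where
  "SL n R = \<lparr>carrier = {A \<in> matrices n R. mat_det n R A = \<one>\<^bsub>R\<^esub>},
             monoid.mult = mat_mult n R, one = mat_scalar n R \<one>\<^bsub>R\<^esub>\<rparr>"

definition upper_SL :: "nat \<Rightarrow> ('a, 'b) ring_scheme \<Rightarrow> 'a matrix monoid" where
  "upper_SL n R =
     (SL n R)\<lparr>carrier := {A \<in> carrier (SL n R). \<forall>i<n. \<forall>j<i. A (i, j) = \<zero>\<^bsub>R\<^esub>}\<rparr>"

definition mat_map :: "nat \<Rightarrow> ('a \<Rightarrow> 'b) \<Rightarrow> 'a matrix \<Rightarrow> 'b matrix" where
  "mat_map n f A = (\<lambda>ij\<in>{..<n} \<times> {..<n}. f (A ij))"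

definition finite_index :: "('g, 'b) monoid_scheme \<Rightarrow> 'g set \<Rightarrow> 'g set \<Rightarrow> bool" where
  "finite_index G H K \<longleftrightarrow> finite (rcosets\<^bsub>G\<lparr>carrier := H\<rparr>\<^esub> K)"

definition commensurated :: "('g, 'b) monoid_scheme \<Rightarrow> 'g set \<Rightarrow> bool" where
  "commensurated G H \<longleftrightarrow> subgroup H G \<and>
     (\<forall>g\<in>carrier G. let H' = (\<lambda>h. g \<otimes>\<^bsub>G\<^esub> h \<otimes>\<^bsub>G\<^esub> inv\<^bsub>G\<^esub> g) ` H in
        finite_index G H (H \<inter> H') \<and> finite_index G H' (H \<inter> H'))"

definition pointwise_topology :: "'a set \<Rightarrow> ('a \<Rightarrow> 'a) topology" where
  "pointwise_topology S =
     subtopology (product_topology (\<lambda>_. discrete_topology S) S) (carrier (BijGroup S))"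

definition schlichting_map ::
  "('g, 'b) monoid_scheme \<Rightarrow> 'g set \<Rightarrow> 'g \<Rightarrow> ('g set \<Rightarrow> 'g set)" where
  "schlichting_map G H g = (\<lambda>C\<in>lcosets\<^bsub>G\<^esub> H. g <#\<^bsub>G\<^esub> C)"

definition schlichting_completion ::
  "('g, 'b) monoid_scheme \<Rightarrow> 'g set \<Rightarrow> ('g set \<Rightarrow> 'g set) monoid" where
  "schlichting_completion G H =
     (BijGroup (lcosets\<^bsub>G\<^esub> H))\<lparr>carrier :=
        pointwise_topology (lcosets\<^bsub>G\<^esub> H) closure_of (schlichting_map G H ` carrier G)\<rparr>"

definition schlichting_topology ::
  "('g, 'b) monoid_scheme \<Rightarrow> 'g set \<Rightarrow> ('g set \<Rightarrow> 'g set) topology" where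
  "schlichting_topology G H =
     subtopology (pointwise_topology (lcosets\<^bsub>G\<^esub> H)) (carrier (schlichting_completion G H))"

definition coset_topology :: "('g, 'b) monoid_scheme \<Rightarrow> 'g topology \<Rightarrow> 'g set \<Rightarrow> 'g set topology"
  where "coset_topology G T N =
     topology (\<lambda>U. U \<subseteq> carrier (G Mod N) \<and> openin T {g \<in> topspace T. N #>\<^bsub>G\<^esub> g \<in> U})"

lemma openin_coset_topology:
  "openin (coset_topology G T N) U \<longleftrightarrow>
     U \<subseteq> carrier (G Mod N) \<and> openin T {g \<in> topspace T. N #>\<^bsub>G\<^esub> g \<in> U}"
proof -
  let ?pre = "\<lambda>U. {g \<in> topspace T. N #>\<^bsub>G\<^esub> g \<in> U}"
  have inter: "?pre (U \<inter> V) = ?pre U \<inter> ?pre V" for U V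
    by blast
  have union: "?pre (\<Union>\<K>) = \<Union>(?pre ` \<K>)" for \<K>
    by blast
  have "istopology (\<lambda>U. U \<subseteq> carrier (G Mod N) \<and> openin T (?pre U))"
    unfolding istopology_def inter union by blast
  then show ?thesis
    by (simp add: coset_topology_def topology_inverse')
qed

definition topological_group_iso ::
  "('g, 'b) monoid_scheme \<Rightarrow> 'g topology \<Rightarrow> ('h, 'c) monoid_scheme \<Rightarrow> 'h topology
     \<Rightarrow> ('g \<Rightarrow> 'h) \<Rightarrow> bool" where
  "topological_group_iso G S H T f \<longleftrightarrow> f \<in> iso G H \<and> homeomorphic_map S T f"

definition Gamma_group :: "nat \<Rightarrow> nat set \<Rightarrow> rat matrix monoid" where
  "Gamma_group n P = upper_SL n (localized_int_ring P)"

definition Lambda_set :: "nat \<Rightarrow> rat matrix set" where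
  "Lambda_set n = carrier (upper_SL n int_ring)"

definition G_group :: "nat \<Rightarrow> nat set \<Rightarrow> padics matrix monoid" where
  "G_group n P =
     (upper_SL n (padics_ring P))\<lparr>carrier :=
        {A \<in> carrier (upper_SL n (padics_ring P)).
           \<forall>i<n. A (i, i) \<in> padics_of_rat P ` Units (localized_int_ring P)}\<rparr>"

text \<open>All entries, including the diagonal ones, carry the topology of \<open>\<rat>\<^sub>P\<close>.  For a finite set
  \<open>P\<close> of primes this topology is discrete on the image of the units of \<open>\<int>[P\<^sup>-\<^sup>1]\<close>: a unit \<open>u\<close> is
  plus or minus a product of powers of primes in \<open>P\<close>, so if the p-adic absolute value of \<open>u - 1\<close> is
  less than \<open>1 / p\<close> for every \<open>p\<close> in \<open>P \<noteq> {}\<close>, then \<open>u = 1\<close>.\<close>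

definition G_topology :: "nat \<Rightarrow> nat set \<Rightarrow> padics matrix topology" where
  "G_topology n P =
     subtopology (product_topology (\<lambda>_. padics_topology P) ({..<n} \<times> {..<n}))
       (carrier (G_group n P))"

definition N_set :: "nat \<Rightarrow> nat set \<Rightarrow> padics matrix set" where
  "N_set n P =
     (if odd n then {mat_scalar n (padics_ring P) \<one>\<^bsub>padics_ring P\<^esub>}
      else {mat_scalar n (padics_ring P) \<one>\<^bsub>padics_ring P\<^esub>,
            mat_scalar n (padics_ring P) (\<ominus>\<^bsub>padics_ring P\<^esub> \<one>\<^bsub>padics_ring P\<^esub>)})"

end

theory Submission
  imports Defs "HOL-Number_Theory.Cong"
begin

text \<open>Let \<open>q\<close> be the product of the primes in \<open>P\<close> and let \<open>K\<close> be the open subgroup of integral matrices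
  in \<open>G\<close>.  Since \<open>\<Gamma>\<close> is dense in \<open>G\<close> and \<open>\<Lambda> = \<Gamma> \<inter> K\<close>, the sets \<open>\<Gamma>/\<Lambda>\<close> and \<open>G/K\<close> coincide and \<open>G\<close> acts on
  them.  An element of \<open>K\<close> has diagonal entries \<open>\<plusminus>1\<close>; conjugating it by powers of
  \<open>diag(q\<^sup>n\<^sup>-\<^sup>1, q\<^sup>n\<^sup>-\<^sup>3, ...)\<close> and by \<open>1 + q\<^sup>-\<^sup>2 E\<^sub>i\<^sub>j\<close> shows that the stabilisers \<open>C m\<close> of suitable finite
  sets of cosets consist of matrices congruent to an element of \<open>N\<close> modulo \<open>q\<^sup>m\<close>.  So \<open>N\<close> is the kernel
  of the action, and the topologies agree on \<open>G/N\<close>.  A permutation in the closure of \<open>\<Gamma>\<close> is given by a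
  sequence in \<open>\<Gamma>\<close> that is Cauchy modulo \<open>N\<close>, hence, after a correction of signs, by its limit in \<open>G\<close>.
  Finally \<open>\<Lambda>\<close> is commensurated because a conjugate of \<open>\<Lambda>\<close> contains a congruence subgroup of \<open>\<Lambda>\<close>.\<close>

section \<open>Matrices over a commutative ring\<close>

text \<open>The work is split along one interface: \<open>schlichting_model\<close> lists what
  \<Gamma>, G, K and the sets \<open>C m\<close> have to satisfy for the completion to be identified
  by pure group theory, and the p-adic arithmetic serves to verify this list. The obstacle that
  shapes both sides is that coset stabilisers see a matrix only modulo N. Each \<open>C m\<close>
  contains N, so two elements that are close as permutations are close in G only up to a sign. Hence
  openness is compared for N-invariant sets, and a sequence has to be corrected before it has a
  limit in G. The second difficulty is the determinant: approximating all entries of a matrix would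
  destroy it. The diagonal of an element of G already consists of rational units, so it can be kept
  exactly while the entries above it, on which the determinant does not depend, are approximated.
  Two kinds of test cosets occur because dilations commute with diagonal matrices and therefore give
  no information on the diagonal, whereas elementary matrices compare its entries.\<close>

lemma matrices_eqI:
  assumes "A \<in> matrices n R" "B \<in> matrices n S"
    and "\<And>i j. i < n \<Longrightarrow> j < n \<Longrightarrow> A (i, j) = B (i, j)"
  shows "A = B"
  using assms unfolding matrices_def by (intro PiE_ext) auto

lemma matrices_entry: "A \<in> matrices n R \<Longrightarrow> i < n \<Longrightarrow> j < n \<Longrightarrow> A (i, j) \<in> carrier R"
  by (auto simp: matrices_def)

definition upper_tri :: "nat \<Rightarrow> ('a, 'b) ring_scheme \<Rightarrow> 'a matrix \<Rightarrow> bool" where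
  "upper_tri n R A \<longleftrightarrow> (\<forall>i<n. \<forall>j<i. A (i, j) = \<zero>\<^bsub>R\<^esub>)"

lemma upper_tri_zero: "upper_tri n R A \<Longrightarrow> i < n \<Longrightarrow> j < i \<Longrightarrow> A (i, j) = \<zero>\<^bsub>R\<^esub>"
  by (simp add: upper_tri_def)

context cring
begin

section \<open>Finite sums over an explicit carrier\<close>

lemma finsum_swap:
  assumes "finite A" "finite B" "\<And>i j. i \<in> A \<Longrightarrow> j \<in> B \<Longrightarrow> f i j \<in> carrier R"
  shows "(\<Oplus>i\<in>A. \<Oplus>j\<in>B. f i j) = (\<Oplus>j\<in>B. \<Oplus>i\<in>A. f i j)"
  using assms(1,3)
proof (induction A rule: finite_induct)
  case empty
  then show ?case by simp
next
  case (insert a A)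
  have "(\<Oplus>i\<in>insert a A. \<Oplus>j\<in>B. f i j) = (\<Oplus>j\<in>B. f a j) \<oplus> (\<Oplus>j\<in>B. \<Oplus>i\<in>A. f i j)"
    using insert by (simp add: Pi_def finsum_closed)
  also have "\<dots> = (\<Oplus>j\<in>B. f a j \<oplus> (\<Oplus>i\<in>A. f i j))"
    using insert by (subst finsum_addf) (auto simp: Pi_def)
  also have "\<dots> = (\<Oplus>j\<in>B. \<Oplus>i\<in>insert a A. f i j)"
    using insert by (intro finsum_cong') (auto simp: Pi_def)
  finally show ?case .
qed

lemma finsum_single:
  assumes "finite A" "a \<in> A" "f a \<in> carrier R" "\<And>i. i \<in> A \<Longrightarrow> i \<noteq> a \<Longrightarrow> f i = \<zero>"
  shows "(\<Oplus>i\<in>A. f i) = f a"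
proof -
  have "(\<Oplus>i\<in>A. f i) = (\<Oplus>i\<in>A. if a = i then f i else \<zero>)"
    using assms by (intro finsum_cong') auto
  also have "\<dots> = f a"
    using assms by (intro finsum_singleton) (auto simp: Pi_def, metis zero_closed)
  finally show ?thesis .
qed

lemma finsum_pair:
  assumes "finite A" "a \<in> A" "b \<in> A" "a \<noteq> b" "f a \<in> carrier R" "f b \<in> carrier R"
    and z: "\<And>i. i \<in> A \<Longrightarrow> i \<noteq> a \<Longrightarrow> i \<noteq> b \<Longrightarrow> f i = \<zero>"
  shows "(\<Oplus>i\<in>A. f i) = f a \<oplus> f b"
proof -
  have A: "A = insert a (A - {a})" using assms by auto
  have "\<And>i. i \<in> A \<Longrightarrow> f i \<in> carrier R" using assms by (metis zero_closed)
  then have "(\<Oplus>i\<in>A. f i) = f a \<oplus> (\<Oplus>i\<in>A - {a}. f i)"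
    using assms by (subst A, subst finsum_insert) auto
  also have "(\<Oplus>i\<in>A - {a}. f i) = f b"
    using assms by (intro finsum_single) auto
  finally show ?thesis .
qed

section \<open>Products of matrices\<close>

lemma mat_mult_closed:
  "A \<in> matrices n R \<Longrightarrow> B \<in> matrices n R \<Longrightarrow> mat_mult n R A B \<in> matrices n R"
  by (auto simp: matrices_def mat_mult_def intro!: finsum_closed)

lemma mat_mult_assoc:
  assumes "A \<in> matrices n R" "B \<in> matrices n R" "C \<in> matrices n R"
  shows "mat_mult n R (mat_mult n R A B) C = mat_mult n R A (mat_mult n R B C)"
proof (rule matrices_eqI)
  show "mat_mult n R (mat_mult n R A B) C \<in> matrices n R"
    "mat_mult n R A (mat_mult n R B C) \<in> matrices n R"
    using assms by (auto intro!: mat_mult_closed)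
  note cl = matrices_entry[OF assms(1)] matrices_entry[OF assms(2)] matrices_entry[OF assms(3)]
  fix i j assume ij: "i < n" "j < n"
  have "mat_mult n R (mat_mult n R A B) C (i, j) =
      (\<Oplus>k\<in>{..<n}. \<Oplus>l\<in>{..<n}. A (i, l) \<otimes> B (l, k) \<otimes> C (k, j))"
    using ij cl by (auto simp: mat_mult_def Pi_def intro!: finsum_cong' finsum_ldistr)
  also have "\<dots> = (\<Oplus>l\<in>{..<n}. \<Oplus>k\<in>{..<n}. A (i, l) \<otimes> B (l, k) \<otimes> C (k, j))"
    using ij cl by (intro finsum_swap) auto
  also have "\<dots> = (\<Oplus>l\<in>{..<n}. A (i, l) \<otimes> (\<Oplus>k\<in>{..<n}. B (l, k) \<otimes> C (k, j)))"
    using ij cl by (intro finsum_cong')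
      (auto simp: Pi_def finsum_rdistr m_assoc intro!: finsum_cong')
  also have "\<dots> = mat_mult n R A (mat_mult n R B C) (i, j)"
    using ij cl by (auto simp: mat_mult_def Pi_def intro!: finsum_cong')
  finally show "mat_mult n R (mat_mult n R A B) C (i, j) = mat_mult n R A (mat_mult n R B C) (i, j)" .
qed

lemma mat_scalar_closed: "c \<in> carrier R \<Longrightarrow> mat_scalar n R c \<in> matrices n R"
  by (auto simp: matrices_def mat_scalar_def)

lemma mat_scalar_mult_entry:
  assumes "c \<in> carrier R" "A \<in> matrices n R" "i < n" "j < n"
  shows "mat_mult n R (mat_scalar n R c) A (i, j) = c \<otimes> A (i, j)"
proof -
  have "(\<Oplus>k\<in>{..<n}. mat_scalar n R c (i, k) \<otimes> A (k, j)) = mat_scalar n R c (i, i) \<otimes> A (i, j)"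
    using assms matrices_entry[OF assms(2)] by (intro finsum_single) (auto simp: mat_scalar_def)
  then show ?thesis using assms by (simp add: mat_mult_def mat_scalar_def)
qed

lemma mat_mult_scalar_entry:
  assumes "c \<in> carrier R" "A \<in> matrices n R" "i < n" "j < n"
  shows "mat_mult n R A (mat_scalar n R c) (i, j) = A (i, j) \<otimes> c"
proof -
  have "(\<Oplus>k\<in>{..<n}. A (i, k) \<otimes> mat_scalar n R c (k, j)) = A (i, j) \<otimes> mat_scalar n R c (j, j)"
    using assms matrices_entry[OF assms(2)] by (intro finsum_single) (auto simp: mat_scalar_def)
  then show ?thesis using assms by (simp add: mat_mult_def mat_scalar_def)
qed

lemma mat_one_mult: "A \<in> matrices n R \<Longrightarrow> mat_mult n R (mat_scalar n R \<one>) A = A"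
  by (rule matrices_eqI[OF mat_mult_closed[OF mat_scalar_closed]])
     (auto simp: mat_scalar_mult_entry dest: matrices_entry)

lemma upper_tri_mult_below:
  assumes "A \<in> matrices n R" "B \<in> matrices n R" "upper_tri n R A" "upper_tri n R B"
  shows "upper_tri n R (mat_mult n R A B)"
  unfolding upper_tri_def
proof (intro allI impI)
  fix i j assume ij: "i < n" "j < i"
  have "A (i, k) \<otimes> B (k, j) = \<zero>" if "k < n" for k
    using ij that assms matrices_entry[OF assms(1)] matrices_entry[OF assms(2)]
    by (cases "k < i") (auto simp: upper_tri_zero)
  then have "(\<Oplus>k\<in>{..<n}. A (i, k) \<otimes> B (k, j)) = (\<Oplus>k\<in>{..<n}. \<zero>)"
    by (intro finsum_cong') auto
  then show "mat_mult n R A B (i, j) = \<zero>"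
    using ij by (simp add: mat_mult_def finsum_zero)
qed

text \<open>For k < i the left factor of the k-th summand vanishes, for k > i the right one.
  Multiplicativity of the diagonal is what keeps the unit condition on the diagonals of G stable
  under products and inverses.\<close>

lemma upper_tri_mult_diag:
  assumes "A \<in> matrices n R" "B \<in> matrices n R" "upper_tri n R A" "upper_tri n R B" "i < n"
  shows "mat_mult n R A B (i, i) = A (i, i) \<otimes> B (i, i)"
proof -
  note cl = matrices_entry[OF assms(1)] matrices_entry[OF assms(2)]
  have "A (i, k) \<otimes> B (k, i) = \<zero>" if "k < n" "k \<noteq> i" for k
    using that assms cl by (cases "k < i") (auto simp: upper_tri_zero)
  then have "(\<Oplus>k\<in>{..<n}. A (i, k) \<otimes> B (k, i)) = A (i, i) \<otimes> B (i, i)"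
    using assms cl by (intro finsum_single) auto
  then show ?thesis
    using assms by (simp add: mat_mult_def)
qed

section \<open>Determinants and inverses of triangular matrices\<close>

lemma finprod_zero:
  assumes "finite A" "a \<in> A" "f \<in> A \<rightarrow> carrier R" "f a = \<zero>"
  shows "(\<Otimes>i\<in>A. f i) = \<zero>"
proof -
  have A: "A = insert a (A - {a})" using assms by auto
  have "(\<Otimes>i\<in>A. f i) = f a \<otimes> (\<Otimes>i\<in>A - {a}. f i)"
    using assms by (subst A, subst finprod_insert) (auto simp: Pi_def)
  then show ?thesis using assms by (simp add: Pi_def)
qed

text \<open>A permutation other than the identity sends some i to a smaller index, so its summand
  contains an entry below the diagonal.\<close>

lemma mat_det_upper_tri:
  assumes A: "A \<in> matrices n R" "upper_tri n R A"
  shows "mat_det n R A = (\<Otimes>i\<in>{..<n}. A (i, i))"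
proof -
  note cl = matrices_entry[OF A(1)]
  have perm: "\<sigma> i < n" if "\<sigma> permutes {..<n}" "i < n" for \<sigma> i
    using that permutes_in_image by fastforce
  define t where "t \<sigma> = (if evenperm \<sigma> then \<one> else \<ominus> \<one>) \<otimes> (\<Otimes>i\<in>{..<n}. A (i, \<sigma> i))" for \<sigma>
  have "(\<Oplus>\<sigma>\<in>{\<sigma>. \<sigma> permutes {..<n}}. t \<sigma>) = t id"
  proof (rule finsum_single)
    show "finite {\<sigma>. \<sigma> permutes {..<n}}"
      by (simp add: finite_permutations)
    show "id \<in> {\<sigma>. \<sigma> permutes {..<n}}"
      by (simp add: permutes_id)
    show "t id \<in> carrier R"
      unfolding t_def using cl by (auto intro!: m_closed finprod_closed)
    fix \<sigma> assume \<sigma>: "\<sigma> \<in> {\<sigma>. \<sigma> permutes {..<n}}" "\<sigma> \<noteq> id"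
    then obtain i where i: "i < n" "\<sigma> i < i"
      using permutes_natset_ge[of \<sigma> "{..<n}"] by (metis lessThan_iff mem_Collect_eq not_le)
    have "(\<Otimes>i\<in>{..<n}. A (i, \<sigma> i)) = \<zero>"
      using \<sigma> i cl perm A(2) by (intro finprod_zero[of _ i]) (auto simp: upper_tri_zero)
    then show "t \<sigma> = \<zero>" by (simp add: t_def)
  qed
  also have "t id = (\<Otimes>i\<in>{..<n}. A (i, i))"
    using cl by (simp add: t_def evenperm_id finprod_closed Pi_def)
  finally show ?thesis by (simp add: mat_det_def t_def)
qed

text \<open>The working form of the group: from here on the determinant occurs only as the product
  of the diagonal entries.\<close>

lemma carrier_upper_SL:
  "carrier (upper_SL n R) =
     {A \<in> matrices n R. upper_tri n R A \<and> (\<Otimes>i\<in>{..<n}. A (i, i)) = \<one>}"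
  by (auto simp: upper_SL_def SL_def mat_det_upper_tri upper_tri_def[symmetric])

lemma mat_mult_upper_SL [simp]: "A \<otimes>\<^bsub>upper_SL n R\<^esub> B = mat_mult n R A B"
  and mat_one_upper_SL [simp]: "\<one>\<^bsub>upper_SL n R\<^esub> = mat_scalar n R \<one>"
  by (simp_all add: upper_SL_def SL_def)

text \<open>Back substitution: the equations \<open>B A = 1\<close> for one row \<open>b\<close> of \<open>B\<close> are solved from left to right.\<close>

lemma upper_tri_row_solve:
  assumes A: "A \<in> matrices n R" and U: "\<And>i. i < n \<Longrightarrow> A (i, i) \<in> Units R"
    and c: "\<And>j. c j \<in> carrier R" and m: "m \<le> n"
  shows "\<exists>b. (\<forall>k. b k \<in> carrier R) \<and> (\<forall>j<m. (\<Oplus>k\<in>{..j}. b k \<otimes> A (k, j)) = c j)"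
  using m
proof (induction m)
  case 0
  show ?case by (rule exI[of _ "\<lambda>_. \<zero>"]) auto
next
  case (Suc m)
  note cl = matrices_entry[OF A]
  obtain b where b: "\<And>k. b k \<in> carrier R" "\<And>j. j < m \<Longrightarrow> (\<Oplus>k\<in>{..j}. b k \<otimes> A (k, j)) = c j"
    using Suc by auto
  have Um: "A (m, m) \<in> Units R" using U Suc by auto
  define s where "s = (\<Oplus>k\<in>{..<m}. b k \<otimes> A (k, m))"
  have s: "s \<in> carrier R"
    unfolding s_def using b cl Suc by (auto intro!: finsum_closed)
  \<comment> \<open>A change of b m leaves the equations of the columns j < m intact, since these
    involve only b k with k \<le> j. In column m its coefficient is the unit A (m, m).\<close>
  define x where "x = (c m \<ominus> s) \<otimes> inv (A (m, m))"
  define b' where "b' = b(m := x)"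
  have x: "x \<in> carrier R" using s c Um by (auto simp: x_def)
  have b': "b' k \<in> carrier R" for k using b x by (simp add: b'_def)
  have "(\<Oplus>k\<in>{..j}. b' k \<otimes> A (k, j)) = c j" if j: "j < Suc m" for j
  proof (cases "j = m")
    case False
    then have "(\<Oplus>k\<in>{..j}. b' k \<otimes> A (k, j)) = (\<Oplus>k\<in>{..j}. b k \<otimes> A (k, j))"
      using j b cl Suc by (intro finsum_cong') (auto simp: b'_def)
    then show ?thesis using b False j by auto
  next
    case True
    have "(\<Oplus>k\<in>{..m}. b' k \<otimes> A (k, m)) = (\<Oplus>k\<in>insert m {..<m}. b' k \<otimes> A (k, m))"
      by (rule arg_cong[of _ _ "finsum R _"]) auto
    also have "\<dots> = b' m \<otimes> A (m, m) \<oplus> (\<Oplus>k\<in>{..<m}. b' k \<otimes> A (k, m))"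
      using b' cl Suc by (intro finsum_insert) auto
    also have "(\<Oplus>k\<in>{..<m}. b' k \<otimes> A (k, m)) = s"
      unfolding s_def using b cl Suc by (intro finsum_cong') (auto simp: b'_def)
    also have "b' m \<otimes> A (m, m) = (c m \<ominus> s) \<otimes> (inv (A (m, m)) \<otimes> A (m, m))"
      using s c Um Units_closed[OF Um] by (simp add: b'_def x_def m_assoc)
    also have "\<dots> \<oplus> s = c m"
      using s c[of m] Um by (simp, algebra)
    finally show ?thesis using True by simp
  qed
  then show ?case using b' by blast
qed

lemma finsum_upper_tri_col:
  assumes A: "A \<in> matrices n R" "upper_tri n R A" and b: "\<And>k. b k \<in> carrier R" and j: "j < n"
  shows "(\<Oplus>k\<in>{..<n}. b k \<otimes> A (k, j)) = (\<Oplus>k\<in>{..j}. b k \<otimes> A (k, j))"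
proof (rule add.finprod_mono_neutral_cong_right)
  fix k assume "k \<in> {..<n} - {..j}"
  then show "b k \<otimes> A (k, j) = \<zero>" using A b by (auto simp: upper_tri_zero)
qed (use j b matrices_entry[OF A(1)] in auto)

text \<open>The product of the other factors is an inverse. Determinant one thus makes every pivot
  of a triangular matrix a unit.\<close>

lemma finprod_one_Units:
  assumes "finite A" "f \<in> A \<rightarrow> carrier R" "(\<Otimes>i\<in>A. f i) = \<one>" "a \<in> A"
  shows "f a \<in> Units R"
proof -
  have A: "A = insert a (A - {a})" using assms by auto
  have "(\<Otimes>i\<in>A. f i) = f a \<otimes> (\<Otimes>i\<in>A - {a}. f i)"
    using assms by (subst A, subst finprod_insert) (auto simp: Pi_def)
  moreover have "(\<Otimes>i\<in>A - {a}. f i) \<in> carrier R"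
    using assms by (intro finprod_closed) auto
  ultimately show ?thesis using assms m_comm unfolding Units_def by fastforce
qed

lemma upper_SL_diag_Units: "A \<in> carrier (upper_SL n R) \<Longrightarrow> i < n \<Longrightarrow> A (i, i) \<in> Units R"
  using finprod_one_Units[of "{..<n}" "\<lambda>i. A (i, i)" i]
  by (auto simp: carrier_upper_SL matrices_entry)

text \<open>Back substitution yields the rows of a left inverse B but says nothing about its shape;
  triangularity and determinant one are derived afterwards from BA = 1.\<close>

lemma upper_SL_left_inverse:
  assumes "A \<in> carrier (upper_SL n R)"
  shows "\<exists>B \<in> carrier (upper_SL n R). mat_mult n R B A = mat_scalar n R \<one>"
proof -
  have A: "A \<in> matrices n R" "upper_tri n R A" and d: "(\<Otimes>i\<in>{..<n}. A (i, i)) = \<one>"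
    using assms by (auto simp: carrier_upper_SL)
  note cl = matrices_entry[OF A(1)]
  have U: "A (i, i) \<in> Units R" if "i < n" for i
    using upper_SL_diag_Units[OF assms that] .
  have "\<exists>b. (\<forall>k. b k \<in> carrier R) \<and>
      (\<forall>j<n. (\<Oplus>k\<in>{..j}. b k \<otimes> A (k, j)) = (if i = j then \<one> else \<zero>))" for i
    using upper_tri_row_solve[OF A(1) U, of "\<lambda>j. if i = j then \<one> else \<zero>" n] by auto
  then obtain b where b: "\<And>i k. b i k \<in> carrier R"
    and eq: "\<And>i j. j < n \<Longrightarrow> (\<Oplus>k\<in>{..j}. b i k \<otimes> A (k, j)) = (if i = j then \<one> else \<zero>)"
    by metis
  define B where "B = (\<lambda>(i, j)\<in>{..<n} \<times> {..<n}. b i j)"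
  have B: "B \<in> matrices n R" using b by (auto simp: B_def matrices_def)
  have BA: "mat_mult n R B A = mat_scalar n R \<one>"
  proof (rule matrices_eqI[OF mat_mult_closed[OF B A(1)] mat_scalar_closed[OF one_closed]])
    fix i j assume ij: "i < n" "j < n"
    have "(\<Oplus>k\<in>{..<n}. B (i, k) \<otimes> A (k, j)) = (\<Oplus>k\<in>{..<n}. b i k \<otimes> A (k, j))"
      using ij b cl by (intro finsum_cong') (auto simp: B_def)
    then show "mat_mult n R B A (i, j) = mat_scalar n R \<one> (i, j)"
      using ij by (simp add: mat_mult_def mat_scalar_def finsum_upper_tri_col[OF A b] eq)
  qed
  \<comment> \<open>Induction on the column: once the b i k with k < j vanish, the j-th equation
    reads b i j times the pivot A (j, j) equals zero, and the pivot cancels.\<close>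
  have low: "b i j = \<zero>" if "j < i" "i < n" for i j
    using that
  proof (induction j rule: less_induct)
    case (less j)
    have "(\<Oplus>k\<in>{..j}. b i k \<otimes> A (k, j)) = b i j \<otimes> A (j, j)"
      using less b cl by (intro finsum_single) auto
    then have "b i j \<otimes> A (j, j) = \<zero>" using eq[of j i] less by simp
    then have "b i j \<otimes> (A (j, j) \<otimes> inv (A (j, j))) = \<zero>"
      using b U[of j] less by (simp add: m_assoc[symmetric] Units_closed del: Units_r_inv)
    then show ?case using b U[of j] less by simp
  qed
  have Bu: "upper_tri n R B"
    using low by (auto simp: upper_tri_def B_def)
  have "B (i, i) \<otimes> A (i, i) = \<one>" if "i < n" for i
    using upper_tri_mult_diag[OF B A(1) Bu A(2) that] BA that by (simp add: mat_scalar_def)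
  then have "(\<Otimes>i\<in>{..<n}. B (i, i) \<otimes> A (i, i)) = \<one>"
    by (intro finprod_one_eqI) auto
  then have "(\<Otimes>i\<in>{..<n}. B (i, i)) = \<one>"
    using d cl matrices_entry[OF B] by (subst (asm) finprod_multf) (auto simp: finprod_closed Pi_def)
  then show ?thesis using B Bu BA by (auto simp: carrier_upper_SL)
qed

lemma mat_scalar_one_upper_SL: "mat_scalar n R \<one> \<in> carrier (upper_SL n R)"
  unfolding carrier_upper_SL
  by (auto simp: mat_scalar_closed upper_tri_def intro!: finprod_one_eqI) (auto simp: mat_scalar_def)

lemma group_upper_SL: "group (upper_SL n R)"
proof (rule groupI)
  fix A B assume "A \<in> carrier (upper_SL n R)" "B \<in> carrier (upper_SL n R)"
  then have AB: "A \<in> matrices n R" "upper_tri n R A" "(\<Otimes>i\<in>{..<n}. A (i, i)) = \<one>"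
    "B \<in> matrices n R" "upper_tri n R B" "(\<Otimes>i\<in>{..<n}. B (i, i)) = \<one>"
    by (auto simp: carrier_upper_SL)
  note cl = matrices_entry[OF AB(1)] matrices_entry[OF AB(4)]
  have "(\<Otimes>i\<in>{..<n}. mat_mult n R A B (i, i)) = (\<Otimes>i\<in>{..<n}. A (i, i) \<otimes> B (i, i))"
    using AB cl by (intro finprod_cong') (auto simp: upper_tri_mult_diag)
  also have "\<dots> = \<one>"
    using AB cl by (subst finprod_multf) (auto simp: Pi_def)
  finally show "A \<otimes>\<^bsub>upper_SL n R\<^esub> B \<in> carrier (upper_SL n R)"
    using AB by (auto simp: carrier_upper_SL mat_mult_closed upper_tri_mult_below)
next
  fix A assume A: "A \<in> carrier (upper_SL n R)"
  then show "\<exists>B\<in>carrier (upper_SL n R). B \<otimes>\<^bsub>upper_SL n R\<^esub> A = \<one>\<^bsub>upper_SL n R\<^esub>"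
    using upper_SL_left_inverse by simp
next
  show "\<one>\<^bsub>upper_SL n R\<^esub> \<in> carrier (upper_SL n R)"
    by (simp add: mat_scalar_one_upper_SL)
qed (simp_all add: mat_mult_assoc mat_one_mult carrier_upper_SL)

end

section \<open>Change of the base ring\<close>

lemma mat_map_entry [simp]: "i < n \<Longrightarrow> j < n \<Longrightarrow> mat_map n f A (i, j) = f (A (i, j))"
  by (simp add: mat_map_def)

lemma (in ring_hom_cring) mat_map_closed:
  "A \<in> matrices n R \<Longrightarrow> mat_map n h A \<in> matrices n S"
  by (auto simp: mat_map_def matrices_def)

text \<open>Applied to the embedding of the localised integers into \<open>QP\<close>, which maps
  \<Gamma> to G, and, with \<open>id\<close> as the homomorphism, to the inclusion of the ring of
  integral elements, which shows that inverses of integral matrices are integral.\<close>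

lemma (in ring_hom_cring) mat_map_hom: "mat_map n h \<in> hom (upper_SL n R) (upper_SL n S)"
proof (rule homI)
  fix A assume "A \<in> carrier (upper_SL n R)"
  then have A: "A \<in> matrices n R" "upper_tri n R A" "(\<Otimes>i\<in>{..<n}. A (i, i)) = \<one>"
    by (auto simp: R.carrier_upper_SL)
  note cl = matrices_entry[OF A(1)]
  have "(\<Otimes>\<^bsub>S\<^esub>i\<in>{..<n}. mat_map n h A (i, i)) = h (\<Otimes>i\<in>{..<n}. A (i, i))"
    using cl by (subst hom_finprod) (auto intro!: S.finprod_cong')
  then show "mat_map n h A \<in> carrier (upper_SL n S)"
    using A cl by (auto simp: S.carrier_upper_SL mat_map_closed upper_tri_def)
next
  fix A B assume "A \<in> carrier (upper_SL n R)" "B \<in> carrier (upper_SL n R)"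
  then have AB: "A \<in> matrices n R" "B \<in> matrices n R"
    by (auto simp: R.carrier_upper_SL)
  note cl = matrices_entry[OF AB(1)] matrices_entry[OF AB(2)]
  have "mat_map n h (mat_mult n R A B) = mat_mult n S (mat_map n h A) (mat_map n h B)"
  proof (rule matrices_eqI)
    fix i j assume ij: "i < n" "j < n"
    show "mat_map n h (mat_mult n R A B) (i, j) =
        mat_mult n S (mat_map n h A) (mat_map n h B) (i, j)"
      using ij cl by (auto simp: mat_mult_def intro!: S.finsum_cong')
  qed (use AB in \<open>auto intro!: mat_map_closed R.mat_mult_closed S.mat_mult_closed\<close>)
  then show "mat_map n h (A \<otimes>\<^bsub>upper_SL n R\<^esub> B) =
      mat_map n h A \<otimes>\<^bsub>upper_SL n S\<^esub> mat_map n h B" by simp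
qed

lemma mat_map_id: "A \<in> matrices n R \<Longrightarrow> mat_map n id A = A"
  by (auto simp: mat_map_def matrices_def restrict_def PiE_def extensional_def fun_eq_iff)

section \<open>The \<open>p\<close>-adic absolute value\<close>

text \<open>\<open>padic_val\<close> refers to the reduced fraction. Cross multiplication shows that
  any fraction computes it, so that two rationals can be put over a common denominator.\<close>

lemma padic_val_of_int_div:
  assumes p: "prime p" and ab: "a \<noteq> 0" "b \<noteq> 0"
  shows "padic_val p (of_int a / of_int b) =
    int (multiplicity (int p) a) - int (multiplicity (int p) b)"
proof -
  obtain c d where cd: "quotient_of (of_int a / of_int b) = (c, d)" by fastforce
  have d: "d > 0" using quotient_of_denom_pos[OF cd] .
  have "(of_int a / of_int b :: rat) = of_int c / of_int d" using quotient_of_div[OF cd] .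
  then have "(of_int (a * d) :: rat) = of_int (c * b)" using ab d by (simp add: field_simps)
  then have eq: "a * d = c * b" by (simp only: of_int_eq_iff)
  then have c: "c \<noteq> 0" using ab d by auto
  have "prime (int p)" using p by simp
  then have "multiplicity (int p) a + multiplicity (int p) d =
      multiplicity (int p) c + multiplicity (int p) b"
    using ab c d eq
    by (metis less_irrefl prime_elem_multiplicity_mult_distrib prime_imp_prime_elem)
  then show ?thesis by (simp add: padic_val_def cd)
qed

lemma rat_as_fraction:
  fixes x :: rat
  obtains a b where "x = of_int a / of_int b" "b \<noteq> 0"
  by (metis div_by_1 of_int_1 quotient_of_div quotient_of_denom_pos less_irrefl surj_pair)

locale prime_number =
  fixes p :: nat
  assumes prime_p: "prime p"
begin

lemma p_gt_1: "real p > 1"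
  using prime_gt_1_nat[OF prime_p] by simp

lemma prime_elem_p: "prime_elem (int p)"
  using prime_p by simp

lemma padic_val_mult:
  assumes "x \<noteq> 0" "y \<noteq> 0"
  shows "padic_val p (x * y) = padic_val p x + padic_val p y"
proof -
  obtain a b where x: "x = of_int a / of_int b" "b \<noteq> 0" by (rule rat_as_fraction)
  obtain c d where y: "y = of_int c / of_int d" "d \<noteq> 0" by (rule rat_as_fraction)
  have nz: "a \<noteq> 0" "c \<noteq> 0" using x y assms by auto
  have xy: "x * y = of_int (a * c) / of_int (b * d)" using x y by simp
  have "a * c \<noteq> 0" "b * d \<noteq> 0" using nz x y by auto
  then show ?thesis
    unfolding xy unfolding x(1) y(1)
    using nz x(2) y(2) padic_val_of_int_div[OF prime_p]
      prime_elem_multiplicity_mult_distrib[OF prime_elem_p]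
    by (metis (no_types, lifting) add_diff_add of_nat_add)
qed

text \<open>Over the common denominator b * d, a power of p that divides both numerators divides
  their sum.\<close>

lemma padic_val_add:
  assumes "x \<noteq> 0" "y \<noteq> 0" "x + y \<noteq> 0"
  shows "padic_val p (x + y) \<ge> min (padic_val p x) (padic_val p y)"
proof -
  obtain a b where x: "x = of_int a / of_int b" "b \<noteq> 0" by (rule rat_as_fraction)
  obtain c d where y: "y = of_int c / of_int d" "d \<noteq> 0" by (rule rat_as_fraction)
  have x': "x = of_int (a * d) / of_int (b * d)" and y': "y = of_int (c * b) / of_int (b * d)"
    using x y by simp_all
  have s: "x + y = of_int (a * d + c * b) / of_int (b * d)"
    unfolding x' y' by (simp add: add_divide_distrib)
  have nz: "a * d \<noteq> 0" "c * b \<noteq> 0" "a * d + c * b \<noteq> 0" "b * d \<noteq> 0"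
    using assms x y s by (auto simp del: of_int_add)
  define k where "k = min (multiplicity (int p) (a * d)) (multiplicity (int p) (c * b))"
  have "int p ^ k dvd a * d" "int p ^ k dvd c * b"
    by (auto simp: k_def intro!: multiplicity_dvd')
  then have "int p ^ k dvd a * d + c * b" by simp
  then have "k \<le> multiplicity (int p) (a * d + c * b)"
    using nz prime_elem_p by (intro multiplicity_geI) (auto simp: prime_elem_def)
  moreover have "padic_val p x = int (multiplicity (int p) (a * d)) - int (multiplicity (int p) (b * d))"
    "padic_val p y = int (multiplicity (int p) (c * b)) - int (multiplicity (int p) (b * d))"
    "padic_val p (x + y) = int (multiplicity (int p) (a * d + c * b)) - int (multiplicity (int p) (b * d))"
    unfolding s unfolding x' y' using nz by (simp_all only: padic_val_of_int_div[OF prime_p] simp_thms)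
  ultimately show ?thesis unfolding k_def by linarith
qed

section \<open>Multiplicativity and the ultrametric inequality\<close>

lemma padic_abs_zero [simp]: "padic_abs p 0 = 0"
  by (simp add: padic_abs_def)

lemma padic_abs_one [simp]: "padic_abs p 1 = 1"
  by (simp add: padic_abs_def padic_val_def)

lemma padic_abs_nonneg [simp]: "padic_abs p x \<ge> 0"
  by (simp add: padic_abs_def)

lemma padic_abs_eq_0_iff [simp]: "padic_abs p x = 0 \<longleftrightarrow> x = 0"
  using p_gt_1 by (auto simp: padic_abs_def)

lemma padic_abs_mult: "padic_abs p (x * y) = padic_abs p x * padic_abs p y"
  using p_gt_1 padic_val_mult[of x y] by (auto simp: padic_abs_def power_int_add[symmetric])

lemma padic_abs_minus [simp]: "padic_abs p (- x) = padic_abs p x"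
proof -
  have "padic_abs p (- 1) * padic_abs p (- 1) = padic_abs p 1"
    by (simp add: padic_abs_mult[symmetric] del: padic_abs_one)
  then have "padic_abs p (- 1) = 1"
    using padic_abs_nonneg[of "- 1"] by (simp add: square_eq_1_iff)
  then show ?thesis using padic_abs_mult[of "- 1" x] by simp
qed

lemma padic_abs_diff_commute: "padic_abs p (x - y) = padic_abs p (y - x)"
  using padic_abs_minus[of "x - y"] by simp

lemma padic_abs_add: "padic_abs p (x + y) \<le> max (padic_abs p x) (padic_abs p y)"
proof (cases "x = 0 \<or> y = 0 \<or> x + y = 0")
  case True
  then show ?thesis by (auto simp: le_max_iff_disj)
next
  case False
  have mono: "real p powi (- i) \<le> real p powi (- j)" if "j \<le> i" for i j
    using that p_gt_1 by (intro power_int_increasing) auto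
  have "padic_val p x \<le> padic_val p (x + y) \<or> padic_val p y \<le> padic_val p (x + y)"
    using padic_val_add[of x y] False by (auto simp: min_le_iff_disj)
  then show ?thesis
    using False mono by (auto simp: padic_abs_def le_max_iff_disj)
qed

lemma padic_abs_diff: "padic_abs p (x - y) \<le> max (padic_abs p x) (padic_abs p y)"
  using padic_abs_add[of x "- y"] by simp

lemma padic_abs_add_le: "padic_abs p x \<le> e \<Longrightarrow> padic_abs p y \<le> e \<Longrightarrow> padic_abs p (x + y) \<le> e"
  using padic_abs_add[of x y] by linarith

lemma padic_abs_triangle: "padic_abs p (x + y) \<le> padic_abs p x + padic_abs p y"
  using padic_abs_add[of x y] padic_abs_nonneg[of x] padic_abs_nonneg[of y] by linarith

lemma padic_abs_reverse: "\<bar>padic_abs p x - padic_abs p y\<bar> \<le> padic_abs p (x - y)"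
  using padic_abs_triangle[of "x - y" y] padic_abs_triangle[of "y - x" x] padic_abs_diff_commute[of x y]
  by simp

lemma padic_abs_of_int_le:
  assumes "int p ^ k dvd a"
  shows "padic_abs p (of_int a) \<le> real p powi (- int k)"
proof (cases "a = 0")
  case True
  then show ?thesis by simp
next
  case False
  then have "k \<le> multiplicity (int p) a"
    using assms prime_elem_p by (intro multiplicity_geI) (auto simp: prime_elem_def)
  then show ?thesis
    using False p_gt_1 padic_val_of_int_div[OF prime_p False, of 1]
    by (auto simp: padic_abs_def intro!: power_int_increasing)
qed

lemma padic_abs_of_int_le_1: "padic_abs p (of_int a) \<le> 1"
  using padic_abs_of_int_le[of 0 a] by simp

lemma padic_abs_of_int_unit: "\<not> int p dvd a \<Longrightarrow> padic_abs p (of_int a) = 1"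
  using padic_val_of_int_div[OF prime_p, of a 1]
  by (cases "a = 0") (auto simp: padic_abs_def not_dvd_imp_multiplicity_0)

lemma padic_abs_p: "padic_abs p (of_nat p) = 1 / real p"
proof -
  have "padic_val p (of_nat p) = 1"
    using padic_val_of_int_div[OF prime_p, of "int p" 1] prime_elem_p p_gt_1
    by (simp add: prime_elem_def)
  then show ?thesis using p_gt_1 by (simp add: padic_abs_def power_int_minus field_simps)
qed

lemma padic_abs_power: "padic_abs p (x ^ k) = padic_abs p x ^ k"
  by (induction k) (simp_all add: padic_abs_mult)

lemma padic_abs_inverse: "padic_abs p (inverse x) = inverse (padic_abs p x)"
proof (cases "x = 0")
  case False
  then have "padic_abs p x * padic_abs p (inverse x) = 1"
    by (simp add: padic_abs_mult[symmetric])
  then show ?thesis by (metis inverse_unique)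
qed simp

lemma padic_abs_powi: "padic_abs p (x powi k) = padic_abs p x powi k"
  by (simp add: power_int_def padic_abs_power padic_abs_inverse)

end

section \<open>The \<open>p\<close>-adic numbers\<close>

context prime_number
begin

abbreviation "CR \<equiv> padic_cauchy_ring p"
abbreviation "NI \<equiv> padic_null_ideal p"
abbreviation "Q \<equiv> padic_field p"

section \<open>The ring of Cauchy sequences\<close>

lemma Metric_space_padic_abs: "Metric_space UNIV (\<lambda>x y. padic_abs p (x - y))"
proof
  fix x y z :: rat
  show "padic_abs p (x - z) \<le> padic_abs p (x - y) + padic_abs p (y - z)"
    using padic_abs_triangle[of "x - y" "y - z"] by simp
qed (auto simp: padic_abs_diff_commute)

lemma cauchy_iff: "s \<in> carrier CR \<longleftrightarrow> (\<forall>e>0. \<exists>N. \<forall>k\<ge>N. \<forall>l\<ge>N. padic_abs p (s k - s l) < e)"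
  by (auto simp: padic_cauchy_ring_def Metric_space.MCauchy_def[OF Metric_space_padic_abs])

lemma CR_simps [simp]:
  "s \<otimes>\<^bsub>CR\<^esub> t = (\<lambda>k. s k * t k)" "s \<oplus>\<^bsub>CR\<^esub> t = (\<lambda>k. s k + t k)"
  "\<one>\<^bsub>CR\<^esub> = (\<lambda>_. 1)" "\<zero>\<^bsub>CR\<^esub> = (\<lambda>_. 0)"
  by (simp_all add: padic_cauchy_ring_def)

lemma cauchy_const: "(\<lambda>_. x) \<in> carrier CR"
  by (simp add: cauchy_iff)

text \<open>By the reverse triangle inequality the absolute values form a real Cauchy sequence. Its
  limit becomes the norm of the class, and its boundedness is what products of Cauchy sequences rely
  on.\<close>

lemma cauchy_abs_convergent:
  assumes "s \<in> carrier CR"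
  shows "convergent (\<lambda>k. padic_abs p (s k))"
proof -
  have "Cauchy (\<lambda>k. padic_abs p (s k))"
  proof (rule metric_CauchyI)
    fix e :: real assume "e > 0"
    then obtain N where "\<forall>k\<ge>N. \<forall>l\<ge>N. padic_abs p (s k - s l) < e"
      using assms by (auto simp: cauchy_iff)
    then show "\<exists>N. \<forall>k\<ge>N. \<forall>l\<ge>N. dist (padic_abs p (s k)) (padic_abs p (s l)) < e"
      using padic_abs_reverse by (metis dist_real_def le_less_trans)
  qed
  then show ?thesis by (rule real_Cauchy_convergent)
qed

lemma cauchy_bounded:
  assumes "s \<in> carrier CR"
  obtains B where "B > 0" "\<And>k. padic_abs p (s k) \<le> B"
proof -
  have "Bseq (\<lambda>k. padic_abs p (s k))"
    using cauchy_abs_convergent[OF assms] by (rule convergent_imp_Bseq)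
  then show ?thesis using that by (auto simp: Bseq_def)
qed

lemma cauchy_add:
  assumes "s \<in> carrier CR" "t \<in> carrier CR"
  shows "(\<lambda>k. s k + t k) \<in> carrier CR"
  unfolding cauchy_iff
proof (intro allI impI)
  fix e :: real assume "e > 0"
  then obtain N M where "\<forall>k\<ge>N. \<forall>l\<ge>N. padic_abs p (s k - s l) < e" "\<forall>k\<ge>M. \<forall>l\<ge>M. padic_abs p (t k - t l) < e"
    using assms by (meson cauchy_iff)
  moreover have "padic_abs p ((s k + t k) - (s l + t l)) \<le> max (padic_abs p (s k - s l)) (padic_abs p (t k - t l))" for k l
    using padic_abs_add[of "s k - s l" "t k - t l"] by (simp add: algebra_simps)
  ultimately have "\<forall>k\<ge>max N M. \<forall>l\<ge>max N M. padic_abs p ((s k + t k) - (s l + t l)) < e"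
    by (meson le_less_trans max.boundedE max_less_iff_conj)
  then show "\<exists>N. \<forall>k\<ge>N. \<forall>l\<ge>N. padic_abs p ((s k + t k) - (s l + t l)) < e" by blast
qed

lemma cauchy_uminus: "s \<in> carrier CR \<Longrightarrow> (\<lambda>k. - s k) \<in> carrier CR"
  by (simp add: cauchy_iff) (metis add.commute padic_abs_diff_commute uminus_add_conv_diff)

lemma cauchy_mult:
  assumes "s \<in> carrier CR" "t \<in> carrier CR"
  shows "(\<lambda>k. s k * t k) \<in> carrier CR"
  unfolding cauchy_iff
proof (intro allI impI)
  fix e :: real assume e: "e > 0"
  obtain B where B: "B > 0" "\<And>k. padic_abs p (s k) \<le> B" using cauchy_bounded assms(1) by blast
  obtain B' where B': "B' > 0" "\<And>k. padic_abs p (t k) \<le> B'" using cauchy_bounded assms(2) by blast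
  obtain N where N: "\<forall>k\<ge>N. \<forall>l\<ge>N. padic_abs p (s k - s l) < e / B'"
    using assms(1) e B' by (meson cauchy_iff divide_pos_pos)
  obtain M where M: "\<forall>k\<ge>M. \<forall>l\<ge>M. padic_abs p (t k - t l) < e / B"
    using assms(2) e B by (meson cauchy_iff divide_pos_pos)
  have "padic_abs p (s k * t k - s l * t l) < e" if kl: "k \<ge> max N M" "l \<ge> max N M" for k l
  proof -
    have "s k * t k - s l * t l = s k * (t k - t l) + (s k - s l) * t l" by (simp add: algebra_simps)
    then have "padic_abs p (s k * t k - s l * t l) \<le>
        max (padic_abs p (s k) * padic_abs p (t k - t l)) (padic_abs p (s k - s l) * padic_abs p (t l))"
      using padic_abs_add by (metis padic_abs_mult)
    moreover have "padic_abs p (s k) * padic_abs p (t k - t l) \<le> B * padic_abs p (t k - t l)"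
      using B by (intro mult_right_mono) auto
    moreover have "B * padic_abs p (t k - t l) < e"
      using M kl B by (simp add: field_simps)
    moreover have "padic_abs p (s k - s l) * padic_abs p (t l) \<le> padic_abs p (s k - s l) * B'"
      using B' by (intro mult_left_mono) auto
    moreover have "padic_abs p (s k - s l) * B' < e"
      using N kl B' by (simp add: field_simps)
    ultimately show ?thesis by linarith
  qed
  then show "\<exists>N. \<forall>k\<ge>N. \<forall>l\<ge>N. padic_abs p (s k * t k - s l * t l) < e" by blast
qed

lemma cring_CR: "cring CR"
proof (rule cringI)
  show "abelian_group CR"
  proof (rule abelian_groupI)
    fix s assume s: "s \<in> carrier CR"
    then show "\<exists>t\<in>carrier CR. t \<oplus>\<^bsub>CR\<^esub> s = \<zero>\<^bsub>CR\<^esub>"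
      by (intro bexI[of _ "\<lambda>k. - s k"]) (auto simp: cauchy_uminus)
  qed (auto simp: cauchy_add cauchy_const add_ac)
  show "comm_monoid CR"
    by (rule comm_monoidI) (auto simp: cauchy_mult cauchy_const mult_ac)
qed (auto simp: algebra_simps)

sublocale CR: cring CR by (rule cring_CR)

lemma CR_minus [simp]: "s \<in> carrier CR \<Longrightarrow> \<ominus>\<^bsub>CR\<^esub> s = (\<lambda>k. - s k)"
  by (rule CR.minus_equality) (auto simp: cauchy_uminus)

lemma CR_diff [simp]: "s \<in> carrier CR \<Longrightarrow> t \<in> carrier CR \<Longrightarrow> s \<ominus>\<^bsub>CR\<^esub> t = (\<lambda>k. s k - t k)"
  by (simp add: a_minus_def)

section \<open>Null sequences and the quotient field\<close>

lemma null_iff: "s \<in> NI \<longleftrightarrow> s \<in> carrier CR \<and> (\<lambda>k. padic_abs p (s k)) \<longlonglongrightarrow> 0"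
  by (simp add: padic_null_ideal_def)

lemma null_mult:
  assumes "s \<in> NI" "t \<in> carrier CR"
  shows "(\<lambda>k. s k * t k) \<in> NI"
proof -
  obtain B where B: "B > 0" "\<And>k. padic_abs p (t k) \<le> B" using cauchy_bounded assms(2) by blast
  have "(\<lambda>k. B * padic_abs p (s k)) \<longlonglongrightarrow> B * 0"
    using assms by (intro tendsto_mult) (auto simp: null_iff)
  then have lim: "(\<lambda>k. B * padic_abs p (s k)) \<longlonglongrightarrow> 0" by simp
  have "padic_abs p (s k * t k) \<le> B * padic_abs p (s k)" for k
    using mult_left_mono[OF B(2) padic_abs_nonneg[of "s k"], of k] by (simp add: padic_abs_mult mult.commute)
  then have "(\<lambda>k. padic_abs p (s k * t k)) \<longlonglongrightarrow> 0"
    by (intro tendsto_sandwich[OF _ _ tendsto_const lim]) auto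
  then show ?thesis using assms by (auto simp: null_iff cauchy_mult)
qed

lemma ideal_NI: "ideal NI CR"
proof (rule idealI)
  show "ring CR" ..
  show "subgroup NI (add_monoid CR)"
  proof (rule group.subgroupI[OF CR.a_group])
    show "NI \<subseteq> carrier (add_monoid CR)" by (auto simp: null_iff)
    have "(\<lambda>_. 0) \<in> NI" by (simp add: null_iff cauchy_const)
    then show "NI \<noteq> {}" by blast
    fix s assume s: "s \<in> NI"
    then have "inv\<^bsub>add_monoid CR\<^esub> s = (\<lambda>k. - s k)"
      using CR_minus[of s] by (simp add: a_inv_def null_iff del: CR_minus)
    then show "inv\<^bsub>add_monoid CR\<^esub> s \<in> NI"
      using s by (simp add: null_iff cauchy_uminus)
    fix t assume t: "t \<in> NI"
    have lim: "(\<lambda>k. padic_abs p (s k) + padic_abs p (t k)) \<longlonglongrightarrow> 0"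
      using s t tendsto_add[of "\<lambda>k. padic_abs p (s k)" 0 sequentially "\<lambda>k. padic_abs p (t k)" 0]
      by (simp add: null_iff)
    have "(\<lambda>k. padic_abs p (s k + t k)) \<longlonglongrightarrow> 0"
      by (intro tendsto_sandwich[OF _ _ tendsto_const lim]) (auto simp: padic_abs_triangle)
    then show "s \<otimes>\<^bsub>add_monoid CR\<^esub> t \<in> NI"
      using s t by (simp add: null_iff cauchy_add)
  qed
next
  fix s t assume st: "s \<in> NI" "t \<in> carrier CR"
  show "s \<otimes>\<^bsub>CR\<^esub> t \<in> NI" using null_mult[OF st] by simp
  then show "t \<otimes>\<^bsub>CR\<^esub> s \<in> NI" by (simp add: mult.commute)
qed

sublocale NI: ideal NI CR by (rule ideal_NI)

lemma cring_Q: "cring Q"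
  unfolding padic_field_def by (rule NI.quotient_is_cring[OF cring_CR])

sublocale Q: cring Q by (rule cring_Q)

definition cls :: "(nat \<Rightarrow> rat) \<Rightarrow> (nat \<Rightarrow> rat) set" where
  "cls s = NI +>\<^bsub>CR\<^esub> s"

lemma cls_hom: "cls \<in> ring_hom CR Q"
  using NI.rcos_ring_hom unfolding padic_field_def cls_def[abs_def] .

sublocale cls: ring_hom_cring CR Q cls
  using cls_hom by unfold_locales

lemma carrier_Q: "carrier Q = cls ` carrier CR"
  by (auto simp: padic_field_def FactRing_def A_RCOSETS_defs cls_def a_r_coset_def)

lemma cls_mem_iff:
  assumes "s \<in> carrier CR"
  shows "t \<in> cls s \<longleftrightarrow> t \<in> carrier CR \<and> (\<lambda>k. padic_abs p (t k - s k)) \<longlonglongrightarrow> 0"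
proof
  assume "t \<in> cls s"
  then obtain h where "h \<in> NI" "t = (\<lambda>k. h k + s k)"
    by (auto simp: cls_def a_r_coset_def r_coset_def)
  then show "t \<in> carrier CR \<and> (\<lambda>k. padic_abs p (t k - s k)) \<longlonglongrightarrow> 0"
    using assms by (auto simp: null_iff cauchy_add)
next
  assume t: "t \<in> carrier CR \<and> (\<lambda>k. padic_abs p (t k - s k)) \<longlonglongrightarrow> 0"
  then have "(\<lambda>k. t k - s k) \<in> NI"
    using assms cauchy_add[of t "\<lambda>k. - s k"] by (simp add: null_iff cauchy_uminus)
  then show "t \<in> cls s"
    by (force simp: cls_def a_r_coset_def r_coset_def)
qed

text \<open>\<open>padic_norm\<close> is a definite description over all representatives. These
  differ by null sequences, so their absolute values share one limit, and the description picks
  it.\<close>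

lemma padic_norm_cls:
  assumes s: "s \<in> carrier CR"
  shows "(\<lambda>k. padic_abs p (s k)) \<longlonglongrightarrow> padic_norm p (cls s)"
proof -
  obtain r where r: "(\<lambda>k. padic_abs p (s k)) \<longlonglongrightarrow> r"
    using cauchy_abs_convergent[OF s] by (auto simp: convergent_def)
  have all: "(\<lambda>k. padic_abs p (t k)) \<longlonglongrightarrow> r" if t: "t \<in> cls s" for t
  proof -
    have lim: "(\<lambda>k. padic_abs p (t k - s k)) \<longlonglongrightarrow> 0"
      using t s by (simp add: cls_mem_iff)
    have "(\<lambda>k. padic_abs p (t k) - padic_abs p (s k)) \<longlonglongrightarrow> 0"
      by (rule tendsto_rabs_zero_cancel, rule tendsto_sandwich[OF _ _ tendsto_const lim])
         (auto simp: padic_abs_reverse)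
    from tendsto_add[OF this r] show ?thesis by simp
  qed
  have "s \<in> cls s" using s by (simp add: cls_mem_iff)
  then have "padic_norm p (cls s) = r"
    unfolding padic_norm_def using all LIMSEQ_unique r by (intro the_equality) blast+
  then show ?thesis using r by simp
qed

lemma padic_norm_cls_eqI:
  "s \<in> carrier CR \<Longrightarrow> (\<lambda>k. padic_abs p (s k)) \<longlonglongrightarrow> r \<Longrightarrow> padic_norm p (cls s) = r"
  using padic_norm_cls LIMSEQ_unique by blast

lemma padic_norm_nonneg: "x \<in> carrier Q \<Longrightarrow> padic_norm p x \<ge> 0"
  unfolding carrier_Q using LIMSEQ_le_const[OF padic_norm_cls, of _ 0] by auto

lemma padic_norm_mult:
  assumes "x \<in> carrier Q" "y \<in> carrier Q"
  shows "padic_norm p (x \<otimes>\<^bsub>Q\<^esub> y) = padic_norm p x * padic_norm p y"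
proof -
  obtain s t where st: "s \<in> carrier CR" "t \<in> carrier CR" "x = cls s" "y = cls t"
    using assms carrier_Q by auto
  have "x \<otimes>\<^bsub>Q\<^esub> y = cls (\<lambda>k. s k * t k)"
    using st cls.hom_mult[of s t] by simp
  then show ?thesis
    using st tendsto_mult[OF padic_norm_cls padic_norm_cls, of s t]
    by (simp add: padic_norm_cls_eqI cauchy_mult padic_abs_mult)
qed

lemma padic_norm_add:
  assumes "x \<in> carrier Q" "y \<in> carrier Q"
  shows "padic_norm p (x \<oplus>\<^bsub>Q\<^esub> y) \<le> max (padic_norm p x) (padic_norm p y)"
proof -
  obtain s t where st: "s \<in> carrier CR" "t \<in> carrier CR" "x = cls s" "y = cls t"
    using assms carrier_Q by auto
  have "x \<oplus>\<^bsub>Q\<^esub> y = cls (\<lambda>k. s k + t k)"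
    using st cls.hom_add[of s t] by simp
  then show ?thesis
    using LIMSEQ_le[OF padic_norm_cls[OF cauchy_add] tendsto_max[OF padic_norm_cls padic_norm_cls], of s t s t] st
    by (auto simp: padic_abs_add)
qed

lemma padic_norm_minus:
  assumes "x \<in> carrier Q"
  shows "padic_norm p (\<ominus>\<^bsub>Q\<^esub> x) = padic_norm p x"
proof -
  obtain s where s: "s \<in> carrier CR" "x = cls s" using assms carrier_Q by auto
  have "\<ominus>\<^bsub>Q\<^esub> x = cls (\<lambda>k. - s k)" using s cls.hom_a_inv[of s] by simp
  moreover have "padic_norm p (cls (\<lambda>k. - s k)) = padic_norm p x"
    using padic_norm_cls[OF s(1)] unfolding s(2)
    by (intro padic_norm_cls_eqI cauchy_uminus s(1)) simp
  ultimately show ?thesis by simp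
qed

lemma padic_norm_eq_0_iff:
  assumes "x \<in> carrier Q"
  shows "padic_norm p x = 0 \<longleftrightarrow> x = \<zero>\<^bsub>Q\<^esub>"
proof -
  obtain s where s: "s \<in> carrier CR" "x = cls s" using assms carrier_Q by auto
  have z: "\<zero>\<^bsub>Q\<^esub> = NI" by (simp add: padic_field_def FactRing_def)
  have "padic_norm p x = 0 \<longleftrightarrow> (\<lambda>k. padic_abs p (s k)) \<longlonglongrightarrow> 0"
    using padic_norm_cls[OF s(1)] s LIMSEQ_unique by auto
  also have "\<dots> \<longleftrightarrow> s \<in> NI" using s by (simp add: null_iff)
  also have "\<dots> \<longleftrightarrow> cls s = NI"
    using s NI.a_rcos_const NI.a_rcos_self unfolding cls_def by blast
  finally show ?thesis using s z by simp
qed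

lemma padic_of_rat_cls: "padic_of_rat p x = cls (\<lambda>_. x)"
  by (simp add: padic_of_rat_def cls_def)

lemma padic_of_rat_closed: "padic_of_rat p x \<in> carrier Q"
  by (simp add: padic_of_rat_cls cauchy_const)

lemma padic_of_rat_add: "padic_of_rat p (x + y) = padic_of_rat p x \<oplus>\<^bsub>Q\<^esub> padic_of_rat p y"
  using cls.hom_add[of "\<lambda>_. x" "\<lambda>_. y"] by (simp add: padic_of_rat_cls cauchy_const)

lemma padic_of_rat_mult: "padic_of_rat p (x * y) = padic_of_rat p x \<otimes>\<^bsub>Q\<^esub> padic_of_rat p y"
  using cls.hom_mult[of "\<lambda>_. x" "\<lambda>_. y"] by (simp add: padic_of_rat_cls cauchy_const)

lemma padic_of_rat_one: "padic_of_rat p 1 = \<one>\<^bsub>Q\<^esub>"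
  using cls.hom_one by (simp add: padic_of_rat_cls)

lemma padic_norm_of_rat: "padic_norm p (padic_of_rat p x) = padic_abs p x"
  by (simp add: padic_of_rat_cls padic_norm_cls_eqI cauchy_const)

lemma cls_diff_of_rat:
  assumes s: "s \<in> carrier CR"
  shows "cls s \<ominus>\<^bsub>Q\<^esub> padic_of_rat p x = cls (\<lambda>k. s k - x)" "(\<lambda>k. s k - x) \<in> carrier CR"
proof -
  show "(\<lambda>k. s k - x) \<in> carrier CR"
    using CR.minus_closed[OF s cauchy_const[of x]] s by (simp add: cauchy_const)
  show "cls s \<ominus>\<^bsub>Q\<^esub> padic_of_rat p x = cls (\<lambda>k. s k - x)"
    using s cls.hom_add[of s "\<lambda>_. - x"] cls.hom_a_inv[of "\<lambda>_. x"]
    by (simp add: a_minus_def padic_of_rat_cls cauchy_const)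
qed

text \<open>A late term of a representing sequence serves as \<open>r\<close>. The bound is not
  strict because a limit preserves only weak inequalities.\<close>

lemma padic_rat_dense:
  assumes "x \<in> carrier Q" "e > 0"
  shows "\<exists>r. padic_norm p (x \<ominus>\<^bsub>Q\<^esub> padic_of_rat p r) \<le> e"
proof -
  obtain s where s: "s \<in> carrier CR" "x = cls s" using assms carrier_Q by auto
  obtain N where N: "\<forall>k\<ge>N. \<forall>l\<ge>N. padic_abs p (s k - s l) < e"
    using s(1) assms(2) by (meson cauchy_iff)
  have "padic_norm p (cls (\<lambda>k. s k - s N)) \<le> e"
    using N by (intro LIMSEQ_le_const2[OF padic_norm_cls[OF cls_diff_of_rat(2)[OF s(1)]]] exI[of _ N])
      (auto intro: less_imp_le)
  then show ?thesis using s cls_diff_of_rat(1) by auto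
qed

text \<open>The limit is the class of the sequence \<open>r\<close> itself. By the ultrametric
  inequality the bound for one step also bounds every later difference, so no geometric series has
  to be summed. The constant c accounts for denominators, which delay the convergence.\<close>

lemma padic_complete:
  assumes step: "\<And>k. padic_abs p (r (Suc k) - r k) \<le> real p powi (c - int k)"
  shows "\<exists>x\<in>carrier Q. \<forall>k. padic_norm p (x \<ominus>\<^bsub>Q\<^esub> padic_of_rat p (r k)) \<le> real p powi (c - int k)"
proof -
  have far: "padic_abs p (r (k + d) - r k) \<le> real p powi (c - int k)" for k d
  proof (induction d)
    case (Suc d)
    have "padic_abs p (r (Suc (k + d)) - r (k + d)) \<le> real p powi (c - int (k + d))" by (rule step)
    also have "\<dots> \<le> real p powi (c - int k)"
      using p_gt_1 by (intro power_int_increasing) auto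
    finally show ?case using padic_abs_add_le[OF _ Suc, of "r (Suc (k + d)) - r (k + d)"] by simp
  qed simp
  have far': "padic_abs p (r l - r k) \<le> real p powi (c - int k)" if "k \<le> l" for k l
    using far[of k "l - k"] that by simp
  have r: "r \<in> carrier CR"
    unfolding cauchy_iff
  proof (intro allI impI)
    fix e :: real assume e: "e > 0"
    have "1 / real p < 1" "0 \<le> 1 / real p" using p_gt_1 by auto
    then have "(\<lambda>k. real p powi c * (1 / real p) ^ k) \<longlonglongrightarrow> real p powi c * 0"
      by (intro tendsto_mult tendsto_const LIMSEQ_realpow_zero) auto
    then obtain N where N: "real p powi c * (1 / real p) ^ N < e"
      using order_tendstoD(2)[of _ 0 sequentially e] e eventually_sequentially by force
    have eq: "real p powi (c - int N) = real p powi c * (1 / real p) ^ N"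
      using p_gt_1 by (simp add: power_int_diff power_divide)
    have "padic_abs p (r k - r l) < e" if "k \<ge> N" "l \<ge> N" for k l
    proof -
      have "padic_abs p ((r k - r N) - (r l - r N)) \<le> max (padic_abs p (r k - r N)) (padic_abs p (r l - r N))"
        by (rule padic_abs_diff)
      then show ?thesis using far'[OF that(1)] far'[OF that(2)] N eq by simp
    qed
    then show "\<exists>N. \<forall>k\<ge>N. \<forall>l\<ge>N. padic_abs p (r k - r l) < e" by blast
  qed
  have "padic_norm p (cls (\<lambda>l. r l - r k)) \<le> real p powi (c - int k)" for k
    using far' by (intro LIMSEQ_le_const2[OF padic_norm_cls[OF cls_diff_of_rat(2)[OF r]]] exI[of _ k]) auto
  then show ?thesis
    using r by (intro bexI[of _ "cls r"]) (auto simp: cls_diff_of_rat)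
qed

section \<open>The metric topology\<close>

lemma Q_minus_swap: "x \<in> carrier Q \<Longrightarrow> y \<in> carrier Q \<Longrightarrow> \<ominus>\<^bsub>Q\<^esub> (x \<ominus>\<^bsub>Q\<^esub> y) = y \<ominus>\<^bsub>Q\<^esub> x"
  by algebra

lemma Q_minus_trans: "x \<in> carrier Q \<Longrightarrow> y \<in> carrier Q \<Longrightarrow> z \<in> carrier Q \<Longrightarrow>
    x \<ominus>\<^bsub>Q\<^esub> z = (x \<ominus>\<^bsub>Q\<^esub> y) \<oplus>\<^bsub>Q\<^esub> (y \<ominus>\<^bsub>Q\<^esub> z)"
  by algebra

lemma Metric_space_padic: "Metric_space (carrier Q) (padic_dist p)"
proof
  fix x y show "0 \<le> padic_dist p x y"
    by (auto simp: padic_dist_def padic_norm_nonneg)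
  show "padic_dist p x y = padic_dist p y x"
    using padic_norm_minus[of "x \<ominus>\<^bsub>Q\<^esub> y"] by (auto simp: padic_dist_def Q_minus_swap)
next
  fix x y assume xy: "x \<in> carrier Q" "y \<in> carrier Q"
  then show "padic_dist p x y = 0 \<longleftrightarrow> x = y"
    using Q.r_right_minus_eq[of x y] by (simp add: padic_dist_def padic_norm_eq_0_iff)
  fix z assume z: "z \<in> carrier Q"
  have "padic_norm p (x \<ominus>\<^bsub>Q\<^esub> z) \<le> max (padic_norm p (x \<ominus>\<^bsub>Q\<^esub> y)) (padic_norm p (y \<ominus>\<^bsub>Q\<^esub> z))"
    using xy z padic_norm_add[of "x \<ominus>\<^bsub>Q\<^esub> y" "y \<ominus>\<^bsub>Q\<^esub> z"] Q_minus_trans[of x y z] by simp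
  then show "padic_dist p x z \<le> padic_dist p x y + padic_dist p y z"
    using xy z padic_norm_nonneg[of "x \<ominus>\<^bsub>Q\<^esub> y"] padic_norm_nonneg[of "y \<ominus>\<^bsub>Q\<^esub> z"]
    by (simp add: padic_dist_def)
qed

lemma openin_padic_topology:
  "openin (padic_topology p) U \<longleftrightarrow> U \<subseteq> carrier Q \<and>
    (\<forall>x\<in>U. \<exists>e>0. \<forall>y\<in>carrier Q. padic_norm p (y \<ominus>\<^bsub>Q\<^esub> x) < e \<longrightarrow> y \<in> U)"
proof -
  have swap: "padic_norm p (x \<ominus>\<^bsub>Q\<^esub> y) = padic_norm p (y \<ominus>\<^bsub>Q\<^esub> x)"
    if "x \<in> carrier Q" "y \<in> carrier Q" for x y
    using padic_norm_minus[of "x \<ominus>\<^bsub>Q\<^esub> y"] that by (simp add: Q_minus_swap)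
  have "Metric_space.mball (carrier Q) (padic_dist p) x e \<subseteq> U \<longleftrightarrow>
      (\<forall>y\<in>carrier Q. padic_norm p (y \<ominus>\<^bsub>Q\<^esub> x) < e \<longrightarrow> y \<in> U)" if "x \<in> carrier Q" for x e
    using that swap by (auto simp: Metric_space.in_mball[OF Metric_space_padic] padic_dist_def subset_iff)
  then have "(\<forall>x\<in>U. \<exists>e>0. Metric_space.mball (carrier Q) (padic_dist p) x e \<subseteq> U) \<longleftrightarrow>
      (\<forall>x\<in>U. \<exists>e>0. \<forall>y\<in>carrier Q. padic_norm p (y \<ominus>\<^bsub>Q\<^esub> x) < e \<longrightarrow> y \<in> U)"
    if "U \<subseteq> carrier Q" using that by (intro ball_cong refl) (auto simp only: subset_iff)
  then show ?thesis
    unfolding padic_topology_def Metric_space.openin_mtopology[OF Metric_space_padic]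
    by (intro conj_cong refl) (auto simp only: Ball_def)
qed

end

section \<open>Ultrametric topologies and products of rings\<close>

text \<open>The ultrametric inequality, in the form that every \<open>B m\<close> is transitive, makes the balls open.\<close>

definition ball_topology :: "'a topology \<Rightarrow> 'a set \<Rightarrow> (nat \<Rightarrow> 'a \<Rightarrow> 'a \<Rightarrow> bool) \<Rightarrow> bool" where
  "ball_topology T S B \<longleftrightarrow>
    (\<forall>U. openin T U \<longleftrightarrow> U \<subseteq> S \<and> (\<forall>x\<in>U. \<exists>m. \<forall>y\<in>S. B m y x \<longrightarrow> y \<in> U)) \<and>
    (\<forall>m. \<forall>x\<in>S. B m x x) \<and>
    (\<forall>m. \<forall>x\<in>S. \<forall>y\<in>S. \<forall>z\<in>S. B m z y \<longrightarrow> B m y x \<longrightarrow> B m z x) \<and>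
    (\<forall>m k. \<forall>x\<in>S. \<forall>y\<in>S. m \<le> k \<longrightarrow> B k y x \<longrightarrow> B m y x)"

lemma ball_topology_openin:
  "ball_topology T S B \<Longrightarrow>
    openin T U \<longleftrightarrow> U \<subseteq> S \<and> (\<forall>x\<in>U. \<exists>m. \<forall>y\<in>S. B m y x \<longrightarrow> y \<in> U)"
  unfolding ball_topology_def by (elim conjE allE[of _ U])

lemma ball_topology_refl: "ball_topology T S B \<Longrightarrow> x \<in> S \<Longrightarrow> B m x x"
  unfolding ball_topology_def by blast

lemma ball_topology_trans:
  "ball_topology T S B \<Longrightarrow> x \<in> S \<Longrightarrow> y \<in> S \<Longrightarrow> z \<in> S \<Longrightarrow> B m z y \<Longrightarrow> B m y x \<Longrightarrow> B m z x"
  unfolding ball_topology_def by blast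

lemma ball_topology_antimono:
  "ball_topology T S B \<Longrightarrow> x \<in> S \<Longrightarrow> y \<in> S \<Longrightarrow> m \<le> k \<Longrightarrow> B k y x \<Longrightarrow> B m y x"
  unfolding ball_topology_def by blast

text \<open>The constructions below produce relations of a fixed shape, such as a conjunction over
  coordinates; this rewrites them into \<open>lat\<close> or \<open>near\<close>, to which they are
  equivalent only on S.\<close>

lemma ball_topology_cong:
  assumes bt: "ball_topology T S B" and eq: "\<And>m x y. x \<in> S \<Longrightarrow> y \<in> S \<Longrightarrow> B m y x = B' m y x"
  shows "ball_topology T S B'"
proof -
  have "(\<exists>m. \<forall>y\<in>S. B m y x \<longrightarrow> y \<in> U) = (\<exists>m. \<forall>y\<in>S. B' m y x \<longrightarrow> y \<in> U)" if "x \<in> S" for x U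
    using eq[OF that] by simp
  then have op: "openin T U \<longleftrightarrow> U \<subseteq> S \<and> (\<forall>x\<in>U. \<exists>m. \<forall>y\<in>S. B' m y x \<longrightarrow> y \<in> U)" for U
    unfolding ball_topology_openin[OF bt] by (intro conj_cong ball_cong refl) blast
  have rf: "B' m x x" if "x \<in> S" for m x
    using ball_topology_refl[OF bt that] eq that by simp
  have tr: "B' m z x" if "x \<in> S" "y \<in> S" "z \<in> S" "B' m z y" "B' m y x" for m x y z
    using ball_topology_trans[OF bt that(1-3), of m] eq that by simp
  have an: "B' m y x" if "x \<in> S" "y \<in> S" "m \<le> k" "B' k y x" for m k x y
    using ball_topology_antimono[OF bt that(1-3)] eq that by simp
  show ?thesis
    unfolding ball_topology_def
  proof (intro conjI allI)
    show "openin T U \<longleftrightarrow> U \<subseteq> S \<and> (\<forall>x\<in>U. \<exists>m. \<forall>y\<in>S. B' m y x \<longrightarrow> y \<in> U)" for U by (rule op)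
  qed (use rf tr an in blast)+
qed

lemma ball_topology_topspace: "ball_topology T S B \<Longrightarrow> topspace T = S"
proof -
  assume bt: "ball_topology T S B"
  have "openin T S" using ball_topology_openin[OF bt] by blast
  then show ?thesis
    using ball_topology_openin[OF bt, of "topspace T"] openin_subset by fastforce
qed

lemma ball_topology_open_ball:
  assumes "ball_topology T S B" "x \<in> S"
  shows "openin T {y \<in> S. B m y x}"
  using ball_topology_trans[OF assms(1), of x] assms ball_topology_openin[OF assms(1)] by blast

text \<open>For the converse, the open set of the ambient space is the union of the ambient balls
  around the points of U, with radii chosen so that their traces on A stay inside U.\<close>

lemma ball_topology_subtopology:
  assumes bt: "ball_topology T S B" and A: "A \<subseteq> S"
  shows "ball_topology (subtopology T A) A B"
proof -
  have "openin (subtopology T A) U \<longleftrightarrow> U \<subseteq> A \<and> (\<forall>x\<in>U. \<exists>m. \<forall>y\<in>A. B m y x \<longrightarrow> y \<in> U)"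
    (is "_ \<longleftrightarrow> ?R") for U
  proof
    assume "openin (subtopology T A) U"
    then obtain V where V: "openin T V" "U = V \<inter> A" by (auto simp: openin_subtopology)
    then have V': "\<forall>x\<in>V. \<exists>m. \<forall>y\<in>S. B m y x \<longrightarrow> y \<in> V"
      using ball_topology_openin[OF bt] by blast
    show ?R
    proof (intro conjI ballI)
      fix x assume "x \<in> U"
      then obtain m where "\<forall>y\<in>S. B m y x \<longrightarrow> y \<in> V" using V V' by blast
      then show "\<exists>m. \<forall>y\<in>A. B m y x \<longrightarrow> y \<in> U" using V A by blast
    qed (use V in blast)
  next
    assume R: ?R
    then obtain m where m: "\<And>x. x \<in> U \<Longrightarrow> \<forall>y\<in>A. B (m x) y x \<longrightarrow> y \<in> U" by metis
    define V where "V = (\<Union>x\<in>U. {y \<in> S. B (m x) y x})"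
    have "openin T V"
      unfolding V_def using R A ball_topology_open_ball[OF bt] by blast
    moreover have "U = V \<inter> A"
      using R A m ball_topology_refl[OF bt] unfolding V_def by blast
    ultimately show "openin (subtopology T A) U" by (auto simp: openin_subtopology)
  qed
  then show ?thesis
    using bt A unfolding ball_topology_def by (meson subsetD)
qed

text \<open>Since the index set is finite, finitely many coordinate radii can be replaced by a
  single one, and a product of balls of one radius is a basic open box.\<close>

lemma ball_topology_product:
  assumes bt: "\<And>i. i \<in> I \<Longrightarrow> ball_topology (T i) (S i) (B i)" and I: "finite I"
  shows "ball_topology (product_topology T I) (Pi\<^sub>E I S) (\<lambda>m y x. \<forall>i\<in>I. B i m (y i) (x i))"
proof -
  have top: "topspace (T i) = S i" if "i \<in> I" for i using ball_topology_topspace bt that by blast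
  have op: "openin (product_topology T I) U \<longleftrightarrow>
      U \<subseteq> Pi\<^sub>E I S \<and> (\<forall>x\<in>U. \<exists>m. \<forall>y\<in>Pi\<^sub>E I S. (\<forall>i\<in>I. B i m (y i) (x i)) \<longrightarrow> y \<in> U)"
    (is "_ \<longleftrightarrow> ?R") for U
  proof
    assume U: "openin (product_topology T I) U"
    show ?R
    proof (intro conjI ballI)
      have "topspace (product_topology T I) = Pi\<^sub>E I S"
        using top by (auto simp: topspace_product_topology PiE_iff)
      then show "U \<subseteq> Pi\<^sub>E I S" using openin_subset[OF U] by simp
      fix x assume x: "x \<in> U"
      obtain W where W: "\<And>i. i \<in> I \<Longrightarrow> openin (T i) (W i)" "x \<in> Pi\<^sub>E I W" "Pi\<^sub>E I W \<subseteq> U"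
        using bspec[OF U[unfolded openin_product_topology_alt] x] by (elim exE conjE) (rule that, auto)
      have "\<exists>m. \<forall>y\<in>S i. B i m y (x i) \<longrightarrow> y \<in> W i" if "i \<in> I" for i
        using iffD1[OF ball_topology_openin[OF bt[OF that]] W(1)[OF that]] PiE_mem[OF W(2) that]
        by (elim conjE) (rule bspec)
      then obtain m where m: "\<And>i. i \<in> I \<Longrightarrow> \<forall>y\<in>S i. B i (m i) y (x i) \<longrightarrow> y \<in> W i" by metis
      \<comment> \<open>The sum is an upper bound for all m i that also makes sense when I is
        empty.\<close>
      define M where "M = (\<Sum>i\<in>I. m i)"
      have M: "m i \<le> M" if "i \<in> I" for i
        unfolding M_def using I that by (simp add: member_le_sum)
      have Wsub: "W i \<subseteq> S i" if "i \<in> I" for i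
        using W(1)[OF that] openin_subset top[OF that] by metis
      have "y \<in> U" if y: "y \<in> Pi\<^sub>E I S" "\<forall>i\<in>I. B i M (y i) (x i)" for y
      proof -
        have "y i \<in> W i" if i: "i \<in> I" for i
        proof -
          have "B i (m i) (y i) (x i)"
            using ball_topology_antimono[OF bt[OF i] _ _ M[OF i]] y i PiE_mem[OF W(2) i] Wsub[OF i]
            by blast
          then show ?thesis using m[OF i] y i by blast
        qed
        then have "y \<in> Pi\<^sub>E I W" using y(1) by (auto simp: PiE_iff)
        then show ?thesis using W by blast
      qed
      then show "\<exists>m. \<forall>y\<in>Pi\<^sub>E I S. (\<forall>i\<in>I. B i m (y i) (x i)) \<longrightarrow> y \<in> U" by blast
    qed
  next
    assume R: ?R
    show "openin (product_topology T I) U"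
      unfolding openin_product_topology_alt
    proof
      fix x assume x: "x \<in> U"
      then obtain m where m: "\<forall>y\<in>Pi\<^sub>E I S. (\<forall>i\<in>I. B i m (y i) (x i)) \<longrightarrow> y \<in> U" using R by blast
      have xS: "x \<in> Pi\<^sub>E I S" using R x by blast
      define W where "W i = {y \<in> S i. B i m y (x i)}" for i
      have "\<forall>i\<in>I. openin (T i) (W i)"
        unfolding W_def using ball_topology_open_ball[OF bt] xS by blast
      moreover have "x \<in> Pi\<^sub>E I W"
        unfolding W_def using xS ball_topology_refl[OF bt] by (auto simp: PiE_iff)
      moreover have "Pi\<^sub>E I W \<subseteq> U"
      proof
        fix y assume "y \<in> Pi\<^sub>E I W"
        then have "y \<in> Pi\<^sub>E I S" "\<forall>i\<in>I. B i m (y i) (x i)" by (auto simp: W_def PiE_iff)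
        then show "y \<in> U" using m by blast
      qed
      moreover have "finite {i \<in> I. W i \<noteq> topspace (T i)}" using I by simp
      ultimately show "\<exists>U'. finite {i \<in> I. U' i \<noteq> topspace (T i)} \<and> (\<forall>i\<in>I. openin (T i) (U' i)) \<and>
          x \<in> Pi\<^sub>E I U' \<and> Pi\<^sub>E I U' \<subseteq> U" by blast
    qed
  qed
  have rf: "B i m (x i) (x i)" if "x \<in> Pi\<^sub>E I S" "i \<in> I" for i m x
    using ball_topology_refl[OF bt[OF that(2)]] that by blast
  have tr: "B i m (z i) (x i)"
    if "x \<in> Pi\<^sub>E I S" "y \<in> Pi\<^sub>E I S" "z \<in> Pi\<^sub>E I S" "i \<in> I" "B i m (z i) (y i)" "B i m (y i) (x i)" for i m x y z
    using ball_topology_trans[OF bt[OF that(4)]] that by blast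
  have an: "B i m (y i) (x i)"
    if "x \<in> Pi\<^sub>E I S" "y \<in> Pi\<^sub>E I S" "i \<in> I" "m \<le> k" "B i k (y i) (x i)" for i m k x y
    using ball_topology_antimono[OF bt[OF that(3)] _ _ that(4)] that by blast
  show ?thesis
    unfolding ball_topology_def
  proof (intro conjI allI impI)
    show "openin (product_topology T I) U \<longleftrightarrow> U \<subseteq> Pi\<^sub>E I S \<and>
        (\<forall>x\<in>U. \<exists>m. \<forall>y\<in>Pi\<^sub>E I S. (\<forall>i\<in>I. B i m (y i) (x i)) \<longrightarrow> y \<in> U)" for U by (rule op)
  qed (use rf tr an in blast)+
qed

text \<open>The radii p^-m are cofinal among the positive reals. Closed balls are used since
  membership in p^m times the p-adic integers is a weak inequality.\<close>

lemma (in prime_number) ball_topology_padic: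
  "ball_topology (padic_topology p) (carrier Q) (\<lambda>m y x. padic_norm p (y \<ominus>\<^bsub>Q\<^esub> x) \<le> real p powi (- int m))"
proof -
  have ex: "\<exists>m. real p powi (- int m) < e" if e: "e > 0" for e
  proof -
    obtain m where "(1 / real p) ^ m < e"
      using real_arch_pow_inv[OF e, of "1 / real p"] p_gt_1 by auto
    then show ?thesis by (intro exI[of _ m]) (simp add: power_int_minus power_divide inverse_eq_divide)
  qed
  have "(\<exists>e>0. \<forall>y\<in>carrier Q. padic_norm p (y \<ominus>\<^bsub>Q\<^esub> x) < e \<longrightarrow> y \<in> U) \<longleftrightarrow>
      (\<exists>m. \<forall>y\<in>carrier Q. padic_norm p (y \<ominus>\<^bsub>Q\<^esub> x) \<le> real p powi (- int m) \<longrightarrow> y \<in> U)" (is "?L \<longleftrightarrow> ?R")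
    for x U
  proof
    assume ?L
    then show ?R using ex by (meson le_less_trans)
  next
    assume ?R
    then obtain m where "\<forall>y\<in>carrier Q. padic_norm p (y \<ominus>\<^bsub>Q\<^esub> x) \<le> real p powi (- int m) \<longrightarrow> y \<in> U" by blast
    then show ?L using p_gt_1 by (intro exI[of _ "real p powi (- int m)"]) auto
  qed
  then have "openin (padic_topology p) U \<longleftrightarrow> U \<subseteq> carrier Q \<and>
      (\<forall>x\<in>U. \<exists>m. \<forall>y\<in>carrier Q. padic_norm p (y \<ominus>\<^bsub>Q\<^esub> x) \<le> real p powi (- int m) \<longrightarrow> y \<in> U)" for U
    unfolding openin_padic_topology by simp
  moreover have "padic_norm p (x \<ominus>\<^bsub>Q\<^esub> x) \<le> real p powi (- int m)" if "x \<in> carrier Q" for x m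
    using that padic_norm_eq_0_iff[of "\<zero>\<^bsub>Q\<^esub>"] p_gt_1 by (simp add: Q.r_neg a_minus_def)
  moreover have "padic_norm p (z \<ominus>\<^bsub>Q\<^esub> x) \<le> real p powi (- int m)"
    if "x \<in> carrier Q" "y \<in> carrier Q" "z \<in> carrier Q"
      "padic_norm p (z \<ominus>\<^bsub>Q\<^esub> y) \<le> real p powi (- int m)" "padic_norm p (y \<ominus>\<^bsub>Q\<^esub> x) \<le> real p powi (- int m)"
    for x y z m
    using that padic_norm_add[of "z \<ominus>\<^bsub>Q\<^esub> y" "y \<ominus>\<^bsub>Q\<^esub> x"] Q_minus_trans[of z y x] by simp
  moreover have "real p powi (- int k) \<le> real p powi (- int m)" if "m \<le> k" for m k
    using that p_gt_1 by (intro power_int_increasing) auto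
  ultimately show ?thesis unfolding ball_topology_def by (meson order_trans)
qed

section \<open>Products of rings\<close>

lemma product_ring_simps:
  "carrier (product_ring I R) = (\<Pi>\<^sub>E i\<in>I. carrier (R i))"
  "x \<otimes>\<^bsub>product_ring I R\<^esub> y = (\<lambda>i\<in>I. x i \<otimes>\<^bsub>R i\<^esub> y i)"
  "x \<oplus>\<^bsub>product_ring I R\<^esub> y = (\<lambda>i\<in>I. x i \<oplus>\<^bsub>R i\<^esub> y i)"
  "\<one>\<^bsub>product_ring I R\<^esub> = (\<lambda>i\<in>I. \<one>\<^bsub>R i\<^esub>)"
  "\<zero>\<^bsub>product_ring I R\<^esub> = (\<lambda>i\<in>I. \<zero>\<^bsub>R i\<^esub>)"
  by (simp_all add: product_ring_def)

lemma cring_product_ring: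
  assumes cr: "\<And>i. i \<in> I \<Longrightarrow> cring (R i)"
  shows "cring (product_ring I R)"
proof -
  have ab: "abelian_group (R i)" and cm: "comm_monoid (R i)" if "i \<in> I" for i
    using cr[OF that] by (auto simp: cring_def ring_def)
  note clos = abelian_groupE(1)[OF ab] abelian_groupE(2)[OF ab]
    monoid.m_closed[OF comm_monoid.axioms(1)[OF cm]] monoid.one_closed[OF comm_monoid.axioms(1)[OF cm]]
  show ?thesis
  proof (rule cringI)
    show "abelian_group (product_ring I R)"
    proof (rule abelian_groupI)
      fix x assume x: "x \<in> carrier (product_ring I R)"
      have "(\<lambda>i\<in>I. \<ominus>\<^bsub>R i\<^esub> x i) \<oplus>\<^bsub>product_ring I R\<^esub> x = \<zero>\<^bsub>product_ring I R\<^esub>"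
        using x by (auto simp: product_ring_simps PiE_iff abelian_group.l_neg[OF ab] intro!: restrict_ext)
      moreover have "(\<lambda>i\<in>I. \<ominus>\<^bsub>R i\<^esub> x i) \<in> carrier (product_ring I R)"
        using x by (auto simp: product_ring_simps PiE_iff abelian_group.a_inv_closed[OF ab])
      ultimately show "\<exists>y\<in>carrier (product_ring I R). y \<oplus>\<^bsub>product_ring I R\<^esub> x = \<zero>\<^bsub>product_ring I R\<^esub>"
        by blast
      show "\<zero>\<^bsub>product_ring I R\<^esub> \<oplus>\<^bsub>product_ring I R\<^esub> x = x"
        using x by (intro ext) (auto simp: product_ring_simps PiE_iff extensional_def abelian_groupE(5)[OF ab])
      fix y assume y: "y \<in> carrier (product_ring I R)"
      show "x \<oplus>\<^bsub>product_ring I R\<^esub> y \<in> carrier (product_ring I R)"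
        using x y clos by (auto simp: product_ring_simps PiE_iff)
      show "x \<oplus>\<^bsub>product_ring I R\<^esub> y = y \<oplus>\<^bsub>product_ring I R\<^esub> x"
        using x y by (auto simp: product_ring_simps PiE_iff intro!: restrict_ext abelian_groupE(4)[OF ab])
      fix z assume z: "z \<in> carrier (product_ring I R)"
      show "x \<oplus>\<^bsub>product_ring I R\<^esub> y \<oplus>\<^bsub>product_ring I R\<^esub> z =
          x \<oplus>\<^bsub>product_ring I R\<^esub> (y \<oplus>\<^bsub>product_ring I R\<^esub> z)"
        using x y z by (auto simp: product_ring_simps PiE_iff intro!: restrict_ext abelian_groupE(3)[OF ab])
    qed (use clos in \<open>auto simp: product_ring_simps PiE_iff\<close>)
    show "comm_monoid (product_ring I R)"
    proof (rule comm_monoidI)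
      fix x assume x: "x \<in> carrier (product_ring I R)"
      show "\<one>\<^bsub>product_ring I R\<^esub> \<otimes>\<^bsub>product_ring I R\<^esub> x = x"
        using x by (intro ext) (auto simp: product_ring_simps PiE_iff extensional_def
            monoid.l_one[OF comm_monoid.axioms(1)[OF cm]])
      fix y assume y: "y \<in> carrier (product_ring I R)"
      show "x \<otimes>\<^bsub>product_ring I R\<^esub> y \<in> carrier (product_ring I R)"
        using x y clos by (auto simp: product_ring_simps PiE_iff)
      show "x \<otimes>\<^bsub>product_ring I R\<^esub> y = y \<otimes>\<^bsub>product_ring I R\<^esub> x"
        using x y by (auto simp: product_ring_simps PiE_iff intro!: restrict_ext comm_monoid.m_comm[OF cm])
      fix z assume z: "z \<in> carrier (product_ring I R)"
      show "x \<otimes>\<^bsub>product_ring I R\<^esub> y \<otimes>\<^bsub>product_ring I R\<^esub> z =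
          x \<otimes>\<^bsub>product_ring I R\<^esub> (y \<otimes>\<^bsub>product_ring I R\<^esub> z)"
        using x y z by (auto simp: product_ring_simps PiE_iff
            intro!: restrict_ext monoid.m_assoc[OF comm_monoid.axioms(1)[OF cm]])
    qed (use clos in \<open>auto simp: product_ring_simps PiE_iff\<close>)
    fix x y z assume "x \<in> carrier (product_ring I R)" "y \<in> carrier (product_ring I R)" "z \<in> carrier (product_ring I R)"
    then show "(x \<oplus>\<^bsub>product_ring I R\<^esub> y) \<otimes>\<^bsub>product_ring I R\<^esub> z =
        x \<otimes>\<^bsub>product_ring I R\<^esub> z \<oplus>\<^bsub>product_ring I R\<^esub> y \<otimes>\<^bsub>product_ring I R\<^esub> z"
      by (auto simp: product_ring_simps PiE_iff intro!: restrict_ext cringE(2)[OF cr])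
  qed
qed

text \<open>Negation is not a field of the ring record but is derived from the additive group, so
  its componentwise form follows from uniqueness of inverses.\<close>

lemma product_ring_minus:
  assumes cr: "\<And>i. i \<in> I \<Longrightarrow> cring (R i)"
    and x: "x \<in> carrier (product_ring I R)" and i: "i \<in> I"
  shows "(\<ominus>\<^bsub>product_ring I R\<^esub> x) i = \<ominus>\<^bsub>R i\<^esub> x i"
proof -
  have ab: "abelian_group (R i)" if "i \<in> I" for i
    using cr[OF that] by (auto simp: cring_def ring_def)
  interpret cring "product_ring I R" using cring_product_ring[OF cr] .
  have "\<ominus>\<^bsub>product_ring I R\<^esub> x = (\<lambda>i\<in>I. \<ominus>\<^bsub>R i\<^esub> x i)"
    using x by (intro minus_equality)
      (auto simp: product_ring_simps PiE_iff abelian_group.l_neg[OF ab] abelian_group.a_inv_closed[OF ab]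
        intro!: restrict_ext)
  then show ?thesis using i by simp
qed

section \<open>Rational numbers with denominators composed of primes in \<open>P\<close>\<close>

lemma rat_ring_simps [simp]:
  "carrier rat_ring = UNIV" "x \<otimes>\<^bsub>rat_ring\<^esub> y = x * y" "x \<oplus>\<^bsub>rat_ring\<^esub> y = x + y"
  "\<one>\<^bsub>rat_ring\<^esub> = 1" "\<zero>\<^bsub>rat_ring\<^esub> = 0"
  by (simp_all add: ring_of_type_algebra_def)

lemma cring_rat_ring: "cring rat_ring"
  by (rule cring_from_type_algebra)

interpretation rat_ring: cring rat_ring by (rule cring_rat_ring)

lemma rat_ring_uminus [simp]: "\<ominus>\<^bsub>rat_ring\<^esub> x = - x"
  by (rule rat_ring.minus_equality) auto

lemma rat_subring_cring:
  assumes "1 \<in> A" "\<And>x y. x \<in> A \<Longrightarrow> y \<in> A \<Longrightarrow> x + y \<in> A"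
    "\<And>x y. x \<in> A \<Longrightarrow> y \<in> A \<Longrightarrow> x * y \<in> A" "\<And>x. x \<in> A \<Longrightarrow> - x \<in> A"
  shows "cring (rat_ring\<lparr>carrier := A\<rparr>)"
proof -
  have z: "0 \<in> A" using assms(2)[OF assms(1) assms(4)[OF assms(1)]] by simp
  show ?thesis
  proof (rule cringI)
    show "abelian_group (rat_ring\<lparr>carrier := A\<rparr>)"
    proof (rule abelian_groupI)
      fix x assume "x \<in> carrier (rat_ring\<lparr>carrier := A\<rparr>)"
      then show "\<exists>y\<in>carrier (rat_ring\<lparr>carrier := A\<rparr>). y \<oplus>\<^bsub>rat_ring\<lparr>carrier := A\<rparr>\<^esub> x = \<zero>\<^bsub>rat_ring\<lparr>carrier := A\<rparr>\<^esub>"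
        using assms(4) by (intro bexI[of _ "- x"]) auto
    qed (use assms z in auto)
    show "comm_monoid (rat_ring\<lparr>carrier := A\<rparr>)"
      by (rule comm_monoidI) (use assms in auto)
  qed (auto simp: distrib_right)
qed

lemma cring_int_ring: "cring int_ring"
  unfolding int_ring_def by (rule rat_subring_cring) auto

lemma rat_subring_finprod:
  assumes "cring (rat_ring\<lparr>carrier := A\<rparr>)" "finite I" "f ` I \<subseteq> A"
  shows "(\<Otimes>\<^bsub>rat_ring\<lparr>carrier := A\<rparr>\<^esub>i\<in>I. f i) = (\<Prod>i\<in>I. f i)"
proof -
  interpret A: cring "rat_ring\<lparr>carrier := A\<rparr>" by fact
  show ?thesis
    using assms(2,3) by (induction I) (simp_all add: Pi_def image_subset_iff)
qed

text \<open>If p divided the reduced denominator b, then a would have absolute value 1 and b a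
  smaller one, making x larger than 1.\<close>

lemma (in prime_number) padic_abs_le_1_denominator:
  assumes ab: "quotient_of x = (a, b)" and x: "padic_abs p x \<le> 1"
  shows "\<not> int p dvd b"
proof
  assume pb: "int p dvd b"
  have b: "b > 0" and cop: "coprime a b" and xab: "x = of_int a / of_int b"
    using quotient_of_denom_pos[OF ab] quotient_of_coprime[OF ab] quotient_of_div[OF ab] by auto
  have "\<not> int p dvd a"
    using pb cop prime_p by (metis coprime_common_divisor not_prime_unit prime_nat_int_transfer)
  then have "padic_abs p (of_int a) = 1" by (rule padic_abs_of_int_unit)
  moreover have "padic_abs p (of_int b) \<le> real p powi (- int 1)"
    by (rule padic_abs_of_int_le) (use pb in simp)
  moreover have "real p powi (- int 1) < 1"
    using p_gt_1 by (simp add: power_int_minus inverse_eq_divide)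
  moreover have "padic_abs p x * padic_abs p (of_int b) = padic_abs p (of_int a)"
    unfolding padic_abs_mult[symmetric] using xab b by simp
  moreover have "padic_abs p x * padic_abs p (of_int b) \<le> 1 * padic_abs p (of_int b)"
    using x by (intro mult_right_mono) auto
  ultimately show False by linarith
qed

locale prime_set =
  fixes P :: "nat set"
  assumes finite_P: "finite P" and P_nonempty: "P \<noteq> {}" and primes: "\<And>p. p \<in> P \<Longrightarrow> prime p"
begin

lemma prime_number_P: "p \<in> P \<Longrightarrow> prime_number p"
  using primes by unfold_locales

definition q :: nat where "q = \<Prod>P"

lemma q_pos: "q > 0"
  unfolding q_def using primes prime_gt_0_nat by (intro prod_pos) auto

lemma q_gt_1: "q > 1"
proof -
  obtain p where p: "p \<in> P" using P_nonempty by blast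
  have "p dvd q" unfolding q_def using finite_P p by (rule dvd_prodI[of P p "\<lambda>x. x", simplified])
  then have "p \<le> q" using q_pos by (simp add: dvd_imp_le)
  then show ?thesis using prime_gt_1_nat[OF primes[OF p]] by simp
qed

lemma prime_dvd_q: "prime p \<Longrightarrow> p dvd q \<Longrightarrow> p \<in> P"
proof -
  assume p: "prime p" "p dvd q"
  then obtain r where "r \<in> P" "p dvd r"
    unfolding q_def using finite_P prime_dvd_prod_iff[of P p "\<lambda>x. x"] by auto
  then show ?thesis using p primes primes_dvd_imp_eq by metis
qed

text \<open>Every prime of P divides q exactly once, so q is a uniformiser at all places of P at the
  same time and its powers measure smallness uniformly.\<close>

lemma padic_abs_q:
  assumes p: "p \<in> P"
  shows "padic_abs p (of_nat q) = 1 / real p"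
proof -
  interpret prime_number p by (rule prime_number_P[OF p])
  have q: "q = p * \<Prod>(P - {p})"
    unfolding q_def using finite_P p by (simp add: prod.remove)
  have "\<not> p dvd \<Prod>(P - {p})"
  proof
    assume "p dvd \<Prod>(P - {p})"
    then obtain r where "r \<in> P - {p}" "p dvd r"
      using finite_P prime_dvd_prod_iff[of "P - {p}" p "\<lambda>x. x"] prime_p by auto
    then show False using primes prime_p primes_dvd_imp_eq by blast
  qed
  then have "padic_abs p (of_int (int (\<Prod>(P - {p})))) = 1"
    by (intro padic_abs_of_int_unit) (simp only: int_dvd_int_iff not_False_eq_True)
  then show ?thesis
    using padic_abs_p unfolding q by (simp only: of_nat_mult padic_abs_mult of_int_of_nat_eq)
qed

lemma padic_abs_q_powi: "p \<in> P \<Longrightarrow> padic_abs p (of_nat q powi k) = real p powi (- k)"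
  using prime_number.padic_abs_powi[OF prime_number_P] padic_abs_q
  by (simp add: power_int_divide_distrib power_int_minus inverse_eq_divide)

abbreviation "R \<equiv> localized_int_ring P"

text \<open>The localised integers described by their denominators, in place of the inductively
  generated subring; \<open>R_eq\<close> shows that both agree.\<close>

definition Zloc :: "rat set" where "Zloc = {x. \<exists>k. x * of_nat q ^ k \<in> \<int>}"

lemma Zloc_int: "of_int a \<in> Zloc"
  unfolding Zloc_def by (auto intro: exI[of _ 0])

lemma Zloc_uminus: "x \<in> Zloc \<Longrightarrow> - x \<in> Zloc"
  unfolding Zloc_def by auto

lemma Zloc_add: "x \<in> Zloc \<Longrightarrow> y \<in> Zloc \<Longrightarrow> x + y \<in> Zloc"
proof -
  assume "x \<in> Zloc" "y \<in> Zloc"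
  then obtain k l where kl: "x * of_nat q ^ k \<in> \<int>" "y * of_nat q ^ l \<in> \<int>" by (auto simp: Zloc_def)
  have "(x + y) * of_nat q ^ (k + l) = (x * of_nat q ^ k) * of_nat (q ^ l) + (y * of_nat q ^ l) * of_nat (q ^ k)"
    by (simp add: power_add algebra_simps)
  also have "\<dots> \<in> \<int>" by (intro Ints_add Ints_mult[OF kl(1)] Ints_mult[OF kl(2)] Ints_of_nat)
  finally show ?thesis unfolding Zloc_def by blast
qed

lemma Zloc_mult: "x \<in> Zloc \<Longrightarrow> y \<in> Zloc \<Longrightarrow> x * y \<in> Zloc"
proof -
  assume "x \<in> Zloc" "y \<in> Zloc"
  then obtain k l where kl: "x * of_nat q ^ k \<in> \<int>" "y * of_nat q ^ l \<in> \<int>" by (auto simp: Zloc_def)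
  have "(x * y) * of_nat q ^ (k + l) = (x * of_nat q ^ k) * (y * of_nat q ^ l)"
    by (simp add: power_add algebra_simps)
  also have "\<dots> \<in> \<int>" using kl by (rule Ints_mult)
  finally show ?thesis unfolding Zloc_def by blast
qed

lemma Zloc_q_powi: "of_nat q powi k \<in> Zloc"
proof (cases "k \<ge> 0")
  case True
  then have "(of_nat q :: rat) powi k = of_int (int q ^ nat k)" by (simp add: power_int_def)
  then show ?thesis using Zloc_int by metis
next
  case False
  then have "(of_nat q :: rat) powi k * of_nat q ^ nat (- k) = 1"
    using q_pos by (simp add: power_int_def power_inverse)
  then show ?thesis unfolding Zloc_def by (auto intro!: exI[of _ "nat (- k)"])
qed

lemma cring_Zloc: "cring (rat_ring\<lparr>carrier := Zloc\<rparr>)"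
  using rat_subring_cring[of Zloc] Zloc_int[of 1] Zloc_add Zloc_mult Zloc_uminus by simp

text \<open>Each generator 1/p becomes an integer after multiplication by q. Conversely 1/q is the
  product of all generators, which yields every a/q^k.\<close>

lemma R_eq: "R = rat_ring\<lparr>carrier := Zloc\<rparr>"
proof -
  let ?H = "(\<lambda>p. 1 / of_nat p) ` P :: rat set"
  have 1: "x \<in> Zloc" if "x \<in> generate_ring rat_ring ?H" for x
    using that
  proof induction
    case (incl h)
    then obtain p where p: "p \<in> P" "h = 1 / of_nat p" by auto
    have "q = p * \<Prod>(P - {p})" unfolding q_def using finite_P p by (simp add: prod.remove)
    then have "h * of_nat q ^ 1 = of_nat (\<Prod>(P - {p}))"
      using p prime_gt_0_nat[OF primes[OF p(1)]] by simp
    then show ?case unfolding Zloc_def using Ints_of_nat by (metis (mono_tags, lifting) mem_Collect_eq)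
  qed (use Zloc_int[of 1] Zloc_uminus Zloc_add Zloc_mult in auto)
  note gen = generate_ring.one[of rat_ring ?H] generate_ring.a_inv[of _ rat_ring ?H]
    generate_ring.eng_add[of _ rat_ring ?H] generate_ring.eng_mult[of _ rat_ring ?H]
  have gnat: "of_nat k \<in> generate_ring rat_ring ?H" for k
  proof (induction k)
    case 0
    show ?case using gen(3)[OF gen(1) gen(2)[OF gen(1)]] by simp
  next
    case (Suc k)
    show ?case using gen(3)[OF gen(1) Suc] by simp
  qed
  have gint: "of_int a \<in> generate_ring rat_ring ?H" for a
  proof (cases "a \<ge> 0")
    case True
    then show ?thesis using gnat[of "nat a"] by simp
  next
    case False
    then show ?thesis using gen(2)[OF gnat[of "nat (- a)"]] by simp
  qed
  have gprod: "(\<Prod>p\<in>A. 1 / of_nat p) \<in> generate_ring rat_ring ?H" if "finite A" "A \<subseteq> P" for A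
    using that
  proof (induction A)
    case empty
    then show ?case using gen(1) by simp
  next
    case (insert p A)
    then show ?case using gen(4)[of "1 / of_nat p" "\<Prod>p\<in>A. 1 / of_nat p"] generate_ring.incl[of "1 / of_nat p" ?H rat_ring]
      by simp
  qed
  have "(\<Prod>p\<in>P. 1 / of_nat p) = (1 / of_nat q :: rat)"
    unfolding q_def by (simp add: prod_dividef)
  then have gq: "1 / of_nat q \<in> generate_ring rat_ring ?H" using gprod[OF finite_P] by simp
  have gqk: "(1 / of_nat q) ^ k \<in> generate_ring rat_ring ?H" for k
  proof (induction k)
    case 0
    then show ?case using gen(1) by simp
  next
    case (Suc k)
    show ?case using gen(4)[OF gq Suc] by simp
  qed
  have 2: "x \<in> generate_ring rat_ring ?H" if xZ: "x \<in> Zloc" for x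
  proof -
    obtain k where "x * of_nat q ^ k \<in> \<int>" using xZ by (auto simp: Zloc_def)
    then obtain a where "x * of_nat q ^ k = of_int a" by (rule Ints_cases)
    then have "x = of_int a * (1 / of_nat q) ^ k" using q_pos by (simp add: field_simps)
    then show ?thesis using gen(4)[OF gint gqk] by simp
  qed
  have "generate_ring rat_ring ?H = Zloc" using 1 2 by blast
  then show ?thesis by (simp add: localized_int_ring_def)
qed

lemma R_simps [simp]:
  "carrier R = Zloc" "x \<otimes>\<^bsub>R\<^esub> y = x * y" "x \<oplus>\<^bsub>R\<^esub> y = x + y" "\<one>\<^bsub>R\<^esub> = 1" "\<zero>\<^bsub>R\<^esub> = 0"
  by (simp_all add: R_eq)

sublocale R: cring R unfolding R_eq by (rule cring_Zloc)

lemma R_finprod: "finite I \<Longrightarrow> f ` I \<subseteq> Zloc \<Longrightarrow> (\<Otimes>\<^bsub>R\<^esub>i\<in>I. f i) = (\<Prod>i\<in>I. f i)"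
  unfolding R_eq by (rule rat_subring_finprod[OF cring_Zloc])

lemma Units_R: "u \<in> Units R \<longleftrightarrow> u \<in> Zloc \<and> (\<exists>v\<in>Zloc. u * v = 1)"
  by (auto simp: Units_def mult.commute)

text \<open>A prime factor of the reduced denominator divides a power of q, hence belongs to P,
  where the bound on the absolute value excludes it.\<close>

lemma Zloc_integral:
  assumes x: "x \<in> Zloc" and le: "\<And>p. p \<in> P \<Longrightarrow> padic_abs p x \<le> 1"
  shows "x \<in> \<int>"
proof (cases "x = 0")
  case x0: False
  obtain a b where ab: "quotient_of x = (a, b)" by fastforce
  have b: "b > 0" and cop: "coprime a b" and xab: "x = of_int a / of_int b"
    using quotient_of_denom_pos[OF ab] quotient_of_coprime[OF ab] quotient_of_div[OF ab] by auto
  have a: "a \<noteq> 0" using x0 xab by auto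
  obtain k where "x * of_nat q ^ k \<in> \<int>" using x by (auto simp: Zloc_def)
  then obtain c where "x * of_nat q ^ k = of_int c" by (rule Ints_cases)
  then have "of_int (a * int q ^ k) = (of_int (c * b) :: rat)" using b xab by (simp add: field_simps)
  then have "a * int q ^ k = c * b" by (simp only: of_int_eq_iff)
  then have "b dvd a * int q ^ k" by simp
  then have bq: "b dvd int q ^ k" using cop by (simp add: coprime_commute coprime_dvd_mult_right_iff)
  have "b = 1"
  proof (rule ccontr)
    assume "b \<noteq> 1"
    then have "nat b \<noteq> 1" using b by auto
    then obtain p where p: "prime p" "p dvd nat b" using prime_factor_nat by blast
    then have pb: "int p dvd b" using b by (metis int_dvd_int_iff int_nat_eq less_imp_le)
    then have "int p dvd int q ^ k" using bq dvd_trans by blast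
    then have "p dvd q ^ k" by (metis int_dvd_int_iff of_nat_power)
    then have "p dvd q" using p(1) prime_dvd_power by blast
    then have pP: "p \<in> P" using prime_dvd_q p by blast
    interpret prime_number p by (rule prime_number_P[OF pP])
    show False using padic_abs_le_1_denominator[OF ab le[OF pP]] pb by blast
  qed
  then show ?thesis using xab by simp
qed simp

text \<open>For x = a/b the denominator is prime to p, so it has an inverse y modulo p^m, and a * y
  approximates x.\<close>

lemma int_approx:
  assumes p: "p \<in> P" and x: "padic_abs p x \<le> 1"
  shows "\<exists>c::nat. padic_abs p (of_nat c - x) \<le> real p powi (- int m)"
proof -
  interpret prime_number p by (rule prime_number_P[OF p])
  obtain a b where ab: "quotient_of x = (a, b)" by fastforce
  have b: "b > 0" and cop: "coprime a b" and xab: "x = of_int a / of_int b"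
    using quotient_of_denom_pos[OF ab] quotient_of_coprime[OF ab] quotient_of_div[OF ab] by auto
  have nb: "\<not> int p dvd b" by (rule padic_abs_le_1_denominator[OF ab x])
  then have "coprime b (int p ^ m)"
    using prime_p by (metis coprime_commute coprime_power_right_iff prime_imp_coprime prime_nat_int_transfer)
  then obtain y where y: "[b * y = 1] (mod (int p ^ m))"
    using cong_solve_coprime_int by blast
  \<comment> \<open>Reducing modulo p^m makes the approximation nonnegative, as the Chinese
    remainder theorem for natural numbers requires.\<close>
  define c where "c = (a * y) mod (int p ^ m)"
  have c0: "c \<ge> 0" using p_gt_1 by (simp add: c_def)
  have "[c * b = a * y * b] (mod (int p ^ m))"
    unfolding c_def by (simp add: cong_def mod_mult_left_eq)
  also have "a * y * b = a * (b * y)" by simp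
  also have "[a * (b * y) = a * 1] (mod (int p ^ m))" using y by (rule cong_scalar_left)
  finally have "int p ^ m dvd c * b - a" by (simp add: cong_iff_dvd_diff)
  then have "padic_abs p (of_int (c * b - a)) \<le> real p powi (- int m)"
    by (rule padic_abs_of_int_le)
  moreover have "of_int (c * b - a) = (of_int c - x) * of_int b"
    using xab b by (simp add: field_simps)
  moreover have "padic_abs p (of_int b) = 1" using nb by (rule padic_abs_of_int_unit)
  ultimately have "padic_abs p (of_int c - x) \<le> real p powi (- int m)"
    by (simp add: padic_abs_mult del: of_int_diff of_int_mult)
  then show ?thesis using c0 by (intro exI[of _ "nat c"]) simp
qed

text \<open>Weak approximation with denominators supported on P: a power q^K clears the denominators
  at all places, the Chinese remainder theorem approximates the results by one integer d, and d /
  q^K is the answer.\<close>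

lemma simultaneous_approx:
  fixes x :: "nat \<Rightarrow> rat"
  shows "\<exists>r\<in>Zloc. \<forall>p\<in>P. padic_abs p (r - x p) \<le> real p powi (- int m)"
proof -
  have "\<exists>k. padic_abs p (of_nat q ^ k * x p) \<le> 1" if p: "p \<in> P" for p
  proof -
    interpret prime_number p by (rule prime_number_P[OF p])
    obtain k where "padic_abs p (x p) < real p ^ k"
      using real_arch_pow[OF p_gt_1] by blast
    then show ?thesis
      using p_gt_1 by (intro exI[of _ k]) (simp add: padic_abs_mult padic_abs_power padic_abs_q[OF p] field_simps)
  qed
  then obtain k where k: "\<And>p. p \<in> P \<Longrightarrow> padic_abs p (of_nat q ^ k p * x p) \<le> 1" by metis
  define K where "K = (\<Sum>p\<in>P. k p)"
  have kK: "k p \<le> K" if "p \<in> P" for p unfolding K_def using finite_P that by (simp add: member_le_sum)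
  have K: "padic_abs p (of_nat q ^ K * x p) \<le> 1" if p: "p \<in> P" for p
  proof -
    interpret prime_number p by (rule prime_number_P[OF p])
    have "(of_nat q :: rat) ^ K * x p = of_nat q ^ (K - k p) * (of_nat q ^ k p * x p)"
      using kK[OF p] by (simp add: power_add[symmetric])
    moreover have "padic_abs p (of_nat q ^ (K - k p)) \<le> 1"
      using padic_abs_of_int_le_1[of "int (q ^ (K - k p))"] by simp
    ultimately show ?thesis using k[OF p]
      by (simp only: padic_abs_mult[of "of_nat q ^ (K - k p)"]) (simp add: mult_le_one)
  qed
  \<comment> \<open>The extra precision K is consumed by the final division by q^K, which multiplies
    the p-adic absolute value by p^K.\<close>
  obtain c :: "nat \<Rightarrow> nat" where
    c: "\<And>p. p \<in> P \<Longrightarrow> padic_abs p (of_nat (c p) - of_nat q ^ K * x p) \<le> real p powi (- int (m + K))"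
    using int_approx[OF _ K, of _ "m + K"] by metis
  have "coprime (i ^ (m + K)) (j ^ (m + K))" if "i \<in> P" "j \<in> P" "i \<noteq> j" for i j
    using primes_coprime[OF primes[OF that(1)] primes[OF that(2)] that(3)] by simp
  then obtain d where d: "\<And>p. p \<in> P \<Longrightarrow> [d = c p] (mod (p ^ (m + K)))"
    using chinese_remainder_nat[OF finite_P, of "\<lambda>p. p ^ (m + K)" c] by blast
  define r :: rat where "r = of_nat d * of_nat q powi (- int K)"
  have "r \<in> Zloc"
    unfolding r_def using Zloc_mult[OF Zloc_int[of "int d"] Zloc_q_powi] by simp
  moreover have "padic_abs p (r - x p) \<le> real p powi (- int m)" if p: "p \<in> P" for p
  proof -
    interpret prime_number p by (rule prime_number_P[OF p])
    have "[int d = int (c p)] (mod (int p ^ (m + K)))"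
      using d[OF p] by (metis cong_int_iff of_nat_power)
    then have "int p ^ (m + K) dvd int d - int (c p)" by (simp add: cong_iff_dvd_diff)
    from padic_abs_of_int_le[OF this]
    have 1: "padic_abs p (of_nat d - of_nat (c p)) \<le> real p powi (- int (m + K))" by simp
    have 2: "padic_abs p (of_nat d - of_nat q ^ K * x p) \<le> real p powi (- int (m + K))"
      using padic_abs_add_le[OF 1 c[OF p]] by simp
    have "r - x p = (of_nat d - of_nat q ^ K * x p) * of_nat q powi (- int K)"
      unfolding r_def using q_pos by (simp add: power_int_minus field_simps)
    then have "padic_abs p (r - x p) = padic_abs p (of_nat d - of_nat q ^ K * x p) * real p powi int K"
      by (simp only: padic_abs_mult padic_abs_q_powi[OF p] minus_minus)
    also have "\<dots> \<le> real p powi (- int (m + K)) * real p powi int K"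
      using 2 p_gt_1 by (intro mult_right_mono) auto
    also have "\<dots> = real p powi (- int m)"
      using p_gt_1 power_int_add[of "real p" "- int (m + K)" "int K"] by simp
    finally show ?thesis .
  qed
  ultimately show ?thesis by blast
qed

end

section \<open>The ring \<open>\<rat>\<^sub>P\<close>\<close>

context prime_set
begin

abbreviation "QP \<equiv> padics_ring P"
abbreviation "\<iota> \<equiv> padics_of_rat P"

lemma cring_padic_field: "p \<in> P \<Longrightarrow> cring (padic_field p)"
  using prime_number.cring_Q[OF prime_number_P] .

lemma cring_QP: "cring QP"
  unfolding padics_ring_def by (rule cring_product_ring[OF cring_padic_field])

sublocale QP: cring QP by (rule cring_QP)

lemma QP_mem: "x \<in> carrier QP \<longleftrightarrow> x \<in> (\<Pi>\<^sub>E p\<in>P. carrier (padic_field p))"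
  by (simp add: padics_ring_def product_ring_simps)

lemma QP_entry: "x \<in> carrier QP \<Longrightarrow> p \<in> P \<Longrightarrow> x p \<in> carrier (padic_field p)"
  by (auto simp: QP_mem)

lemma QP_eqI: "x \<in> carrier QP \<Longrightarrow> y \<in> carrier QP \<Longrightarrow> (\<And>p. p \<in> P \<Longrightarrow> x p = y p) \<Longrightarrow> x = y"
  unfolding QP_mem by (rule PiE_ext)

lemma QP_ops:
  assumes "p \<in> P"
  shows "(x \<oplus>\<^bsub>QP\<^esub> y) p = x p \<oplus>\<^bsub>padic_field p\<^esub> y p" "(x \<otimes>\<^bsub>QP\<^esub> y) p = x p \<otimes>\<^bsub>padic_field p\<^esub> y p"
    "\<one>\<^bsub>QP\<^esub> p = \<one>\<^bsub>padic_field p\<^esub>" "\<zero>\<^bsub>QP\<^esub> p = \<zero>\<^bsub>padic_field p\<^esub>"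
  using assms by (simp_all add: padics_ring_def product_ring_simps)

lemma QP_uminus: "x \<in> carrier QP \<Longrightarrow> p \<in> P \<Longrightarrow> (\<ominus>\<^bsub>QP\<^esub> x) p = \<ominus>\<^bsub>padic_field p\<^esub> x p"
  using product_ring_minus[OF cring_padic_field] by (simp add: padics_ring_def)

lemma QP_minus:
  "y \<in> carrier QP \<Longrightarrow> p \<in> P \<Longrightarrow> (x \<ominus>\<^bsub>QP\<^esub> y) p = x p \<ominus>\<^bsub>padic_field p\<^esub> y p"
  by (simp add: a_minus_def QP_ops QP_uminus)

lemma \<iota>_entry: "p \<in> P \<Longrightarrow> \<iota> x p = padic_of_rat p x"
  by (simp add: padics_of_rat_def)

lemma \<iota>_closed [simp, intro]: "\<iota> x \<in> carrier QP"
  using prime_number.padic_of_rat_closed[OF prime_number_P] by (auto simp: QP_mem padics_of_rat_def)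

lemma \<iota>_add: "\<iota> (x + y) = \<iota> x \<oplus>\<^bsub>QP\<^esub> \<iota> y"
  by (rule QP_eqI) (auto simp: QP_ops \<iota>_entry prime_number.padic_of_rat_add[OF prime_number_P])

lemma \<iota>_mult: "\<iota> (x * y) = \<iota> x \<otimes>\<^bsub>QP\<^esub> \<iota> y"
  by (rule QP_eqI) (auto simp: QP_ops \<iota>_entry prime_number.padic_of_rat_mult[OF prime_number_P])

lemma \<iota>_one: "\<iota> 1 = \<one>\<^bsub>QP\<^esub>"
  by (rule QP_eqI) (auto simp: QP_ops \<iota>_entry prime_number.padic_of_rat_one[OF prime_number_P])

text \<open>On all rationals the embedding yields algebraic identities free of membership
  conditions; its restriction to \<open>R\<close> is the version that acts on \<Gamma>.\<close>

lemma \<iota>_ring_hom_rat: "ring_hom_cring rat_ring QP \<iota>"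
  by (intro ring_hom_cring.intro ring_hom_cring_axioms.intro cring_rat_ring cring_QP ring_hom_memI)
    (auto simp: \<iota>_add \<iota>_mult \<iota>_one)

lemma \<iota>_ring_hom: "ring_hom_cring R QP \<iota>"
  by (intro ring_hom_cring.intro ring_hom_cring_axioms.intro R.is_cring cring_QP ring_hom_memI)
    (auto simp: \<iota>_add \<iota>_mult \<iota>_one)

lemma \<iota>_zero: "\<iota> 0 = \<zero>\<^bsub>QP\<^esub>"
  using ring_hom_cring.hom_zero[OF \<iota>_ring_hom_rat] by simp

lemma \<iota>_uminus: "\<iota> (- x) = \<ominus>\<^bsub>QP\<^esub> \<iota> x"
  using ring_hom_cring.hom_a_inv[OF \<iota>_ring_hom_rat, of x] by simp

lemma \<iota>_diff: "\<iota> (x - y) = \<iota> x \<ominus>\<^bsub>QP\<^esub> \<iota> y"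
  using \<iota>_add[of x "- y"] by (simp add: \<iota>_uminus a_minus_def)

section \<open>Lattices: arithmetic, exhaustion, separation, density and completeness\<close>

text \<open>\<open>lat m\<close> is \<open>q\<^sup>m\<close> times the product of the rings of \<open>p\<close>-adic integers.\<close>

definition lat :: "int \<Rightarrow> padics set" where
  "lat m = {x \<in> carrier QP. \<forall>p\<in>P. padic_norm p (x p) \<le> real p powi (- m)}"

lemma lat_carrier: "x \<in> lat m \<Longrightarrow> x \<in> carrier QP"
  by (simp add: lat_def)

lemma lat_\<iota>_iff: "\<iota> x \<in> lat m \<longleftrightarrow> (\<forall>p\<in>P. padic_abs p x \<le> real p powi (- m))"
  by (simp add: lat_def \<iota>_entry prime_number.padic_norm_of_rat[OF prime_number_P])

lemma lat_add:
  assumes "x \<in> lat m" "y \<in> lat m"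
  shows "x \<oplus>\<^bsub>QP\<^esub> y \<in> lat m"
proof -
  have "padic_norm p ((x \<oplus>\<^bsub>QP\<^esub> y) p) \<le> real p powi (- m)" if p: "p \<in> P" for p
  proof -
    have "padic_norm p (x p) \<le> real p powi (- m)" "padic_norm p (y p) \<le> real p powi (- m)"
      using assms p by (auto simp: lat_def)
    moreover have "padic_norm p (x p \<oplus>\<^bsub>padic_field p\<^esub> y p) \<le> max (padic_norm p (x p)) (padic_norm p (y p))"
      using assms p by (intro prime_number.padic_norm_add prime_number_P QP_entry lat_carrier)
    ultimately show ?thesis using p by (simp add: QP_ops)
  qed
  then show ?thesis using assms by (simp add: lat_def)
qed

lemma lat_uminus: "x \<in> lat m \<Longrightarrow> \<ominus>\<^bsub>QP\<^esub> x \<in> lat m"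
  by (simp add: lat_def QP_uminus QP_entry prime_number.padic_norm_minus[OF prime_number_P])

lemma lat_diff: "x \<in> lat m \<Longrightarrow> y \<in> lat m \<Longrightarrow> x \<ominus>\<^bsub>QP\<^esub> y \<in> lat m"
  by (simp add: a_minus_def lat_add lat_uminus)

lemma lat_mult:
  assumes "x \<in> lat m" "y \<in> lat k"
  shows "x \<otimes>\<^bsub>QP\<^esub> y \<in> lat (m + k)"
proof -
  have "padic_norm p ((x \<otimes>\<^bsub>QP\<^esub> y) p) \<le> real p powi (- (m + k))" if p: "p \<in> P" for p
  proof -
    interpret prime_number p by (rule prime_number_P[OF p])
    have e: "x p \<in> carrier Q" "y p \<in> carrier Q"
      using assms p by (auto simp: lat_def QP_entry)
    have "padic_norm p (x p) * padic_norm p (y p) \<le> real p powi (- m) * real p powi (- k)"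
      using assms p e by (intro mult_mono) (auto simp: lat_def padic_norm_nonneg)
    also have "\<dots> = real p powi (- (m + k))"
      using p_gt_1 by (simp add: power_int_add[symmetric])
    finally show ?thesis using p e by (simp add: QP_ops padic_norm_mult)
  qed
  then show ?thesis using assms by (simp add: lat_def)
qed

lemma lat_antimono: "k \<le> m \<Longrightarrow> x \<in> lat m \<Longrightarrow> x \<in> lat k"
proof -
  assume km: "k \<le> m" and x: "x \<in> lat m"
  have "real p powi (- m) \<le> real p powi (- k)" if "p \<in> P" for p
    using prime_number.p_gt_1[OF prime_number_P[OF that]] km by (intro power_int_increasing) auto
  then show ?thesis using x unfolding lat_def by fastforce
qed

lemma lat_zero [simp]: "\<zero>\<^bsub>QP\<^esub> \<in> lat m"
  unfolding \<iota>_zero[symmetric] lat_\<iota>_iff using prime_number.padic_abs_zero[OF prime_number_P] by simp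

lemma lat_\<iota>_int: "\<iota> (of_int a) \<in> lat 0"
  unfolding lat_\<iota>_iff using prime_number.padic_abs_of_int_le_1[OF prime_number_P] by simp

lemma lat_one [simp]: "\<one>\<^bsub>QP\<^esub> \<in> lat 0"
  using lat_\<iota>_int[of 1] by (simp add: \<iota>_one)

lemma lat_\<iota>_int_dvd:
  assumes "int q ^ m dvd a"
  shows "\<iota> (of_int a) \<in> lat (int m)"
  unfolding lat_\<iota>_iff
proof
  fix p assume p: "p \<in> P"
  have "p dvd q" unfolding q_def using finite_P p by (rule dvd_prodI[of P p "\<lambda>x. x", simplified])
  then have "int p ^ m dvd int q ^ m" by (simp add: dvd_power_same)
  then show "padic_abs p (of_int a) \<le> real p powi (- int m)"
    using prime_number.padic_abs_of_int_le[OF prime_number_P[OF p]] assms dvd_trans by blast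
qed

lemma lat_q_powi: "\<iota> (of_nat q powi k) \<in> lat k"
  by (simp add: lat_\<iota>_iff padic_abs_q_powi)

lemma lat_\<iota>_integral: "x \<in> Zloc \<Longrightarrow> \<iota> x \<in> lat 0 \<Longrightarrow> x \<in> \<int>"
  using Zloc_integral by (simp add: lat_\<iota>_iff)

lemma lat_exhaust:
  assumes x: "x \<in> carrier QP"
  shows "\<exists>k::nat. x \<in> lat (- int k)"
proof -
  have "\<exists>k. padic_norm p (x p) \<le> real p ^ k" if p: "p \<in> P" for p
    using real_arch_pow[OF prime_number.p_gt_1[OF prime_number_P[OF p]]] less_imp_le by blast
  then obtain k where k: "\<And>p. p \<in> P \<Longrightarrow> padic_norm p (x p) \<le> real p ^ k p" by metis
  have "padic_norm p (x p) \<le> real p ^ (\<Sum>p\<in>P. k p)" if p: "p \<in> P" for p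
  proof -
    have "k p \<le> (\<Sum>p\<in>P. k p)" using finite_P p by (simp add: member_le_sum)
    then have "real p ^ k p \<le> real p ^ (\<Sum>p\<in>P. k p)"
      using prime_number.p_gt_1[OF prime_number_P[OF p]] by (intro power_increasing) auto
    then show ?thesis using k[OF p] by simp
  qed
  then show ?thesis using x by (intro exI[of _ "\<Sum>p\<in>P. k p"]) (simp add: lat_def del: of_nat_sum)
qed

lemma lat_exhaust_finite:
  assumes "finite A" "A \<subseteq> carrier QP"
  shows "\<exists>k::nat. A \<subseteq> lat (- int k)"
  using assms
proof (induction A)
  case (insert x A)
  then obtain k l where kl: "A \<subseteq> lat (- int k)" "x \<in> lat (- int l)" using lat_exhaust[of x] by auto
  have "insert x A \<subseteq> lat (- int (max k l))"
    using kl lat_antimono[of "- int (max k l)" "- int k"] lat_antimono[of "- int (max k l)" "- int l"]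
    by auto
  then show ?case by blast
qed simp

text \<open>The norms at each place fall below every positive bound. In this way entries divisible
  by all powers of q become zero when the kernel of the action is computed.\<close>

lemma lat_separated:
  assumes x: "x \<in> carrier QP" and m: "\<And>m::nat. x \<in> lat (int m - c)"
  shows "x = \<zero>\<^bsub>QP\<^esub>"
proof (rule QP_eqI[OF x QP.zero_closed])
  fix p assume p: "p \<in> P"
  interpret prime_number p by (rule prime_number_P[OF p])
  have "padic_norm p (x p) \<le> e" if e: "e > 0" for e
  proof -
    have "(1 / real p) ^ m * real p powi c = real p powi (- (int m - c))" for m
      using p_gt_1 by (simp add: power_int_diff power_divide)
    moreover obtain m where "(1 / real p) ^ m < e / real p powi c"
      using real_arch_pow_inv[of "e / real p powi c" "1 / real p"] e p_gt_1 by auto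
    then have "(1 / real p) ^ m * real p powi c < e" using p_gt_1 by (simp add: field_simps)
    ultimately have "real p powi (- (int m - c)) < e" by simp
    moreover have "padic_norm p (x p) \<le> real p powi (- (int m - c))"
      using m[of m] p unfolding lat_def by blast
    ultimately show ?thesis by linarith
  qed
  then have "padic_norm p (x p) \<le> 0" by (rule field_le_epsilon[of _ 0, simplified])
  then show "x p = \<zero>\<^bsub>QP\<^esub> p"
    using p padic_norm_eq_0_iff[of "x p"] padic_norm_nonneg[of "x p"] QP_entry[OF x p] by (simp add: QP_ops)
qed

text \<open>One place suffices, and P provides one because it is nonempty.\<close>

lemma \<iota>_inj: "\<iota> x = \<iota> y \<Longrightarrow> x = y"
proof -
  assume eq: "\<iota> x = \<iota> y"
  obtain p where p: "p \<in> P" using P_nonempty by blast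
  interpret prime_number p by (rule prime_number_P[OF p])
  have "\<iota> (x - y) = \<zero>\<^bsub>QP\<^esub>" using eq by (simp add: \<iota>_diff QP.r_neg a_minus_def)
  then have "padic_norm p (padic_of_rat p (x - y)) = 0"
    using p padic_norm_eq_0_iff[of "\<zero>\<^bsub>Q\<^esub>"] \<iota>_entry QP_ops(4) by (metis Q.zero_closed)
  then show "x = y" by (simp add: padic_norm_of_rat)
qed

text \<open>Each component is approximated by a rational of its own; a single element of
  \<open>Zloc\<close> then approximates all of these, and the ultrametric inequality keeps the
  precision m.\<close>

lemma \<iota>_dense:
  assumes x: "x \<in> carrier QP"
  shows "\<exists>r\<in>Zloc. x \<ominus>\<^bsub>QP\<^esub> \<iota> r \<in> lat (int m)"
proof -
  have "\<exists>r. padic_norm p (x p \<ominus>\<^bsub>padic_field p\<^esub> padic_of_rat p r) \<le> real p powi (- int m)" if p: "p \<in> P" for p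
  proof -
    interpret prime_number p by (rule prime_number_P[OF p])
    show ?thesis using padic_rat_dense[OF QP_entry[OF x p], of "real p powi (- int m)"] p_gt_1 by simp
  qed
  then obtain s where s: "\<And>p. p \<in> P \<Longrightarrow>
      padic_norm p (x p \<ominus>\<^bsub>padic_field p\<^esub> padic_of_rat p (s p)) \<le> real p powi (- int m)" by metis
  obtain r where r: "r \<in> Zloc" "\<And>p. p \<in> P \<Longrightarrow> padic_abs p (r - s p) \<le> real p powi (- int m)"
    using simultaneous_approx by blast
  have "padic_norm p ((x \<ominus>\<^bsub>QP\<^esub> \<iota> r) p) \<le> real p powi (- int m)" if p: "p \<in> P" for p
  proof -
    interpret prime_number p by (rule prime_number_P[OF p])
    let ?s = "padic_of_rat p (s p)" and ?r = "padic_of_rat p r"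
    have cl: "x p \<in> carrier Q" "?s \<in> carrier Q" "?r \<in> carrier Q"
      using QP_entry[OF x p] padic_of_rat_closed by auto
    have "?s \<ominus>\<^bsub>Q\<^esub> ?r = padic_of_rat p (s p - r)"
      unfolding padic_of_rat_cls using cls_diff_of_rat(1)[OF cauchy_const, of "s p" r] by (simp add: padic_of_rat_cls)
    then have "padic_norm p (?s \<ominus>\<^bsub>Q\<^esub> ?r) \<le> real p powi (- int m)"
      using r(2)[OF p] by (simp add: padic_norm_of_rat padic_abs_diff_commute)
    then show ?thesis
      using s[OF p] padic_norm_add[of "x p \<ominus>\<^bsub>Q\<^esub> ?s" "?s \<ominus>\<^bsub>Q\<^esub> ?r"] Q_minus_trans[of "x p" ?s ?r] cl p
      by (simp add: QP_minus \<iota>_entry)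
  qed
  then show ?thesis using r(1) x by (intro bexI[of _ r]) (auto simp: lat_def)
qed

lemma lat_complete:
  fixes r :: "nat \<Rightarrow> rat"
  assumes step: "\<And>k. \<iota> (r (Suc k) - r k) \<in> lat (int k - c)"
  shows "\<exists>x\<in>carrier QP. \<forall>k. x \<ominus>\<^bsub>QP\<^esub> \<iota> (r k) \<in> lat (int k - c)"
proof -
  have "\<exists>x\<in>carrier (padic_field p). \<forall>k. padic_norm p (x \<ominus>\<^bsub>padic_field p\<^esub> padic_of_rat p (r k)) \<le> real p powi (c - int k)"
    if p: "p \<in> P" for p
    using step p by (intro prime_number.padic_complete[OF prime_number_P[OF p]]) (simp add: lat_\<iota>_iff)
  then obtain x where x: "\<And>p. p \<in> P \<Longrightarrow> x p \<in> carrier (padic_field p)"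
    "\<And>p k. p \<in> P \<Longrightarrow> padic_norm p (x p \<ominus>\<^bsub>padic_field p\<^esub> padic_of_rat p (r k)) \<le> real p powi (c - int k)"
    by metis
  have c: "restrict x P \<in> carrier QP" using x by (auto simp: QP_mem)
  have "restrict x P \<ominus>\<^bsub>QP\<^esub> \<iota> (r k) \<in> lat (int k - c)" for k
    using c x by (auto simp: lat_def QP_minus \<iota>_entry)
  then show ?thesis using c by blast
qed

text \<open>The finitely many places share one exponent, so the product topology is the topology of
  congruence modulo q^m.\<close>

lemma ball_topology_padics:
  "ball_topology (padics_topology P) (carrier QP) (\<lambda>m y x. y \<ominus>\<^bsub>QP\<^esub> x \<in> lat (int m))"
proof -
  have bt: "ball_topology (padics_topology P) (\<Pi>\<^sub>E p\<in>P. carrier (padic_field p))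
      (\<lambda>m y x. \<forall>p\<in>P. padic_norm p (y p \<ominus>\<^bsub>padic_field p\<^esub> x p) \<le> real p powi (- int m))"
    unfolding padics_topology_def
    by (rule ball_topology_product[OF prime_number.ball_topology_padic[OF prime_number_P] finite_P])
  have "(\<Pi>\<^sub>E p\<in>P. carrier (padic_field p)) = carrier QP"
    by (simp add: padics_ring_def product_ring_simps)
  note bt = bt[unfolded this]
  show ?thesis
    by (rule ball_topology_cong[OF bt]) (auto simp: lat_def QP_minus)
qed

end

section \<open>Commensurated subgroups and Schlichting completions\<close>

text \<open>A basic open set of a power of a discrete space restricts finitely many values. The set
  B is a parameter because both the full permutation group and the completion occur as B.\<close>

lemma openin_subtopology_pointwise:
  assumes "B \<subseteq> S \<rightarrow>\<^sub>E S"
  shows "openin (subtopology (product_topology (\<lambda>_. discrete_topology S) S) B) U \<longleftrightarrow>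
    U \<subseteq> B \<and> (\<forall>\<sigma>\<in>U. \<exists>E. finite E \<and> E \<subseteq> S \<and> (\<forall>\<tau>\<in>B. (\<forall>x\<in>E. \<tau> x = \<sigma> x) \<longrightarrow> \<tau> \<in> U))"
    (is "?L \<longleftrightarrow> ?R")
proof
  assume ?L
  then obtain V where V: "openin (product_topology (\<lambda>_. discrete_topology S) S) V" "U = V \<inter> B"
    by (auto simp: openin_subtopology)
  have "\<exists>E. finite E \<and> E \<subseteq> S \<and> (\<forall>\<tau>\<in>B. (\<forall>x\<in>E. \<tau> x = \<sigma> x) \<longrightarrow> \<tau> \<in> U)" if \<sigma>: "\<sigma> \<in> U" for \<sigma>
  proof -
    obtain W where W: "finite {i \<in> S. W i \<noteq> S}" "\<sigma> \<in> Pi\<^sub>E S W" "Pi\<^sub>E S W \<subseteq> V"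
      using V \<sigma> by (force simp: openin_product_topology_alt)
    have "\<tau> \<in> U" if "\<tau> \<in> B" "\<forall>x\<in>{i \<in> S. W i \<noteq> S}. \<tau> x = \<sigma> x" for \<tau>
    proof -
      have "\<tau> i \<in> W i" if "i \<in> S" for i
        using that \<open>\<tau> \<in> B\<close> assms \<open>\<forall>x\<in>{i \<in> S. W i \<noteq> S}. \<tau> x = \<sigma> x\<close> W(2)
        by (cases "W i = S") (auto simp: PiE_iff)
      then have "\<tau> \<in> Pi\<^sub>E S W"
        using \<open>\<tau> \<in> B\<close> assms by (auto simp: PiE_iff)
      then show ?thesis using W V that by auto
    qed
    then show ?thesis using W(1) by blast
  qed
  then show ?R using V by auto
next
  assume R: ?R
  then obtain E where E: "\<And>\<sigma>. \<sigma> \<in> U \<Longrightarrow> finite (E \<sigma>) \<and> E \<sigma> \<subseteq> S \<and> (\<forall>\<tau>\<in>B. (\<forall>x\<in>E \<sigma>. \<tau> x = \<sigma> x) \<longrightarrow> \<tau> \<in> U)"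
    by metis
  define V where "V = (\<Union>\<sigma>\<in>U. Pi\<^sub>E S (\<lambda>x. if x \<in> E \<sigma> then {\<sigma> x} else S))"
  have "openin (product_topology (\<lambda>_. discrete_topology S) S) (Pi\<^sub>E S (\<lambda>x. if x \<in> E \<sigma> then {\<sigma> x} else S))"
    if "\<sigma> \<in> U" for \<sigma>
  proof -
    have "{i \<in> S. (if i \<in> E \<sigma> then {\<sigma> i} else S) \<noteq> S} \<subseteq> E \<sigma>" by auto
    then have "finite {i \<in> S. (if i \<in> E \<sigma> then {\<sigma> i} else S) \<noteq> S}"
      using E[OF that] finite_subset by blast
    moreover have "\<sigma> \<in> S \<rightarrow>\<^sub>E S" using that R assms by auto
    ultimately show ?thesis by (simp add: openin_PiE_gen) (auto simp: PiE_iff)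
  qed
  then have "openin (product_topology (\<lambda>_. discrete_topology S) S) V"
    unfolding V_def by blast
  moreover have "U = V \<inter> B"
  proof
    show "U \<subseteq> V \<inter> B"
    proof
      fix \<sigma> assume \<sigma>: "\<sigma> \<in> U"
      then have "\<sigma> \<in> S \<rightarrow>\<^sub>E S" using R assms by auto
      then have "\<sigma> \<in> Pi\<^sub>E S (\<lambda>x. if x \<in> E \<sigma> then {\<sigma> x} else S)" by (auto simp: PiE_iff)
      then show "\<sigma> \<in> V \<inter> B" using \<sigma> R by (auto simp: V_def)
    qed
    show "V \<inter> B \<subseteq> U"
    proof
      fix \<tau> assume \<tau>: "\<tau> \<in> V \<inter> B"
      then obtain \<sigma> where \<sigma>: "\<sigma> \<in> U" "\<tau> \<in> Pi\<^sub>E S (\<lambda>x. if x \<in> E \<sigma> then {\<sigma> x} else S)"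
        by (auto simp: V_def)
      have "\<tau> x = \<sigma> x" if "x \<in> E \<sigma>" for x
        using \<sigma> E[OF \<sigma>(1)] that PiE_mem[OF \<sigma>(2), of x] by auto
      then show "\<tau> \<in> U" using E[OF \<sigma>(1)] \<tau> by blast
    qed
  qed
  ultimately show ?L by (auto simp: openin_subtopology)
qed

lemma Bij_subset_PiE: "Bij S \<subseteq> S \<rightarrow>\<^sub>E S"
  by (auto simp: Bij_def bij_betw_def PiE_def)

text \<open>Agreement with \<sigma> on a finite set is itself an open condition. The intersection
  with \<open>Bij S\<close> appears because only the part of A that lies in the space can meet its
  open sets.\<close>

lemma closure_of_pointwise_topology:
  "pointwise_topology S closure_of A =
    {\<sigma> \<in> Bij S. \<forall>E. finite E \<longrightarrow> E \<subseteq> S \<longrightarrow> (\<exists>\<tau>\<in>A \<inter> Bij S. \<forall>x\<in>E. \<tau> x = \<sigma> x)}"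
proof -
  note op = openin_subtopology_pointwise[OF Bij_subset_PiE]
  have top: "topspace (pointwise_topology S) = Bij S"
    using Bij_subset_PiE by (auto simp: pointwise_topology_def BijGroup_def)
  have "(\<forall>U. \<sigma> \<in> U \<and> openin (pointwise_topology S) U \<longrightarrow> (\<exists>\<tau>\<in>A. \<tau> \<in> U)) \<longleftrightarrow>
      (\<forall>E. finite E \<longrightarrow> E \<subseteq> S \<longrightarrow> (\<exists>\<tau>\<in>A \<inter> Bij S. \<forall>x\<in>E. \<tau> x = \<sigma> x))" (is "?L \<longleftrightarrow> ?R")
    if \<sigma>: "\<sigma> \<in> Bij S" for \<sigma>
  proof
    assume L: ?L
    show ?R
    proof (intro allI impI)
      fix E assume E: "finite E" "E \<subseteq> S"
      have "openin (pointwise_topology S) {\<tau> \<in> Bij S. \<forall>x\<in>E. \<tau> x = \<sigma> x}"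
        unfolding pointwise_topology_def BijGroup_def partial_object.select_convs op
      proof (intro conjI ballI exI[of _ E] impI)
        fix \<sigma>' \<tau> assume "\<sigma>' \<in> {\<tau> \<in> Bij S. \<forall>x\<in>E. \<tau> x = \<sigma> x}" "\<tau> \<in> Bij S" "\<forall>x\<in>E. \<tau> x = \<sigma>' x"
        moreover from this have "\<tau> x = \<sigma> x" if "x \<in> E" for x
          using that by (metis (mono_tags, lifting) mem_Collect_eq)
        ultimately show "\<tau> \<in> {\<tau> \<in> Bij S. \<forall>x\<in>E. \<tau> x = \<sigma> x}" by blast
      qed (use E in blast)+
      then show "\<exists>\<tau>\<in>A \<inter> Bij S. \<forall>x\<in>E. \<tau> x = \<sigma> x"
        using L[rule_format, of "{\<tau> \<in> Bij S. \<forall>x\<in>E. \<tau> x = \<sigma> x}"] \<sigma> by blast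
    qed
  next
    assume R: ?R
    show ?L
    proof (intro allI impI)
      fix U assume "\<sigma> \<in> U \<and> openin (pointwise_topology S) U"
      then obtain E where "finite E" "E \<subseteq> S" "\<forall>\<tau>\<in>Bij S. (\<forall>x\<in>E. \<tau> x = \<sigma> x) \<longrightarrow> \<tau> \<in> U"
        unfolding pointwise_topology_def BijGroup_def partial_object.select_convs op by meson
      then show "\<exists>\<tau>\<in>A. \<tau> \<in> U" using R by blast
    qed
  qed
  then have "\<sigma> \<in> pointwise_topology S closure_of A \<longleftrightarrow> \<sigma> \<in> Bij S \<and>
      (\<forall>E. finite E \<longrightarrow> E \<subseteq> S \<longrightarrow> (\<exists>\<tau>\<in>A \<inter> Bij S. \<forall>x\<in>E. \<tau> x = \<sigma> x))" for \<sigma>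
    unfolding closure_of_def top mem_Collect_eq by (rule conj_cong[OF refl])
  then show ?thesis by blast
qed

section \<open>Finite index and commensurability from separating maps\<close>

lemma (in group) mult_inv_cancel:
  assumes "x \<in> carrier G" "y \<in> carrier G"
  shows "x \<otimes> (inv x \<otimes> y) = y" "inv x \<otimes> (x \<otimes> y) = y"
  using assms by (simp_all add: m_assoc[symmetric])

lemma (in group) inv_mult_subgroup_iff:
  assumes "subgroup H G" "x \<in> carrier G" "y \<in> carrier G"
  shows "x <# H = y <# H \<longleftrightarrow> inv x \<otimes> y \<in> H"
proof
  assume "x <# H = y <# H"
  then have "y \<in> x <# H" using lcos_self[OF assms(3,1)] by simp
  then show "inv x \<otimes> y \<in> H"
    using subgroup.lcos_module_imp[OF assms(1) is_group assms(2)] by simp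
next
  assume "inv x \<otimes> y \<in> H"
  then have "y \<in> x <# H"
    using subgroup.lcos_module_rev[OF assms(1) is_group assms(2,3)] by simp
  then show "x <# H = y <# H"
    using l_repr_independence assms by blast
qed

text \<open>The coset of a depends only on the value f a, so there are at most as many cosets as
  values; the proof chooses one representative for each value.\<close>

lemma (in group) finite_rcosets_of_separating_map:
  assumes I: "subgroup I G" and H: "H \<subseteq> carrier G" and fin: "finite (f ` H)"
    and sep: "\<And>a b. a \<in> H \<Longrightarrow> b \<in> H \<Longrightarrow> f a = f b \<Longrightarrow> b \<otimes> inv a \<in> I"
  shows "finite_index G H I"
proof -
  have "(\<lambda>a. I #> a) ` H \<subseteq> (\<lambda>y. I #> (SOME a. a \<in> H \<and> f a = y)) ` f ` H"
  proof
    fix Y assume "Y \<in> (\<lambda>a. I #> a) ` H"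
    then obtain a where a: "a \<in> H" "Y = I #> a" by blast
    define b where "b = (SOME b. b \<in> H \<and> f b = f a)"
    have b: "b \<in> H \<and> f b = f a" unfolding b_def by (rule someI) (use a in auto)
    have "b \<otimes> inv a \<in> I" using sep a b by metis
    then have "b \<in> I #> a"
      using a b H subgroup.rcos_module_rev[OF I is_group] by blast
    then have "Y = I #> b" using repr_independence a H I by blast
    then show "Y \<in> (\<lambda>y. I #> (SOME a. a \<in> H \<and> f a = y)) ` f ` H"
      unfolding b_def using a by blast
  qed
  then have "finite ((\<lambda>a. I #> a) ` H)"
    using fin finite_subset by blast
  moreover have "rcosets\<^bsub>G\<lparr>carrier := H\<rparr>\<^esub> I = (\<lambda>a. I #> a) ` H"
    by (auto simp: RCOSETS_def r_coset_def)
  ultimately show ?thesis by (simp add: finite_index_def)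
qed

lemma (in group) subgroup_conj:
  assumes "subgroup H G" "g \<in> carrier G"
  shows "subgroup ((\<lambda>h. g \<otimes> h \<otimes> inv g) ` H) G"
proof -
  have "(\<lambda>h. g \<otimes> h \<otimes> inv g) \<in> hom G G"
    using assms(2) by (auto intro!: homI simp: m_assoc inv_solve_left)
  then interpret group_hom G G "\<lambda>h. g \<otimes> h \<otimes> inv g"
    by unfold_locales
  show ?thesis using subgroup_img_is_subgroup[OF assms(1)] .
qed

text \<open>The map f g stands for reduction modulo a congruence subgroup of H so deep that
  conjugation by inv g keeps it inside H. Elements with equal reduction then have their quotient in
  the intersection of H with its conjugate. For the index in the conjugate, everything is conjugated
  back and the hypothesis is applied to inv g.\<close>

lemma (in group) commensurated_of_separating_map:
  fixes f :: "'a \<Rightarrow> 'a \<Rightarrow> 'd"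
  assumes H: "subgroup H G"
    and fin: "\<And>g. g \<in> carrier G \<Longrightarrow> finite (f g ` H)"
    and sep: "\<And>g a b. g \<in> carrier G \<Longrightarrow> a \<in> H \<Longrightarrow> b \<in> H \<Longrightarrow> f g a = f g b
       \<Longrightarrow> inv g \<otimes> (b \<otimes> inv a) \<otimes> g \<in> H"
  shows "commensurated G H"
  unfolding commensurated_def Let_def
proof (intro conjI ballI H)
  fix g assume g: "g \<in> carrier G"
  note Hc = subgroup.mem_carrier[OF H]
  define H' where "H' = (\<lambda>h. g \<otimes> h \<otimes> inv g) ` H"
  have H': "subgroup H' G" unfolding H'_def using subgroup_conj[OF H g] .
  have I: "subgroup (H \<inter> H') G" using subgroups_Inter_pair[OF H H'] .
  have mem: "x \<in> H'" if "x \<in> carrier G" "inv g \<otimes> x \<otimes> g \<in> H" for x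
  proof -
    have "x = g \<otimes> (inv g \<otimes> x \<otimes> g) \<otimes> inv g"
      using that g by (simp add: m_assoc mult_inv_cancel)
    then show ?thesis unfolding H'_def using that by blast
  qed
  show "finite_index G H (H \<inter> H')"
  proof (rule finite_rcosets_of_separating_map[OF I, where f = "f g"])
    fix a b assume "a \<in> H" "b \<in> H" "f g a = f g b"
    then show "b \<otimes> inv a \<in> H \<inter> H'"
      using sep[OF g] mem Hc H by (auto simp: subgroup.m_closed subgroup.m_inv_closed)
  qed (use Hc fin g in auto)
  have ig: "inv g \<in> carrier G" using g by simp
  have unconj: "inv g \<otimes> (g \<otimes> h \<otimes> inv g) \<otimes> g = h" if "h \<in> carrier G" for h
    using that g by (simp add: m_assoc mult_inv_cancel)
  \<comment> \<open>Conjugating back maps H' onto H, so the pulled back separating map has the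
    finite image of \<open>f (inv g)\<close>.\<close>
  have im: "(\<lambda>x. inv g \<otimes> x \<otimes> g) ` H' = H"
    unfolding H'_def image_image using unconj Hc by force
  show "finite_index G H' (H \<inter> H')"
  proof (rule finite_rcosets_of_separating_map[OF I, where f = "\<lambda>x. f (inv g) (inv g \<otimes> x \<otimes> g)"])
    show "H' \<subseteq> carrier G" using subgroup.subset[OF H'] .
    have "(\<lambda>x. f (inv g) (inv g \<otimes> x \<otimes> g)) ` H' = f (inv g) ` (\<lambda>x. inv g \<otimes> x \<otimes> g) ` H'"
      unfolding image_image ..
    also have "\<dots> = f (inv g) ` H" unfolding im ..
    finally have "(\<lambda>x. f (inv g) (inv g \<otimes> x \<otimes> g)) ` H' = f (inv g) ` H" .
    then show "finite ((\<lambda>x. f (inv g) (inv g \<otimes> x \<otimes> g)) ` H')"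
      using fin[OF ig] by simp
    fix x y assume xy: "x \<in> H'" "y \<in> H'" "f (inv g) (inv g \<otimes> x \<otimes> g) = f (inv g) (inv g \<otimes> y \<otimes> g)"
    obtain a b where ab: "a \<in> H" "b \<in> H" "x = g \<otimes> a \<otimes> inv g" "y = g \<otimes> b \<otimes> inv g"
      using xy by (auto simp: H'_def)
    then have "f (inv g) a = f (inv g) b" using xy unconj Hc by simp
    then have "inv (inv g) \<otimes> (b \<otimes> inv a) \<otimes> inv g \<in> H" by (rule sep[OF ig ab(1,2)])
    moreover have "y \<otimes> inv x = g \<otimes> (b \<otimes> inv a) \<otimes> inv g"
      using ab Hc[OF ab(1)] Hc[OF ab(2)] g
      by (simp add: inv_mult_group m_assoc mult_inv_cancel)
    ultimately have "y \<otimes> inv x \<in> H" using g by simp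
    then show "y \<otimes> inv x \<in> H \<inter> H'"
      using xy H' by (auto simp: subgroup.m_closed subgroup.m_inv_closed)
  qed
qed

text \<open>A model of the Schlichting completion: \<open>C m\<close> is the pointwise stabiliser of the cosets of
  \<open>F m\<close>, and these stabilisers control both the topology modulo \<open>N\<close> and completeness.\<close>

locale schlichting_model = \<Gamma>: group \<Gamma> + G: group G
  for \<Gamma> :: "('g, 'u) monoid_scheme" and G :: "('h, 'v) monoid_scheme" (structure) +
  fixes \<iota> :: "'g \<Rightarrow> 'h" and K :: "'h set" and F :: "nat \<Rightarrow> 'g set" and T :: "'h topology"
    and C :: "nat \<Rightarrow> 'h set" and N :: "'h set" and \<Lambda> :: "'g set"
  assumes C_eq: "\<And>m. C m = {g \<in> carrier G. \<forall>c\<in>F m. inv (\<iota> c) \<otimes> g \<otimes> \<iota> c \<in> K}"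
    and \<iota>_hom: "\<iota> \<in> hom \<Gamma> G"
    and K: "subgroup K G"
    and N_eq: "N = {g \<in> carrier G. \<forall>c\<in>carrier \<Gamma>. inv (\<iota> c) \<otimes> g \<otimes> \<iota> c \<in> K}"
    and \<Lambda>_eq: "\<Lambda> = {c \<in> carrier \<Gamma>. \<iota> c \<in> K}"
    and dense: "\<And>g m. g \<in> carrier G \<Longrightarrow> \<exists>c\<in>carrier \<Gamma>. inv (\<iota> c) \<otimes> g \<in> C m"
    and F_finite: "\<And>m. finite (F m)" and F_sub: "\<And>m. F m \<subseteq> carrier \<Gamma>"
    and F_mono: "mono F"
    and cofinal: "\<And>c. c \<in> carrier \<Gamma> \<Longrightarrow> \<exists>m. \<forall>g\<in>C m. inv (\<iota> c) \<otimes> g \<otimes> \<iota> c \<in> K"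
    and complete: "\<And>c. (\<And>m. c m \<in> carrier \<Gamma>) \<Longrightarrow> (\<And>m. inv (\<iota> (c m)) \<otimes> \<iota> (c (Suc m)) \<in> C m)
      \<Longrightarrow> \<exists>g\<in>carrier G. \<forall>m. inv (\<iota> (c m)) \<otimes> g \<in> C m"
    and T_space: "topspace T = carrier G"
    and T_open: "\<And>U. U \<subseteq> carrier G \<Longrightarrow> (\<And>g x. g \<in> U \<Longrightarrow> x \<in> N \<Longrightarrow> g \<otimes> x \<in> U) \<Longrightarrow>
      openin T U \<longleftrightarrow> (\<forall>g\<in>U. \<exists>m. \<forall>x\<in>C m. g \<otimes> x \<in> U)"
begin

text \<open>\<open>moves g c c'\<close> says that \<open>g\<close> maps the coset of \<open>\<iota> c\<close> in \<open>G/K\<close> to that of \<open>\<iota> c'\<close>.\<close>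

definition moves :: "'h \<Rightarrow> 'g \<Rightarrow> 'g \<Rightarrow> bool" where
  "moves g c c' \<longleftrightarrow> inv (\<iota> c') \<otimes> g \<otimes> \<iota> c \<in> K"

abbreviation "L \<equiv> lcosets\<^bsub>\<Gamma>\<^esub> \<Lambda>"
abbreviation coset where "coset c \<equiv> c <#\<^bsub>\<Gamma>\<^esub> \<Lambda>"

sublocale \<iota>: group_hom \<Gamma> G \<iota>
  using \<iota>_hom by unfold_locales

section \<open>The relation \<open>moves\<close> and the action on cosets\<close>

lemma \<Lambda>: "subgroup \<Lambda> \<Gamma>"
proof -
  show ?thesis
    unfolding \<Lambda>_eq using K
    by (intro \<Gamma>.subgroupI) (auto simp: subgroup.m_closed subgroup.m_inv_closed subgroup.one_closed
      intro!: exI[of _ "\<one>\<^bsub>\<Gamma>\<^esub>"])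
qed

lemma L_iff: "Y \<in> L \<longleftrightarrow> (\<exists>c\<in>carrier \<Gamma>. Y = coset c)"
  by (auto simp: LCOSETS_def)

lemma finite_cosets_obtain:
  assumes "finite E" "E \<subseteq> L"
  obtains E' where "E' \<subseteq> carrier \<Gamma>" "finite E'" "E = coset ` E'"
proof -
  have "E \<subseteq> coset ` carrier \<Gamma>" using assms by (auto simp: LCOSETS_def)
  then show ?thesis using that finite_subset_image[OF assms(1)] by metis
qed

lemma coset_L: "c \<in> carrier \<Gamma> \<Longrightarrow> coset c \<in> L"
  by (auto simp: L_iff)

text \<open>Some \<open>C m\<close> lies in K, by cofinality at the identity of \<Gamma>. Density
  therefore gives every coset of K in G a representative in the image of \<Gamma>.\<close>

lemma moves_ex:
  assumes [simp]: "g \<in> carrier G" "c \<in> carrier \<Gamma>"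
  shows "\<exists>c'\<in>carrier \<Gamma>. moves g c c'"
proof -
  obtain m where m: "\<forall>g\<in>C m. inv (\<iota> \<one>\<^bsub>\<Gamma>\<^esub>) \<otimes> g \<otimes> \<iota> \<one>\<^bsub>\<Gamma>\<^esub> \<in> K"
    using cofinal[of "\<one>\<^bsub>\<Gamma>\<^esub>"] by blast
  have "C m \<subseteq> carrier G" unfolding C_eq by auto
  then have "C m \<subseteq> K" using m by (force simp: \<iota>.hom_one)
  then show ?thesis using dense[of "g \<otimes> \<iota> c" m] by (auto simp: moves_def G.m_assoc)
qed

lemma moves_mult:
  assumes "moves h c c'" "moves g c' c''" and [simp]: "g \<in> carrier G" "h \<in> carrier G"
    "c \<in> carrier \<Gamma>" "c' \<in> carrier \<Gamma>" "c'' \<in> carrier \<Gamma>"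
  shows "moves (g \<otimes> h) c c''"
proof -
  have "(inv (\<iota> c'') \<otimes> g \<otimes> \<iota> c') \<otimes> (inv (\<iota> c') \<otimes> h \<otimes> \<iota> c) \<in> K"
    using assms(1,2) K by (simp add: moves_def subgroup.m_closed)
  then show ?thesis by (simp add: moves_def G.m_assoc G.mult_inv_cancel)
qed

lemma moves_inv:
  assumes "moves g c c'" and [simp]: "g \<in> carrier G" "c \<in> carrier \<Gamma>" "c' \<in> carrier \<Gamma>"
  shows "moves (inv g) c' c"
proof -
  have "inv (inv (\<iota> c') \<otimes> g \<otimes> \<iota> c) \<in> K"
    using assms(1) K by (simp add: moves_def subgroup.m_inv_closed)
  then show ?thesis by (simp add: moves_def G.inv_mult_group G.m_assoc)
qed

lemma moves_one_iff:
  assumes [simp]: "c \<in> carrier \<Gamma>" "c' \<in> carrier \<Gamma>"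
  shows "moves \<one> c c' \<longleftrightarrow> coset c = coset c'"
proof -
  have "moves \<one> c c' \<longleftrightarrow> inv\<^bsub>\<Gamma>\<^esub> c' \<otimes>\<^bsub>\<Gamma>\<^esub> c \<in> \<Lambda>"
    by (auto simp: moves_def \<Lambda>_eq)
  also have "\<dots> \<longleftrightarrow> coset c' = coset c" using \<Gamma>.inv_mult_subgroup_iff[OF \<Lambda>] by simp
  finally show ?thesis by auto
qed

lemma moves_\<iota>:
  assumes [simp]: "a \<in> carrier \<Gamma>" "c \<in> carrier \<Gamma>"
  shows "moves (\<iota> a) c (a \<otimes>\<^bsub>\<Gamma>\<^esub> c)"
  using K by (simp add: moves_def G.inv_mult_group G.m_assoc G.mult_inv_cancel subgroup.one_closed)

text \<open>Equality of cosets is the relation \<open>moves \<one>\<close>, so compatibility with it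
  follows by composing and inverting moves.\<close>

lemma moves_unique:
  assumes "moves g c1 c1'" "moves g c2 c2'" "g \<in> carrier G"
    "c1 \<in> carrier \<Gamma>" "c2 \<in> carrier \<Gamma>" "c1' \<in> carrier \<Gamma>" "c2' \<in> carrier \<Gamma>" "coset c1 = coset c2"
  shows "coset c1' = coset c2'"
proof -
  have "moves (\<one> \<otimes> inv g) c1' c2"
    using assms moves_one_iff moves_inv by (intro moves_mult[of _ _ c1]) auto
  then have "moves (g \<otimes> inv g) c1' c2'"
    using assms by (intro moves_mult[of _ _ c2]) auto
  then show ?thesis using assms moves_one_iff by simp
qed

lemma moves_cong:
  assumes "moves g c1 c1'" "g \<in> carrier G"
    "c1 \<in> carrier \<Gamma>" "c2 \<in> carrier \<Gamma>" "c1' \<in> carrier \<Gamma>" "c2' \<in> carrier \<Gamma>"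
    "coset c1 = coset c2" "coset c1' = coset c2'"
  shows "moves g c2 c2'"
proof -
  have "moves (g \<otimes> \<one>) c2 c1'"
    using assms moves_one_iff by (intro moves_mult[of _ _ c1]) auto
  then have "moves (\<one> \<otimes> g) c2 c2'"
    using assms moves_one_iff by (intro moves_mult[of _ _ c1']) auto
  then show ?thesis using assms by simp
qed

text \<open>The action on G/K transported to \<Gamma>/\<Lambda>. Collecting every c' that is reached
  from some member of Y avoids a choice of representatives.\<close>

definition act :: "'h \<Rightarrow> 'g set \<Rightarrow> 'g set" where
  "act g = (\<lambda>Y\<in>L. {c' \<in> carrier \<Gamma>. \<exists>c\<in>Y. moves g c c'})"

lemma mem_coset_iff: "c \<in> carrier \<Gamma> \<Longrightarrow> x \<in> coset c \<longleftrightarrow> x \<in> carrier \<Gamma> \<and> coset c = coset x"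
  using \<Gamma>.l_repr_independence[OF _ _ \<Lambda>] \<Gamma>.lcos_self[OF _ \<Lambda>] \<Gamma>.l_coset_carrier[OF _ _ \<Lambda>]
  by metis

lemma act_coset:
  assumes "moves g c c'" "g \<in> carrier G" "c \<in> carrier \<Gamma>" "c' \<in> carrier \<Gamma>"
  shows "act g (coset c) = coset c'"
proof -
  have "x \<in> {c' \<in> carrier \<Gamma>. \<exists>c\<in>coset c. moves g c c'} \<longleftrightarrow> x \<in> coset c'" for x
  proof
    assume "x \<in> {c' \<in> carrier \<Gamma>. \<exists>c\<in>coset c. moves g c c'}"
    then obtain c1 where "x \<in> carrier \<Gamma>" "c1 \<in> carrier \<Gamma>" "coset c = coset c1" "moves g c1 x"
      using assms mem_coset_iff by blast
    then show "x \<in> coset c'"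
      using moves_unique[OF assms(1), of c1 x] assms mem_coset_iff by blast
  next
    assume "x \<in> coset c'"
    then have "x \<in> carrier \<Gamma>" "coset c' = coset x" using assms mem_coset_iff by blast+
    then have "moves g c x" using moves_cong[OF assms(1), of c x] assms by blast
    then show "x \<in> {c' \<in> carrier \<Gamma>. \<exists>c\<in>coset c. moves g c c'}"
      using assms mem_coset_iff \<open>x \<in> carrier \<Gamma>\<close> by blast
  qed
  then show ?thesis unfolding act_def using coset_L assms by auto
qed

lemma act_eq_iff:
  assumes "g \<in> carrier G" "c \<in> carrier \<Gamma>" "c' \<in> carrier \<Gamma>"
  shows "act g (coset c) = coset c' \<longleftrightarrow> moves g c c'"
  using assms moves_ex[OF assms(1,2)] act_coset moves_cong by metis

lemma act_closed: "g \<in> carrier G \<Longrightarrow> Y \<in> L \<Longrightarrow> act g Y \<in> L"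
  using moves_ex act_coset by (auto simp: L_iff) metis

lemma act_mult:
  assumes "g \<in> carrier G" "h \<in> carrier G" "Y \<in> L"
  shows "act (g \<otimes> h) Y = act g (act h Y)"
proof -
  obtain c where c: "c \<in> carrier \<Gamma>" "Y = coset c" using assms L_iff by auto
  obtain c' where c': "c' \<in> carrier \<Gamma>" "moves h c c'" using moves_ex assms c by blast
  obtain c'' where c'': "c'' \<in> carrier \<Gamma>" "moves g c' c''" using moves_ex assms c' by blast
  have "moves (g \<otimes> h) c c''" using moves_mult assms c c' c'' by blast
  then show ?thesis using c c' c'' assms act_coset by simp
qed

lemma act_one: "Y \<in> L \<Longrightarrow> act \<one> Y = Y"
  using moves_one_iff act_coset[of "\<one>"] unfolding L_iff by fastforce

lemma act_Bij: "g \<in> carrier G \<Longrightarrow> act g \<in> Bij L"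
proof -
  assume g: "g \<in> carrier G"
  have "bij_betw (act g) L L"
    using g act_mult[of g "inv g"] act_mult[of "inv g" g]
    by (intro bij_betw_byWitness[where f' = "act (inv g)"]) (auto simp: act_one act_closed)
  then show ?thesis by (auto simp: Bij_def act_def)
qed

lemma act_hom: "act \<in> hom G (BijGroup L)"
proof (rule homI)
  fix g h assume gh: "g \<in> carrier G" "h \<in> carrier G"
  have "act (g \<otimes> h) Y = compose L (act g) (act h) Y" for Y
    using gh act_mult by (cases "Y \<in> L") (auto simp: compose_def act_def)
  then show "act (g \<otimes> h) = act g \<otimes>\<^bsub>BijGroup L\<^esub> act h"
    using gh act_Bij by (auto simp: BijGroup_def)
qed (auto simp: act_Bij BijGroup_def)

lemma act_\<iota>: "a \<in> carrier \<Gamma> \<Longrightarrow> act (\<iota> a) = schlichting_map \<Gamma> \<Lambda> a"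
proof
  fix Y assume a: "a \<in> carrier \<Gamma>"
  show "act (\<iota> a) Y = schlichting_map \<Gamma> \<Lambda> a Y"
  proof (cases "Y \<in> L")
    case True
    then obtain c where c: "c \<in> carrier \<Gamma>" "Y = coset c" using L_iff by auto
    have "act (\<iota> a) Y = coset (a \<otimes>\<^bsub>\<Gamma>\<^esub> c)"
      using a c by (simp add: act_coset moves_\<iota>)
    also have "\<dots> = a <#\<^bsub>\<Gamma>\<^esub> Y"
      using a c \<Gamma>.lcos_m_assoc[OF subgroup.subset[OF \<Lambda>]] by simp
    finally show ?thesis using True by (simp add: schlichting_map_def)
  qed (simp add: schlichting_map_def act_def)
qed

lemma C_iff: "g \<in> C m \<longleftrightarrow> g \<in> carrier G \<and> (\<forall>c\<in>F m. moves g c c)"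
  by (auto simp: C_eq moves_def)

lemma N_iff: "g \<in> N \<longleftrightarrow> g \<in> carrier G \<and> (\<forall>c\<in>carrier \<Gamma>. moves g c c)"
  by (auto simp: N_eq moves_def)

lemma C_antimono: "m \<le> m' \<Longrightarrow> C m' \<subseteq> C m"
  using monoD[OF F_mono, of m m'] unfolding C_eq by blast

lemma cofinal': "c \<in> carrier \<Gamma> \<Longrightarrow> \<exists>m. \<forall>g\<in>C m. moves g c c"
  using cofinal by (simp add: moves_def)

lemma cofinal_finite:
  assumes "finite E" "E \<subseteq> carrier \<Gamma>"
  shows "\<exists>m. \<forall>g\<in>C m. \<forall>c\<in>E. moves g c c"
  using assms
proof (induction E)
  case (insert c E)
  then obtain m m' where "\<forall>g\<in>C m. \<forall>c\<in>E. moves g c c" "\<forall>g\<in>C m'. moves g c c"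
    using cofinal'[of c] by auto
  then have "\<forall>g\<in>C (max m m'). \<forall>c\<in>insert c E. moves g c c"
    using C_antimono[of m "max m m'"] C_antimono[of m' "max m m'"] by auto
  then show ?case by blast
qed simp

text \<open>Translates between stabilisers and the pointwise topology: a quotient lies in
  \<open>C m\<close> exactly when both elements agree on the cosets of \<open>F m\<close>.\<close>

lemma moves_quotient:
  assumes "g \<in> carrier G" "h \<in> carrier G" "c \<in> carrier \<Gamma>"
  shows "moves (inv g \<otimes> h) c c \<longleftrightarrow> act g (coset c) = act h (coset c)"
proof -
  have "moves (inv g \<otimes> h) c c \<longleftrightarrow> act (inv g) (act h (coset c)) = coset c"
    using assms act_eq_iff[of "inv g \<otimes> h" c c] by (simp add: act_mult coset_L)
  also have "\<dots> \<longleftrightarrow> act g (act (inv g) (act h (coset c))) = act g (coset c)"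
    using assms act_Bij[of g] by (auto simp: Bij_def bij_betw_def act_closed coset_L inj_on_eq_iff)
  also have "act g (act (inv g) (act h (coset c))) = act h (coset c)"
    using assms by (simp add: act_mult[symmetric] act_closed coset_L act_one G.mult_inv_cancel)
  finally show ?thesis by auto
qed

lemma kernel_act: "kernel G (BijGroup L) act = N"
proof -
  have "act g = \<one>\<^bsub>BijGroup L\<^esub> \<longleftrightarrow> (\<forall>c\<in>carrier \<Gamma>. moves g c c)" if g: "g \<in> carrier G" for g
  proof -
    have "act g = \<one>\<^bsub>BijGroup L\<^esub> \<longleftrightarrow> (\<forall>Y\<in>L. act g Y = Y)"
      by (auto simp: BijGroup_def act_def fun_eq_iff restrict_def)
    also have "\<dots> \<longleftrightarrow> (\<forall>c\<in>carrier \<Gamma>. act g (coset c) = coset c)"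
      by (simp add: LCOSETS_def)
    finally show ?thesis using g act_eq_iff by simp
  qed
  then show ?thesis by (auto simp: kernel_def N_iff)
qed

lemma N_normal: "N \<lhd> G"
proof -
  interpret group_hom G "BijGroup L" act
    by (intro group_hom.intro group_hom_axioms.intro G.is_group group_BijGroup act_hom)
  show ?thesis using normal_kernel by (simp add: kernel_act)
qed

section \<open>The completion as the image of the action\<close>

lemma completion_carrier: "carrier (schlichting_completion \<Gamma> \<Lambda>) = act ` carrier G"
proof -
  have sm: "schlichting_map \<Gamma> \<Lambda> ` carrier \<Gamma> = (\<lambda>a. act (\<iota> a)) ` carrier \<Gamma>"
    by (auto simp: act_\<iota>)
  have "(pointwise_topology L closure_of ((\<lambda>a. act (\<iota> a)) ` carrier \<Gamma>)) = act ` carrier G"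
  proof
    show "act ` carrier G \<subseteq> pointwise_topology L closure_of ((\<lambda>a. act (\<iota> a)) ` carrier \<Gamma>)"
    proof
      fix \<sigma> assume "\<sigma> \<in> act ` carrier G"
      then obtain g where g: "g \<in> carrier G" "\<sigma> = act g" by auto
      have "\<exists>\<tau>\<in>(\<lambda>a. act (\<iota> a)) ` carrier \<Gamma> \<inter> Bij L. \<forall>Y\<in>E. \<tau> Y = \<sigma> Y" if E: "finite E" "E \<subseteq> L" for E
      proof -
        obtain E' where E': "E' \<subseteq> carrier \<Gamma>" "finite E'" "E = coset ` E'"
          using finite_cosets_obtain[OF E(1,2)] by blast
        obtain m where m: "\<forall>g\<in>C m. \<forall>c\<in>E'. moves g c c"
          using cofinal_finite[of E'] E' by auto
        obtain a where a: "a \<in> carrier \<Gamma>" "inv (\<iota> a) \<otimes> g \<in> C m"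
          using dense g by blast
        have "act (\<iota> a) (coset c) = \<sigma> (coset c)" if "c \<in> E'" for c
          using m a E' g that moves_quotient[of "\<iota> a" g c] by auto
        then have "\<forall>Y\<in>E. act (\<iota> a) Y = \<sigma> Y" using E' by simp
        then show ?thesis using a act_Bij by (intro bexI[of _ "act (\<iota> a)"]) auto
      qed
      then show "\<sigma> \<in> pointwise_topology L closure_of ((\<lambda>a. act (\<iota> a)) ` carrier \<Gamma>)"
        using g act_Bij by (auto simp: closure_of_pointwise_topology)
    qed
    show "pointwise_topology L closure_of ((\<lambda>a. act (\<iota> a)) ` carrier \<Gamma>) \<subseteq> act ` carrier G"
    proof
      fix \<sigma> assume "\<sigma> \<in> pointwise_topology L closure_of ((\<lambda>a. act (\<iota> a)) ` carrier \<Gamma>)"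
      then have \<sigma>: "\<sigma> \<in> Bij L"
        and ap: "\<And>E. finite E \<Longrightarrow> E \<subseteq> L \<Longrightarrow> \<exists>a\<in>carrier \<Gamma>. \<forall>Y\<in>E. act (\<iota> a) Y = \<sigma> Y"
        unfolding closure_of_pointwise_topology by blast+
      have approx: "\<exists>a\<in>carrier \<Gamma>. \<forall>c\<in>E. act (\<iota> a) (coset c) = \<sigma> (coset c)"
        if "finite E" "E \<subseteq> carrier \<Gamma>" for E
        using ap[of "coset ` E"] that coset_L by auto
      obtain a where a: "\<And>m. a m \<in> carrier \<Gamma>"
        "\<And>m c. c \<in> F m \<Longrightarrow> act (\<iota> (a m)) (coset c) = \<sigma> (coset c)"
        using approx[OF F_finite F_sub] by metis
      \<comment> \<open>Stated for a general b because it serves both the next term of the sequence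
        and the auxiliary elements used below.\<close>
      have in_C: "inv (\<iota> (a m)) \<otimes> \<iota> b \<in> C m"
        if "b \<in> carrier \<Gamma>" "\<And>c. c \<in> F m \<Longrightarrow> act (\<iota> b) (coset c) = \<sigma> (coset c)" for b m
      proof -
        have "moves (inv (\<iota> (a m)) \<otimes> \<iota> b) c c" if "c \<in> F m" for c
          using moves_quotient[of "\<iota> (a m)" "\<iota> b" c] that a \<open>b \<in> _\<close> F_sub[of m]
            \<open>c \<in> F m \<Longrightarrow> act (\<iota> b) (coset c) = \<sigma> (coset c)\<close> by auto
        then show ?thesis using that a by (auto simp: C_iff)
      qed
      have "F m \<subseteq> F (Suc m)" for m using F_mono by (auto simp: mono_def)
      then have "inv (\<iota> (a m)) \<otimes> \<iota> (a (Suc m)) \<in> C m" for m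
        using a by (intro in_C) blast+
      then obtain g where g: "g \<in> carrier G" "\<And>m. inv (\<iota> (a m)) \<otimes> g \<in> C m"
        using complete[of a] a by blast
      have "act g (coset c) = \<sigma> (coset c)" if c: "c \<in> carrier \<Gamma>" for c
      proof -
        obtain m where m: "\<forall>g\<in>C m. moves g c c" using cofinal'[OF c] by blast
        \<comment> \<open>Agreement of a m with \<sigma> is known only on the cosets of
          \<open>F m\<close>, and c need not be among them. An element b that agrees with \<sigma>
          there and at c differs from a m by an element of \<open>C m\<close>, which fixes the coset
          of c, so a m agrees with \<sigma> at c as well.\<close>
        obtain b where b: "b \<in> carrier \<Gamma>" "\<forall>x\<in>insert c (F m). act (\<iota> b) (coset x) = \<sigma> (coset x)"
          using approx[of "insert c (F m)"] c F_finite F_sub by blast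
        have "act (\<iota> (a m)) (coset c) = act (\<iota> b) (coset c)"
          using in_C[OF b(1)] b(2) m moves_quotient[of "\<iota> (a m)" "\<iota> b" c] a c b(1) by auto
        moreover have "act (\<iota> (a m)) (coset c) = act g (coset c)"
          using g m moves_quotient[of "\<iota> (a m)" g c] a c by auto
        ultimately show ?thesis using b by auto
      qed
      then have "\<forall>Y\<in>L. act g Y = \<sigma> Y" by (simp add: LCOSETS_def)
      then have "act g Y = \<sigma> Y" for Y
        using \<sigma> by (cases "Y \<in> L") (simp_all add: act_def Bij_def extensional_def)
      then show "\<sigma> \<in> act ` carrier G" using g by (metis ext imageI)
    qed
  qed
  then show ?thesis by (simp add: schlichting_completion_def sm)
qed

text \<open>The form in which \<open>FactGroup_iso_set\<close> presents the map induced on the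
  quotient by a kernel.\<close>

definition completion_iso :: "'h set \<Rightarrow> 'g set \<Rightarrow> 'g set" where
  "completion_iso Y = the_elem (act ` Y)"

lemma act_mult_N: "g \<in> carrier G \<Longrightarrow> x \<in> N \<Longrightarrow> act (x \<otimes> g) = act g"
proof
  fix Y assume g: "g \<in> carrier G" and x: "x \<in> N"
  show "act (x \<otimes> g) Y = act g Y"
  proof (cases "Y \<in> L")
    case True
    then obtain c where "c \<in> carrier \<Gamma>" "act g Y = coset c"
      using act_closed[OF g] L_iff by blast
    then show ?thesis using x True g act_coset[of x c c] by (simp add: N_iff act_mult)
  qed (simp add: act_def)
qed

lemma completion_iso_coset: "g \<in> carrier G \<Longrightarrow> completion_iso (N #> g) = act g"
proof -
  assume g: "g \<in> carrier G"
  have "act ` (N #> g) = {act g}"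
  proof (intro equalityI subsetI)
    fix x assume "x \<in> act ` (N #> g)"
    then show "x \<in> {act g}" using act_mult_N[OF g] by (auto simp: r_coset_def)
  next
    have "g \<in> N #> g" using G.rcos_self[OF g normal.axioms(1)[OF N_normal]] .
    then show "x \<in> act ` (N #> g)" if "x \<in> {act g}" for x using that by blast
  qed
  then show ?thesis by (simp add: completion_iso_def)
qed

text \<open>The first isomorphism theorem for \<open>act\<close> with the completion as codomain.
  Multiplication and unit are inherited from \<open>BijGroup L\<close>, so the kernel is still N,
  and \<open>completion_carrier\<close> gives surjectivity.\<close>

lemma completion_iso: "completion_iso \<in> iso (G Mod N) (schlichting_completion \<Gamma> \<Lambda>)"
proof -
  interpret h: group_hom G "BijGroup L" act
    by (intro group_hom.intro group_hom_axioms.intro G.is_group group_BijGroup act_hom)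
  have eq: "schlichting_completion \<Gamma> \<Lambda> = (BijGroup L)\<lparr>carrier := act ` carrier G\<rparr>"
    using completion_carrier by (simp add: schlichting_completion_def)
  have gr: "group (schlichting_completion \<Gamma> \<Lambda>)"
    unfolding eq using h.img_is_subgroup subgroup.subgroup_is_group group_BijGroup by blast
  interpret h': group_hom G "schlichting_completion \<Gamma> \<Lambda>" act
    using gr act_hom unfolding eq
    by (intro group_hom.intro group_hom_axioms.intro) (auto simp: hom_def G.is_group)
  have "kernel G (schlichting_completion \<Gamma> \<Lambda>) act = N"
    using kernel_act by (simp add: kernel_def eq)
  then show ?thesis
    using h'.FactGroup_iso_set completion_carrier unfolding completion_iso_def[abs_def] by simp
qed

lemma carrier_Mod: "carrier (G Mod N) = (\<lambda>g. N #> g) ` carrier G"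
  by (auto simp: FactGroup_def RCOSETS_def)

lemma r_coset_mult_N: "g \<in> carrier G \<Longrightarrow> x \<in> N \<Longrightarrow> N #> (g \<otimes> x) = N #> g"
proof -
  assume gx: "g \<in> carrier G" "x \<in> N"
  interpret N: normal N G by (rule N_normal)
  have "g \<otimes> x \<in> N #> g"
    using gx N.coset_eq by (auto simp: l_coset_def)
  then show ?thesis using G.repr_independence gx N.subgroup_axioms by metis
qed

section \<open>Comparison of the two topologies\<close>

text \<open>Preimages of sets of cosets are N-invariant, so \<open>T_open\<close> applies to them.
  The resulting condition has the same shape as the one in
  \<open>openin_schlichting_iff\<close>.\<close>

lemma openin_coset_topology_iff:
  "openin (coset_topology G T N) W \<longleftrightarrow> W \<subseteq> carrier (G Mod N) \<and>
    (\<forall>g\<in>carrier G. N #> g \<in> W \<longrightarrow> (\<exists>m. \<forall>x\<in>C m. N #> (g \<otimes> x) \<in> W))"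
proof -
  have "openin T {g \<in> carrier G. N #> g \<in> W} \<longleftrightarrow>
      (\<forall>g\<in>{g \<in> carrier G. N #> g \<in> W}. \<exists>m. \<forall>x\<in>C m. g \<otimes> x \<in> {g \<in> carrier G. N #> g \<in> W})"
    by (rule T_open) (auto simp: r_coset_mult_N N_iff)
  then show ?thesis
    unfolding openin_coset_topology T_space by (auto simp: C_iff)
qed

lemma topspace_coset_topology: "topspace (coset_topology G T N) = carrier (G Mod N)"
proof
  show "topspace (coset_topology G T N) \<subseteq> carrier (G Mod N)"
    using openin_topspace[of "coset_topology G T N"] unfolding openin_coset_topology_iff by blast
  have "openin (coset_topology G T N) (carrier (G Mod N))"
    by (auto simp: openin_coset_topology_iff carrier_Mod C_iff)
  then show "carrier (G Mod N) \<subseteq> topspace (coset_topology G T N)"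
    by (rule openin_subset)
qed

lemma schlichting_topology_eq: "schlichting_topology \<Gamma> \<Lambda> =
    subtopology (product_topology (\<lambda>_. discrete_topology L) L) (act ` carrier G)"
proof -
  have "carrier (BijGroup L) \<inter> act ` carrier G = act ` carrier G"
    using act_Bij by (auto simp: BijGroup_def)
  then show ?thesis
    by (simp add: schlichting_topology_def pointwise_topology_def subtopology_subtopology completion_carrier)
qed

lemma act_PiE: "act ` carrier G \<subseteq> L \<rightarrow>\<^sub>E L"
  using act_Bij Bij_subset_PiE by blast

text \<open>Every finite set of cosets is fixed by some \<open>C m\<close>, and conversely
  \<open>C m\<close> is the stabiliser of a finite set, that of the cosets of
  \<open>F m\<close>.\<close>

lemma openin_schlichting_iff:
  "openin (schlichting_topology \<Gamma> \<Lambda>) U \<longleftrightarrow> U \<subseteq> act ` carrier G \<and>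
    (\<forall>g\<in>carrier G. act g \<in> U \<longrightarrow> (\<exists>m. \<forall>x\<in>C m. act (g \<otimes> x) \<in> U))" (is "_ \<longleftrightarrow> ?R")
  unfolding schlichting_topology_eq openin_subtopology_pointwise[OF act_PiE]
proof safe
  fix g assume g: "g \<in> carrier G" "act g \<in> U"
  assume "\<forall>\<sigma>\<in>U. \<exists>E. finite E \<and> E \<subseteq> L \<and> (\<forall>\<tau>\<in>act ` carrier G. (\<forall>x\<in>E. \<tau> x = \<sigma> x) \<longrightarrow> \<tau> \<in> U)"
  then obtain E where E: "finite E" "E \<subseteq> L"
    "\<And>h. h \<in> carrier G \<Longrightarrow> (\<forall>x\<in>E. act h x = act g x) \<Longrightarrow> act h \<in> U"
    using g by (metis imageI)
  obtain E' where E': "E' \<subseteq> carrier \<Gamma>" "finite E'" "E = coset ` E'"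
    using finite_cosets_obtain[OF E(1,2)] by blast
  obtain m where m: "\<forall>g\<in>C m. \<forall>c\<in>E'. moves g c c"
    using cofinal_finite[of E'] E' by auto
  have "act (g \<otimes> x) \<in> U" if x: "x \<in> C m" for x
  proof (rule E(3))
    show "\<forall>Y\<in>E. act (g \<otimes> x) Y = act g Y"
    proof
      fix Y assume "Y \<in> E"
      then obtain c where c: "c \<in> E'" "c \<in> carrier \<Gamma>" "Y = coset c" using E' by auto
      then have "act x Y = Y" using m x by (simp add: act_coset C_iff)
      then show "act (g \<otimes> x) Y = act g Y"
        using g x c by (simp add: act_mult C_iff coset_L)
    qed
  qed (use g x in \<open>auto simp: C_iff\<close>)
  then show "\<exists>m. \<forall>x\<in>C m. act (g \<otimes> x) \<in> U" by blast
next
  fix \<sigma> assume R: "\<forall>g\<in>carrier G. act g \<in> U \<longrightarrow> (\<exists>m. \<forall>x\<in>C m. act (g \<otimes> x) \<in> U)"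
    and \<sigma>: "\<sigma> \<in> U" "U \<subseteq> act ` carrier G"
  then obtain g where g: "g \<in> carrier G" "\<sigma> = act g" by blast
  then obtain m where m: "\<forall>x\<in>C m. act (g \<otimes> x) \<in> U" using R \<sigma> by blast
  have "act h \<in> U" if h: "h \<in> carrier G" "\<forall>Y\<in>coset ` F m. act h Y = \<sigma> Y" for h
  proof -
    have "inv g \<otimes> h \<in> C m"
      using g h moves_quotient[of g h] F_sub[of m] by (auto simp: C_iff)
    then have "act (g \<otimes> (inv g \<otimes> h)) \<in> U" using m by blast
    then show ?thesis using g h by (simp add: G.m_assoc[symmetric])
  qed
  moreover have "finite (coset ` F m)" "coset ` F m \<subseteq> L"
    using F_finite F_sub coset_L by auto
  ultimately show "\<exists>E. finite E \<and> E \<subseteq> L \<and> (\<forall>\<tau>\<in>act ` carrier G. (\<forall>x\<in>E. \<tau> x = \<sigma> x) \<longrightarrow> \<tau> \<in> U)"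
    by blast
qed

lemma topspace_schlichting: "topspace (schlichting_topology \<Gamma> \<Lambda>) = act ` carrier G"
  using act_PiE by (auto simp: schlichting_topology_eq)

text \<open>On both sides openness is the same condition on the sets \<open>C m\<close>, read off at
  a coset of N or at the permutation it induces, so continuity and openness of the map amount to
  rewriting.\<close>

theorem completion_topological_group_iso:
  "topological_group_iso (G Mod N) (coset_topology G T N)
     (schlichting_completion \<Gamma> \<Lambda>) (schlichting_topology \<Gamma> \<Lambda>) completion_iso"
proof -
  let ?Q = "coset_topology G T N" and ?S = "schlichting_topology \<Gamma> \<Lambda>"
  have bij: "bij_betw completion_iso (topspace ?Q) (topspace ?S)"
    using completion_iso by (simp add: iso_def topspace_coset_topology topspace_schlichting completion_carrier)
  have cont: "continuous_map ?Q ?S completion_iso"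
    unfolding continuous_map_def topspace_coset_topology
  proof (intro conjI allI impI)
    show "completion_iso \<in> carrier (G Mod N) \<rightarrow> topspace ?S"
      using bij bij_betw_imp_funcset by (auto simp: topspace_coset_topology)
    fix U assume "openin ?S U"
    then show "openin ?Q {x \<in> carrier (G Mod N). completion_iso x \<in> U}"
      unfolding openin_schlichting_iff openin_coset_topology_iff carrier_Mod
      by (auto simp: completion_iso_coset C_iff)
  qed
  have "open": "open_map ?Q ?S completion_iso"
    unfolding open_map_def
  proof (intro allI impI)
    fix W assume W: "openin ?Q W"
    then have Wsub: "W \<subseteq> carrier (G Mod N)" by (simp add: openin_coset_topology_iff)
    \<comment> \<open>Injectivity is what allows membership in the image of W to be tested on
      W.\<close>
    have mem: "act g \<in> completion_iso ` W \<longleftrightarrow> N #> g \<in> W" if "g \<in> carrier G" for g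
    proof -
      have "completion_iso (N #> g) \<in> completion_iso ` W \<longleftrightarrow> N #> g \<in> W"
        using bij Wsub that by (intro inj_on_image_mem_iff[of _ "carrier (G Mod N)"])
          (auto simp: topspace_coset_topology bij_betw_def carrier_Mod)
      then show ?thesis using that by (simp add: completion_iso_coset)
    qed
    have "completion_iso ` W \<subseteq> act ` carrier G"
      using Wsub by (auto simp: carrier_Mod completion_iso_coset)
    then show "openin ?S (completion_iso ` W)"
      using W unfolding openin_schlichting_iff openin_coset_topology_iff
      by (auto simp: mem C_iff)
  qed
  show ?thesis
    using completion_iso cont "open" bij
    by (auto simp: topological_group_iso_def bij_betw_def intro: bijective_open_imp_homeomorphic_map)
qed

end

section \<open>Integral matrices in \<open>G\<close>\<close>

locale upper_adic = prime_set +
  fixes n :: nat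
begin

abbreviation "\<Gamma> \<equiv> Gamma_group n P"
abbreviation "G \<equiv> G_group n P"
abbreviation "\<mu> \<equiv> mat_map n \<iota>"

abbreviation mult_G (infixl \<open>\<star>\<close> 70) where "A \<star> B \<equiv> A \<otimes>\<^bsub>G\<^esub> B"

section \<open>Congruences between matrices\<close>

lemma finsum_diff_lat:
  assumes "finite I" "f \<in> I \<rightarrow> carrier QP" "g \<in> I \<rightarrow> carrier QP"
    and "\<And>i. i \<in> I \<Longrightarrow> f i \<ominus>\<^bsub>QP\<^esub> g i \<in> lat m"
  shows "(\<Oplus>\<^bsub>QP\<^esub>i\<in>I. f i) \<ominus>\<^bsub>QP\<^esub> (\<Oplus>\<^bsub>QP\<^esub>i\<in>I. g i) \<in> lat m"
  using assms
proof (induction I)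
  case empty
  then show ?case by (simp add: a_minus_def)
next
  case (insert a I)
  have cl: "f a \<in> carrier QP" "g a \<in> carrier QP" "(\<Oplus>\<^bsub>QP\<^esub>i\<in>I. f i) \<in> carrier QP" "(\<Oplus>\<^bsub>QP\<^esub>i\<in>I. g i) \<in> carrier QP"
    using insert by (auto simp: Pi_def intro!: QP.finsum_closed)
  have "(\<Oplus>\<^bsub>QP\<^esub>i\<in>insert a I. f i) \<ominus>\<^bsub>QP\<^esub> (\<Oplus>\<^bsub>QP\<^esub>i\<in>insert a I. g i) =
      (f a \<oplus>\<^bsub>QP\<^esub> (\<Oplus>\<^bsub>QP\<^esub>i\<in>I. f i)) \<ominus>\<^bsub>QP\<^esub> (g a \<oplus>\<^bsub>QP\<^esub> (\<Oplus>\<^bsub>QP\<^esub>i\<in>I. g i))"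
    using insert by (simp add: Pi_def)
  also have "\<dots> = (f a \<ominus>\<^bsub>QP\<^esub> g a) \<oplus>\<^bsub>QP\<^esub> ((\<Oplus>\<^bsub>QP\<^esub>i\<in>I. f i) \<ominus>\<^bsub>QP\<^esub> (\<Oplus>\<^bsub>QP\<^esub>i\<in>I. g i))"
    using cl by algebra
  also have "\<dots> \<in> lat m"
    using insert by (intro lat_add) auto
  finally show ?case .
qed

lemma finsum_lat:
  assumes "finite I" "\<And>i. i \<in> I \<Longrightarrow> f i \<in> lat m"
  shows "(\<Oplus>\<^bsub>QP\<^esub>i\<in>I. f i) \<in> lat m"
  using assms
proof (induction I)
  case (insert a I)
  then have "f a \<oplus>\<^bsub>QP\<^esub> (\<Oplus>\<^bsub>QP\<^esub>i\<in>I. f i) \<in> lat m" by (intro lat_add) auto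
  moreover have "f a \<in> carrier QP" "f \<in> I \<rightarrow> carrier QP"
    using insert.prems lat_carrier by auto
  ultimately show ?case using insert.hyps by simp
qed simp

definition near :: "int \<Rightarrow> padics matrix \<Rightarrow> padics matrix \<Rightarrow> bool" where
  "near m A B \<longleftrightarrow> (\<forall>i<n. \<forall>j<n. A (i, j) \<ominus>\<^bsub>QP\<^esub> B (i, j) \<in> lat m)"

text \<open>For negative m this bounds denominators. Multiplication by a matrix with bound -k costs
  k powers of q in a congruence.\<close>

definition bounded_by :: "int \<Rightarrow> padics matrix \<Rightarrow> bool" where
  "bounded_by m A \<longleftrightarrow> (\<forall>i<n. \<forall>j<n. A (i, j) \<in> lat m)"

abbreviation "Mat \<equiv> matrices n QP"

lemma Mat_entry: "A \<in> Mat \<Longrightarrow> i < n \<Longrightarrow> j < n \<Longrightarrow> A (i, j) \<in> carrier QP"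
  by (rule matrices_entry)

lemma near_antimono: "k \<le> m \<Longrightarrow> near m A B \<Longrightarrow> near k A B"
  unfolding near_def using lat_antimono by blast

lemma near_bounded_by:
  assumes "near m A B" "bounded_by m B" "A \<in> Mat" "B \<in> Mat"
  shows "bounded_by m A"
  unfolding bounded_by_def
proof (intro allI impI)
  fix i j assume ij: "i < n" "j < n"
  have cl: "A (i, j) \<in> carrier QP" "B (i, j) \<in> carrier QP"
    using assms ij by (auto intro: Mat_entry)
  then have "A (i, j) = (A (i, j) \<ominus>\<^bsub>QP\<^esub> B (i, j)) \<oplus>\<^bsub>QP\<^esub> B (i, j)" by algebra
  then show "A (i, j) \<in> lat m"
    using assms ij lat_add unfolding near_def bounded_by_def by metis
qed

lemma bounded_by_exists:
  assumes "A \<in> Mat"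
  shows "\<exists>k::nat. bounded_by (- int k) A"
proof -
  obtain k :: nat where "A ` ({..<n} \<times> {..<n}) \<subseteq> lat (- int k)"
    using lat_exhaust_finite[of "A ` ({..<n} \<times> {..<n})"] assms Mat_entry by auto
  then show ?thesis by (intro exI[of _ k]) (auto simp: bounded_by_def)
qed

lemma near_mult_left:
  assumes A: "bounded_by c A" "A \<in> Mat" and BB: "near m B B'" "B \<in> Mat" "B' \<in> Mat"
  shows "near (m + c) (mat_mult n QP A B) (mat_mult n QP A B')"
  unfolding near_def
proof (intro allI impI)
  fix i j assume ij: "i < n" "j < n"
  have "A (i, k) \<otimes>\<^bsub>QP\<^esub> B (k, j) \<ominus>\<^bsub>QP\<^esub> A (i, k) \<otimes>\<^bsub>QP\<^esub> B' (k, j) \<in> lat (m + c)" if k: "k < n" for k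
  proof -
    have cl: "A (i, k) \<in> carrier QP" "B (k, j) \<in> carrier QP" "B' (k, j) \<in> carrier QP"
      using assms ij k by (auto intro: Mat_entry)
    have "A (i, k) \<otimes>\<^bsub>QP\<^esub> B (k, j) \<ominus>\<^bsub>QP\<^esub> A (i, k) \<otimes>\<^bsub>QP\<^esub> B' (k, j) =
        (B (k, j) \<ominus>\<^bsub>QP\<^esub> B' (k, j)) \<otimes>\<^bsub>QP\<^esub> A (i, k)" using cl by algebra
    then show ?thesis using A BB ij k lat_mult by (auto simp: near_def bounded_by_def)
  qed
  then show "mat_mult n QP A B (i, j) \<ominus>\<^bsub>QP\<^esub> mat_mult n QP A B' (i, j) \<in> lat (m + c)"
    using ij assms Mat_entry by (simp add: mat_mult_def) (intro finsum_diff_lat, auto)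
qed

lemma near_mult_right:
  assumes A: "bounded_by c A" "A \<in> Mat" and BB: "near m B B'" "B \<in> Mat" "B' \<in> Mat"
  shows "near (m + c) (mat_mult n QP B A) (mat_mult n QP B' A)"
  unfolding near_def
proof (intro allI impI)
  fix i j assume ij: "i < n" "j < n"
  have "B (i, k) \<otimes>\<^bsub>QP\<^esub> A (k, j) \<ominus>\<^bsub>QP\<^esub> B' (i, k) \<otimes>\<^bsub>QP\<^esub> A (k, j) \<in> lat (m + c)" if k: "k < n" for k
  proof -
    have cl: "A (k, j) \<in> carrier QP" "B (i, k) \<in> carrier QP" "B' (i, k) \<in> carrier QP"
      using assms ij k by (auto intro: Mat_entry)
    have "B (i, k) \<otimes>\<^bsub>QP\<^esub> A (k, j) \<ominus>\<^bsub>QP\<^esub> B' (i, k) \<otimes>\<^bsub>QP\<^esub> A (k, j) =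
        (B (i, k) \<ominus>\<^bsub>QP\<^esub> B' (i, k)) \<otimes>\<^bsub>QP\<^esub> A (k, j)" using cl by algebra
    then show ?thesis using A BB ij k lat_mult by (auto simp: near_def bounded_by_def)
  qed
  then show "mat_mult n QP B A (i, j) \<ominus>\<^bsub>QP\<^esub> mat_mult n QP B' A (i, j) \<in> lat (m + c)"
    using ij assms Mat_entry by (simp add: mat_mult_def) (intro finsum_diff_lat, auto)
qed

lemma bounded_by_mult:
  assumes "bounded_by c A" "bounded_by d B"
  shows "bounded_by (c + d) (mat_mult n QP A B)"
  using assms by (auto simp: bounded_by_def mat_mult_def intro!: finsum_lat lat_mult)

section \<open>The groups G and \<Gamma>\<close>

lemma carrier_G: "A \<in> carrier G \<longleftrightarrow> A \<in> carrier (upper_SL n QP) \<and> (\<forall>i<n. A (i, i) \<in> \<iota> ` Units R)"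
  by (simp add: G_group_def)

lemma G_mult [simp]: "A \<star> B = mat_mult n QP A B"
  by (simp add: G_group_def QP.mat_mult_upper_SL[unfolded upper_SL_def SL_def] upper_SL_def SL_def)

lemma G_one [simp]: "\<one>\<^bsub>G\<^esub> = mat_scalar n QP \<one>\<^bsub>QP\<^esub>"
  by (simp add: G_group_def upper_SL_def SL_def)

text \<open>Injectivity of \<open>\<iota>\<close> brings the determinant condition down from
  \<open>QP\<close> to a product of rational units, where integrality can be exploited.\<close>

lemma G_diag:
  assumes g: "g \<in> carrier G"
  obtains u where "\<And>i. i < n \<Longrightarrow> u i \<in> Units R" "\<And>i. i < n \<Longrightarrow> g (i, i) = \<iota> (u i)"
    "(\<Prod>i<n. u i) = 1"
proof -
  interpret h: ring_hom_cring R QP \<iota> by (rule \<iota>_ring_hom)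
  have "\<exists>v. v \<in> Units R \<and> g (i, i) = \<iota> v" if "i < n" for i
    using g that unfolding carrier_G by blast
  then obtain u where u: "\<And>i. i < n \<Longrightarrow> u i \<in> Units R" "\<And>i. i < n \<Longrightarrow> g (i, i) = \<iota> (u i)" by metis
  have uZ: "u i \<in> Zloc" if "i < n" for i using u(1)[OF that] by (simp add: Units_R)
  have "(\<Otimes>\<^bsub>QP\<^esub>i\<in>{..<n}. g (i, i)) = \<iota> (\<Otimes>\<^bsub>R\<^esub>i\<in>{..<n}. u i)"
    using u uZ by (subst h.hom_finprod) (auto intro!: QP.finprod_cong')
  then have "\<iota> (\<Otimes>\<^bsub>R\<^esub>i\<in>{..<n}. u i) = \<iota> 1"
    using g by (simp add: carrier_G QP.carrier_upper_SL \<iota>_one)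
  then have "(\<Prod>i<n. u i) = 1"
    using \<iota>_inj R_finprod[of "{..<n}" u] uZ by force
  then show ?thesis using that u by blast
qed

lemma Units_R_mult: "u \<in> Units R \<Longrightarrow> v \<in> Units R \<Longrightarrow> u * v \<in> Units R"
  using R.Units_m_closed[of u v] by simp

lemma one_Units_R: "1 \<in> Units R"
  using R.Units_one_closed by simp

lemma subgroup_G: "subgroup (carrier G) (upper_SL n QP)"
proof -
  interpret U: group "upper_SL n QP" by (rule QP.group_upper_SL)
  show ?thesis
  proof (rule U.subgroupI)
    show "carrier G \<subseteq> carrier (upper_SL n QP)" by (auto simp: carrier_G)
    have "mat_scalar n QP \<one>\<^bsub>QP\<^esub> \<in> carrier G"
      using QP.mat_scalar_one_upper_SL imageI[OF one_Units_R, of \<iota>]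
      by (simp add: carrier_G \<iota>_one) (simp add: mat_scalar_def)
    then show "carrier G \<noteq> {}" by blast
    fix A assume A: "A \<in> carrier G"
    let ?B = "inv\<^bsub>upper_SL n QP\<^esub> A"
    have B: "?B \<in> carrier (upper_SL n QP)" using A by (simp add: carrier_G)
    have BA: "mat_mult n QP ?B A = mat_scalar n QP \<one>\<^bsub>QP\<^esub>"
      using U.l_inv[of A] A by (simp add: carrier_G)
    have "?B (i, i) \<in> \<iota> ` Units R" if i: "i < n" for i
    proof -
      obtain u where u: "u \<in> Units R" "A (i, i) = \<iota> u" using A i by (auto simp: carrier_G)
      obtain v where v: "v \<in> Zloc" "u * v = 1" using u(1) by (auto simp: Units_R)
      have vU: "v \<in> Units R" using u v by (auto simp: Units_R mult.commute)
      have "?B (i, i) \<otimes>\<^bsub>QP\<^esub> \<iota> u = \<one>\<^bsub>QP\<^esub>"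
        using QP.upper_tri_mult_diag[of ?B n A i] A B BA i u
        by (simp add: carrier_G QP.carrier_upper_SL mat_scalar_def)
      then have "?B (i, i) \<otimes>\<^bsub>QP\<^esub> \<iota> u \<otimes>\<^bsub>QP\<^esub> \<iota> v = \<iota> v" by simp
      then have "?B (i, i) \<otimes>\<^bsub>QP\<^esub> (\<iota> (u * v)) = \<iota> v"
        using B i by (simp add: \<iota>_mult QP.m_assoc QP.carrier_upper_SL Mat_entry)
      then have "?B (i, i) = \<iota> v"
        using B i by (simp add: v \<iota>_one QP.carrier_upper_SL Mat_entry)
      then show ?thesis using vU by blast
    qed
    then show "?B \<in> carrier G" using B by (simp add: carrier_G)
    fix C assume C: "C \<in> carrier G"
    have "mat_mult n QP A C (i, i) \<in> \<iota> ` Units R" if i: "i < n" for i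
    proof -
      obtain u v where uv: "u \<in> Units R" "v \<in> Units R" "A (i, i) = \<iota> u" "C (i, i) = \<iota> v"
        using A C i unfolding carrier_G by blast
      have "mat_mult n QP A C (i, i) = \<iota> (u * v)"
        using QP.upper_tri_mult_diag[of A n C i] A C i uv
        by (simp add: carrier_G QP.carrier_upper_SL \<iota>_mult)
      then show ?thesis using Units_R_mult[OF uv(1,2)] by blast
    qed
    then show "A \<otimes>\<^bsub>upper_SL n QP\<^esub> C \<in> carrier G"
      using U.m_closed[of A C] A C by (simp add: carrier_G)
  qed
qed

lemma G_eq: "G = upper_SL n QP\<lparr>carrier := carrier G\<rparr>"
  by (simp add: G_group_def)

sublocale G: group G
proof -
  interpret U: group "upper_SL n QP" by (rule QP.group_upper_SL)
  show "group G"
    using subgroup.subgroup_is_group[OF subgroup_G U.is_group] G_eq by simp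
qed

sublocale \<Gamma>: group \<Gamma>
  unfolding Gamma_group_def by (rule R.group_upper_SL)

lemma G_Mat: "A \<in> carrier G \<Longrightarrow> A \<in> Mat"
  by (simp add: carrier_G QP.carrier_upper_SL)

lemma G_upper: "A \<in> carrier G \<Longrightarrow> upper_tri n QP A"
  by (simp add: carrier_G QP.carrier_upper_SL)

lemma G_entry: "A \<in> carrier G \<Longrightarrow> i < n \<Longrightarrow> j < n \<Longrightarrow> A (i, j) \<in> carrier QP"
  using G_Mat Mat_entry by blast

lemma \<Gamma>_iff: "c \<in> carrier \<Gamma> \<longleftrightarrow>
  c \<in> matrices n R \<and> (\<forall>i<n. \<forall>j<i. c (i, j) = 0) \<and> (\<Prod>i<n. c (i, i)) = 1"
proof -
  have "(\<Otimes>\<^bsub>R\<^esub>i\<in>{..<n}. c (i, i)) = (\<Prod>i<n. c (i, i))" if "c \<in> matrices n R"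
    using matrices_entry[OF that] by (intro R_finprod) auto
  then show ?thesis
    by (auto simp: Gamma_group_def R.carrier_upper_SL upper_tri_def)
qed

lemma \<Gamma>_entry: "c \<in> carrier \<Gamma> \<Longrightarrow> i < n \<Longrightarrow> j < n \<Longrightarrow> c (i, j) \<in> Zloc"
  using matrices_entry[of c n R] by (simp add: \<Gamma>_iff)

lemma \<Gamma>_diag: "c \<in> carrier \<Gamma> \<Longrightarrow> i < n \<Longrightarrow> c (i, i) \<in> Units R"
  unfolding Gamma_group_def by (rule R.upper_SL_diag_Units)

lemma \<mu>_hom: "\<mu> \<in> hom \<Gamma> G"
proof -
  interpret h: ring_hom_cring R QP \<iota> by (rule \<iota>_ring_hom)
  have h: "\<mu> \<in> hom \<Gamma> (upper_SL n QP)"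
    unfolding Gamma_group_def by (rule h.mat_map_hom)
  then have "\<mu> c \<in> carrier G" if "c \<in> carrier \<Gamma>" for c
    using that \<Gamma>_diag by (auto simp: hom_def carrier_G)
  then show ?thesis using h by (auto simp: hom_def)
qed

lemma \<mu>_closed: "c \<in> carrier \<Gamma> \<Longrightarrow> \<mu> c \<in> carrier G"
  using \<mu>_hom by (auto simp: hom_def)

section \<open>The subgroup of integral matrices\<close>

definition K :: "padics matrix set" where
  "K = {A \<in> carrier G. bounded_by 0 A}"

lemma subcring_lat: "cring (QP\<lparr>carrier := lat 0\<rparr>)"
proof -
  have "subring (lat 0) QP"
    using lat_mult[of _ 0 _ 0] by (intro QP.subringI) (auto intro: lat_carrier lat_uminus lat_add)
  then have "subcring (lat 0) QP" by (rule QP.subcringI')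
  then show ?thesis using QP.subcring_iff[of "lat 0"] lat_carrier by blast
qed

text \<open>The inverse of an integral matrix is integral because integral matrices already form a group,
  namely \<open>upper_SL n\<close> over the subring of integral elements.\<close>

lemma K_inverse:
  assumes A: "A \<in> K"
  shows "inv\<^bsub>G\<^esub> A \<in> K"
proof -
  let ?O = "QP\<lparr>carrier := lat 0\<rparr>"
  interpret O: cring ?O by (rule subcring_lat)
  interpret h: ring_hom_cring ?O QP id
    by (intro ring_hom_cring.intro ring_hom_cring_axioms.intro subcring_lat cring_QP ring_hom_memI)
      (auto intro: lat_carrier)
  have AG: "A \<in> carrier G" and Ab: "\<And>i j. i < n \<Longrightarrow> j < n \<Longrightarrow> A (i, j) \<in> lat 0"
    using A by (auto simp: K_def bounded_by_def)
  have AO: "A \<in> matrices n ?O"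
    using G_Mat[OF AG] Ab by (auto simp: matrices_def PiE_iff)
  have "(\<Otimes>\<^bsub>?O\<^esub>i\<in>{..<n}. A (i, i)) = (\<Otimes>\<^bsub>QP\<^esub>i\<in>{..<n}. A (i, i))"
    using h.hom_finprod[of "\<lambda>i. A (i, i)" "{..<n}"] Ab by (simp add: comp_def)
  then have "A \<in> carrier (upper_SL n ?O)"
    using AO AG by (auto simp: O.carrier_upper_SL carrier_G QP.carrier_upper_SL upper_tri_def)
  then obtain B where B: "B \<in> carrier (upper_SL n ?O)" "mat_mult n ?O B A = mat_scalar n ?O \<one>\<^bsub>?O\<^esub>"
    using O.upper_SL_left_inverse by blast
  have BO: "B \<in> matrices n ?O" using B by (simp add: O.carrier_upper_SL)
  \<comment> \<open>The inclusion of the integral elements, as the homomorphism \<open>id\<close>,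
    carries B and the relation BA = 1 to \<open>QP\<close>; uniqueness of inverses then identifies B
    with the inverse taken in G.\<close>
  have BU: "B \<in> carrier (upper_SL n QP)"
    using hom_in_carrier[OF h.mat_map_hom B(1)] mat_map_id[OF BO] by simp
  have "mat_mult n QP B A = mat_map n id (mat_mult n ?O B A)"
    using hom_mult[OF h.mat_map_hom B(1) \<open>A \<in> carrier (upper_SL n ?O)\<close>] mat_map_id[OF BO] mat_map_id[OF AO]
    by simp
  also have "\<dots> = mat_scalar n QP \<one>\<^bsub>QP\<^esub>"
    unfolding B(2) by (auto simp: mat_map_def mat_scalar_def)
  finally have BA: "mat_mult n QP B A = mat_scalar n QP \<one>\<^bsub>QP\<^esub>" .
  interpret U: group "upper_SL n QP" by (rule QP.group_upper_SL)
  have "inv\<^bsub>upper_SL n QP\<^esub> A = B"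
    using U.inv_equality[of B A] BA BU AG by (simp add: carrier_G)
  moreover have "inv\<^bsub>G\<^esub> A = inv\<^bsub>upper_SL n QP\<^esub> A"
    using U.m_inv_consistent[OF subgroup_G AG] G_eq by simp
  ultimately have "inv\<^bsub>G\<^esub> A = B" by simp
  moreover have "bounded_by 0 B"
    using matrices_entry[OF BO] by (auto simp: bounded_by_def)
  ultimately show ?thesis using AG by (simp add: K_def) (metis G.inv_closed)
qed

lemma K_mult: "A \<in> K \<Longrightarrow> B \<in> K \<Longrightarrow> A \<star> B \<in> K"
  using bounded_by_mult[of 0 A 0 B] G.m_closed[of A B] by (simp add: K_def)

lemma bounded_by_one: "bounded_by 0 \<one>\<^bsub>G\<^esub>"
  by (auto simp: bounded_by_def mat_scalar_def)

lemma subgroup_K: "subgroup K G"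
proof (rule G.subgroupI)
  show "K \<noteq> {}" using bounded_by_one G.one_closed unfolding K_def by blast
qed (auto simp: K_inverse K_mult simp del: G_mult, auto simp: K_def)

lemma near_inv_mult:
  assumes g: "g \<in> carrier G" "h \<in> carrier G" and b: "bounded_by (- b) (inv\<^bsub>G\<^esub> g)" and near: "near m h g"
  shows "near (m - b) (inv\<^bsub>G\<^esub> g \<star> h) \<one>\<^bsub>G\<^esub>"
proof -
  have "near (m + - b) (mat_mult n QP (inv\<^bsub>G\<^esub> g) h) (mat_mult n QP (inv\<^bsub>G\<^esub> g) g)"
    using assms G.inv_closed[OF g(1)] by (intro near_mult_left G_Mat)
  moreover have "mat_mult n QP (inv\<^bsub>G\<^esub> g) g = \<one>\<^bsub>G\<^esub>"
    using G.l_inv[OF g(1)] by simp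
  ultimately show ?thesis by simp
qed

end

section \<open>Stabilisers of finitely many cosets\<close>

context upper_adic
begin

declare G_mult [simp del] G_one [simp del]

lemma G_mult_entry:
  "i < n \<Longrightarrow> j < n \<Longrightarrow> (A \<star> B) (i, j) = (\<Oplus>\<^bsub>QP\<^esub>k\<in>{..<n}. A (i, k) \<otimes>\<^bsub>QP\<^esub> B (k, j))"
  by (simp add: G_mult mat_mult_def)

lemma G_mult_diag:
  "A \<in> carrier G \<Longrightarrow> B \<in> carrier G \<Longrightarrow> i < n \<Longrightarrow>
    (A \<star> B) (i, i) = A (i, i) \<otimes>\<^bsub>QP\<^esub> B (i, i)"
  using QP.upper_tri_mult_diag by (simp add: G_mult G_Mat G_upper)

lemma G_eqI:
  "A \<in> carrier G \<Longrightarrow> B \<in> carrier G \<Longrightarrow> (\<And>i j. i < n \<Longrightarrow> j < n \<Longrightarrow> A (i, j) = B (i, j)) \<Longrightarrow> A = B"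
  using matrices_eqI[of A n QP B QP] G_Mat by blast

section \<open>Signs and scalar matrices\<close>

text \<open>Those e among 1 and -1 with e ^ n = 1, which is the determinant condition on a scalar
  matrix. They are kept as rationals so that the elements of N are images of elements of
  \<Gamma>.\<close>

definition signs :: "rat set" where "signs = (if odd n then {1} else {1, - 1})"

lemma signs_cases: "e \<in> signs \<Longrightarrow> e = 1 \<or> e = - 1"
  by (auto simp: signs_def split: if_splits)

lemma signs_one [simp]: "1 \<in> signs"
  by (auto simp: signs_def)

lemma signs_mult: "e \<in> signs \<Longrightarrow> e' \<in> signs \<Longrightarrow> e * e' \<in> signs"
  by (auto simp: signs_def split: if_splits)

lemma signs_square: "e \<in> signs \<Longrightarrow> e * e = 1"
  using signs_cases by fastforce

lemma signs_power: "e \<in> signs \<Longrightarrow> e ^ n = 1"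
  by (auto simp: signs_def split: if_splits)

lemma signsI: "e = 1 \<or> e = - 1 \<Longrightarrow> e ^ n = 1 \<Longrightarrow> e \<in> signs"
  by (auto simp: signs_def)

lemma signs_lat: "e \<in> signs \<Longrightarrow> \<iota> e \<in> lat 0"
  using lat_\<iota>_int[of 1] lat_\<iota>_int[of "- 1"] signs_cases[of e] by auto

lemma signs_Zloc: "e \<in> signs \<Longrightarrow> e \<in> Zloc"
  using Zloc_int[of 1] Zloc_int[of "- 1"] signs_cases[of e] by auto

abbreviation scal :: "rat \<Rightarrow> padics matrix" where "scal e \<equiv> mat_scalar n QP (\<iota> e)"

lemma N_set_eq: "N_set n P = scal ` signs"
  using \<iota>_one \<iota>_uminus[of 1] by (auto simp: N_set_def signs_def)

lemma G_one_scal: "\<one>\<^bsub>G\<^esub> = scal 1"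
  by (simp add: G_one \<iota>_one)

lemma scal_entry: "i < n \<Longrightarrow> j < n \<Longrightarrow> scal e (i, j) = (if i = j then \<iota> e else \<zero>\<^bsub>QP\<^esub>)"
  by (simp add: mat_scalar_def)

lemma scal_\<mu>: "scal e = \<mu> (mat_scalar n R e)"
  by (auto simp: mat_map_def mat_scalar_def \<iota>_zero)

lemma scalar_\<Gamma>: "e \<in> signs \<Longrightarrow> mat_scalar n R e \<in> carrier \<Gamma>"
  unfolding \<Gamma>_iff using signs_Zloc[of e] signs_power[of e]
  by (auto simp: R.mat_scalar_closed) (auto simp: mat_scalar_def)

lemma scal_G: "e \<in> signs \<Longrightarrow> scal e \<in> carrier G"
  unfolding scal_\<mu> by (rule \<mu>_closed[OF scalar_\<Gamma>])

lemma scal_bounded: "e \<in> signs \<Longrightarrow> bounded_by 0 (scal e)"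
  by (auto simp: bounded_by_def scal_entry signs_lat)

lemma scal_K: "e \<in> signs \<Longrightarrow> scal e \<in> K"
  by (simp add: K_def scal_G scal_bounded)

lemma mult_scal_entry:
  "A \<in> carrier G \<Longrightarrow> i < n \<Longrightarrow> j < n \<Longrightarrow> (A \<star> scal e) (i, j) = A (i, j) \<otimes>\<^bsub>QP\<^esub> \<iota> e"
  using QP.mat_mult_scalar_entry[of "\<iota> e" A n] by (simp add: G_mult G_Mat)

lemma scal_mult_entry:
  "A \<in> carrier G \<Longrightarrow> i < n \<Longrightarrow> j < n \<Longrightarrow> (scal e \<star> A) (i, j) = \<iota> e \<otimes>\<^bsub>QP\<^esub> A (i, j)"
  using QP.mat_scalar_mult_entry[of "\<iota> e" A n] by (simp add: G_mult G_Mat)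

lemma scal_commute: "A \<in> carrier G \<Longrightarrow> e \<in> signs \<Longrightarrow> scal e \<star> A = A \<star> scal e"
  by (rule G_eqI) (auto simp: scal_G mult_scal_entry scal_mult_entry G_entry QP.m_comm)

lemma scal_mult: "e \<in> signs \<Longrightarrow> e' \<in> signs \<Longrightarrow> scal e \<star> scal e' = scal (e * e')"
  by (rule G_eqI) (auto simp: scal_G signs_mult mult_scal_entry scal_entry \<iota>_mult[symmetric])

lemma conj_scal:
  assumes "e \<in> signs" "A \<in> carrier G"
  shows "inv\<^bsub>G\<^esub> A \<star> scal e \<star> A = scal e"
  using assms scal_G[OF assms(1)] by (simp add: G.m_assoc scal_commute G.mult_inv_cancel)

lemma near_G_mult_left:
  "A \<in> carrier G \<Longrightarrow> B \<in> carrier G \<Longrightarrow> B' \<in> carrier G \<Longrightarrow> bounded_by c A \<Longrightarrow> near m B B' \<Longrightarrow>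
    near (m + c) (A \<star> B) (A \<star> B')"
  using near_mult_left by (simp add: G_mult G_Mat)

lemma near_G_mult_right:
  "A \<in> carrier G \<Longrightarrow> B \<in> carrier G \<Longrightarrow> B' \<in> carrier G \<Longrightarrow> bounded_by c A \<Longrightarrow> near m B B' \<Longrightarrow>
    near (m + c) (B \<star> A) (B' \<star> A)"
  using near_mult_right by (simp add: G_mult G_Mat)

lemma bounded_G_mult: "bounded_by c A \<Longrightarrow> bounded_by d B \<Longrightarrow> bounded_by (c + d) (A \<star> B)"
  by (simp add: G_mult bounded_by_mult)

lemma K_G: "A \<in> K \<Longrightarrow> A \<in> carrier G"
  by (simp add: K_def)

text \<open>Conjugation by A loses at most a + b powers of q, where a and b bound the denominators
  of A and of its inverse, while the scalar matrix is central and stays integral. This estimate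
  underlies cofinality, the size of the stabilisers and commensurability.\<close>

lemma near_scal_conj:
  assumes c: "A \<in> carrier G"
  shows "\<exists>M::nat. \<forall>g\<in>carrier G. \<forall>e\<in>signs. near (int M) g (scal e) \<longrightarrow> inv\<^bsub>G\<^esub> A \<star> g \<star> A \<in> K"
proof -
  obtain a where a: "bounded_by (- int a) A" using bounded_by_exists G_Mat c by blast
  obtain b where b: "bounded_by (- int b) (inv\<^bsub>G\<^esub> A)" using bounded_by_exists G_Mat G.inv_closed[OF c] by blast
  have "inv\<^bsub>G\<^esub> A \<star> g \<star> A \<in> K"
    if g: "g \<in> carrier G" and e: "e \<in> signs" and near: "near (int (a + b)) g (scal e)" for g e
  proof -
    have "near (int (a + b) + - int b) (inv\<^bsub>G\<^esub> A \<star> g) (inv\<^bsub>G\<^esub> A \<star> scal e)"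
      using g e c b near scal_G by (intro near_G_mult_left) auto
    then have "near (int (a + b) + - int b + - int a) (inv\<^bsub>G\<^esub> A \<star> g \<star> A) (inv\<^bsub>G\<^esub> A \<star> scal e \<star> A)"
      using g e c a scal_G by (intro near_G_mult_right) auto
    then have "near 0 (inv\<^bsub>G\<^esub> A \<star> g \<star> A) (scal e)"
      using e c by (simp add: conj_scal)
    then show ?thesis
      using near_bounded_by[OF _ scal_bounded[OF e]] g c scal_G[OF e] by (simp add: K_def G_Mat)
  qed
  then show ?thesis by blast
qed

section \<open>Test cosets and their stabilisers\<close>

text \<open>The exponents descend in steps of 2 so that they are integers symmetric about zero for
  either parity of n, which gives determinant one.\<close>

definition dil_mat :: "nat \<Rightarrow> rat matrix" where
  "dil_mat k = (\<lambda>(i, j)\<in>{..<n} \<times> {..<n}. if i = j then of_nat q powi (int k * (int n - 1 - 2 * int i)) else 0)"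

definition elem_mat :: "nat \<Rightarrow> nat \<Rightarrow> rat matrix" where
  "elem_mat a b = (\<lambda>(i, j)\<in>{..<n} \<times> {..<n}. if i = j then 1 else if i = a \<and> j = b then of_nat q powi (- 2) else 0)"

lemma dil_mat_\<Gamma>: "dil_mat k \<in> carrier \<Gamma>"
proof -
  have pw: "(\<Prod>i\<in>A. (of_nat q :: rat) powi f i) = of_nat q powi (\<Sum>i\<in>A. f i)" if "finite A" for A and f :: "nat \<Rightarrow> int"
    using that q_pos by (induction A) (simp_all add: power_int_add)
  \<comment> \<open>Both the length N and the first term c are left free for the induction; N = n
    and c = n - 1 give zero.\<close>
  have "(\<Sum>i<N. c - 2 * int i) = int N * c - int N * (int N - 1)" for N c
    by (induction N) (simp_all add: algebra_simps)
  from this[of "int n - 1" n] have "(\<Sum>i<n. int k * (int n - 1 - 2 * int i)) = 0"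
    by (simp add: sum_distrib_left[symmetric])
  then have "(\<Prod>i<n. dil_mat k (i, i)) = 1"
    by (simp add: dil_mat_def pw)
  then show ?thesis
    using Zloc_q_powi Zloc_int[of 0] by (auto simp: \<Gamma>_iff matrices_def dil_mat_def)
qed

lemma elem_mat_\<Gamma>: "a < b \<Longrightarrow> elem_mat a b \<in> carrier \<Gamma>"
  using Zloc_q_powi[of "- 2"] Zloc_int[of 0] Zloc_int[of 1]
  by (auto simp: \<Gamma>_iff matrices_def elem_mat_def)

text \<open>Dilations force the off-diagonal entries to be small, elementary matrices with a
  denominator \<open>q\<^sup>2\<close> force the diagonal entries, which are signs, to coincide (a single \<open>q\<close> would not
  separate \<open>1\<close> from \<open>-1\<close> for \<open>P = {2}\<close>).\<close>

definition F :: "nat \<Rightarrow> rat matrix set" where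
  "F m = insert \<one>\<^bsub>\<Gamma>\<^esub> (dil_mat ` {..m} \<union> {elem_mat a b | a b. a < b \<and> b < n})"

definition C :: "nat \<Rightarrow> padics matrix set" where
  "C m = {g \<in> carrier G. \<forall>c\<in>F m. inv\<^bsub>G\<^esub> (\<mu> c) \<star> g \<star> \<mu> c \<in> K}"

lemma F_finite: "finite (F m)"
proof -
  have "{elem_mat a b | a b. a < b \<and> b < n} \<subseteq> (\<lambda>(a, b). elem_mat a b) ` ({..<n} \<times> {..<n})" by force
  then have "finite {elem_mat a b | a b. a < b \<and> b < n}" by (rule finite_subset) simp
  then show ?thesis by (simp add: F_def)
qed

lemma F_sub: "F m \<subseteq> carrier \<Gamma>"
  using dil_mat_\<Gamma> elem_mat_\<Gamma> by (auto simp: F_def)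

lemma F_mono: "mono F"
  by (rule monoI) (auto simp: F_def)

lemma \<mu>_one: "\<mu> \<one>\<^bsub>\<Gamma>\<^esub> = \<one>\<^bsub>G\<^esub>"
  using hom_one[OF \<mu>_hom] \<Gamma>.is_group G.is_group by blast

lemma C_G: "g \<in> C m \<Longrightarrow> g \<in> carrier G"
  by (simp add: C_def)

text \<open>This is the purpose of the identity among the test elements.\<close>

lemma C_K:
  assumes g: "g \<in> C m"
  shows "g \<in> K"
proof -
  have "\<one>\<^bsub>\<Gamma>\<^esub> \<in> F m" by (simp add: F_def)
  then have "inv\<^bsub>G\<^esub> (\<mu> \<one>\<^bsub>\<Gamma>\<^esub>) \<star> g \<star> \<mu> \<one>\<^bsub>\<Gamma>\<^esub> \<in> K"
    using g unfolding C_def by blast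
  then show ?thesis using C_G[OF g] by (simp add: \<mu>_one)
qed

text \<open>Written without inverses, the stabiliser condition becomes an equation between two
  products whose entries can be compared directly.\<close>

lemma C_intertwine:
  assumes "g \<in> C m" "c \<in> F m"
  obtains k where "k \<in> K" "g \<star> \<mu> c = \<mu> c \<star> k"
proof
  have c: "\<mu> c \<in> carrier G" using assms(2) F_sub \<mu>_closed by blast
  show "inv\<^bsub>G\<^esub> (\<mu> c) \<star> g \<star> \<mu> c \<in> K" using assms by (simp add: C_def)
  show "g \<star> \<mu> c = \<mu> c \<star> (inv\<^bsub>G\<^esub> (\<mu> c) \<star> g \<star> \<mu> c)"
    using c C_G[OF assms(1)] by (simp add: G.m_assoc G.mult_inv_cancel)
qed

lemma subgroup_C: "subgroup (C m) G"
proof (rule G.subgroupI)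
  show "C m \<subseteq> carrier G" using C_G by blast
  have "inv\<^bsub>G\<^esub> (\<mu> c) \<star> \<one>\<^bsub>G\<^esub> \<star> \<mu> c \<in> K" if "c \<in> F m" for c
    using subgroup.one_closed[OF subgroup_K] \<mu>_closed[OF subsetD[OF F_sub that]] by simp
  then have "\<one>\<^bsub>G\<^esub> \<in> C m" by (simp add: C_def)
  then show "C m \<noteq> {}" by blast
  fix g assume g: "g \<in> C m"
  show "inv\<^bsub>G\<^esub> g \<in> C m"
    unfolding C_def
  proof (intro CollectI conjI ballI)
    fix c assume c: "c \<in> F m"
    then have cG: "\<mu> c \<in> carrier G" using F_sub \<mu>_closed by blast
    have "inv\<^bsub>G\<^esub> (inv\<^bsub>G\<^esub> (\<mu> c) \<star> g \<star> \<mu> c) \<in> K"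
      using g c by (intro K_inverse) (simp add: C_def)
    then show "inv\<^bsub>G\<^esub> (\<mu> c) \<star> inv\<^bsub>G\<^esub> g \<star> \<mu> c \<in> K"
      using cG C_G[OF g] by (simp add: G.inv_mult_group G.m_assoc)
  qed (use C_G[OF g] in simp)
  fix h assume h: "h \<in> C m"
  show "g \<star> h \<in> C m"
    unfolding C_def
  proof (intro CollectI conjI ballI)
    fix c assume c: "c \<in> F m"
    then have cG: "\<mu> c \<in> carrier G" using F_sub \<mu>_closed by blast
    have "(inv\<^bsub>G\<^esub> (\<mu> c) \<star> g \<star> \<mu> c) \<star> (inv\<^bsub>G\<^esub> (\<mu> c) \<star> h \<star> \<mu> c) \<in> K"
      by (rule K_mult) (use g h c in \<open>simp_all add: C_def\<close>)
    then show "inv\<^bsub>G\<^esub> (\<mu> c) \<star> (g \<star> h) \<star> \<mu> c \<in> K"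
      using cG C_G[OF g] C_G[OF h] by (simp add: G.m_assoc G.mult_inv_cancel)
  qed (use C_G[OF g] C_G[OF h] in simp)
qed

lemma C_antimono: "m \<le> m' \<Longrightarrow> C m' \<subseteq> C m"
  using monoD[OF F_mono, of m m'] unfolding C_def by blast

text \<open>Integral elements of the localised ring are integers, and integers with product one are
  1 or -1.\<close>

lemma K_diag:
  assumes g: "g \<in> K"
  obtains u where "\<And>i. i < n \<Longrightarrow> g (i, i) = \<iota> (u i)" "\<And>i. i < n \<Longrightarrow> u i = 1 \<or> u i = - 1"
    "(\<Prod>i<n. u i) = (1 :: rat)"
proof -
  have gG: "g \<in> carrier G" and gb: "\<And>i j. i < n \<Longrightarrow> j < n \<Longrightarrow> g (i, j) \<in> lat 0"
    using g by (auto simp: K_def bounded_by_def)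
  obtain u where u: "\<And>i. i < n \<Longrightarrow> u i \<in> Units R" "\<And>i. i < n \<Longrightarrow> g (i, i) = \<iota> (u i)"
    and prod: "(\<Prod>i<n. u i) = 1" using G_diag[OF gG] by blast
  have uZ: "u i \<in> Zloc" if "i < n" for i using u(1)[OF that] by (simp add: Units_R)
  have "\<exists>z. u i = of_int z" if "i < n" for i
    using lat_\<iota>_integral[OF uZ[OF that]] gb[OF that that] u(2)[OF that] by (auto elim: Ints_cases)
  then obtain z where z: "\<And>i. i < n \<Longrightarrow> u i = of_int (z i)" by metis
  have "of_int (\<Prod>i<n. z i) = (of_int 1 :: rat)"
    using prod z by simp
  then have "(\<Prod>i<n. z i) = 1" by (simp only: of_int_eq_iff)
  then have "z i dvd 1" if "i < n" for i
    using dvd_prodI[of "{..<n}" i z] that by simp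
  then have "z i = 1 \<or> z i = - 1" if "i < n" for i
    using that by (metis abs_1 abs_eq_iff zdvd1_eq)
  then have "u i = 1 \<or> u i = - 1" if "i < n" for i
    using z that by force
  then show ?thesis using that u prod by blast
qed

text \<open>With d the diagonal of the m-th dilation, the entry (i, j) of the intertwining relation
  reads g (i, j) d j = d i k (i, j) with k integral, and d i / d j is a power of q.\<close>

lemma C_offdiag:
  assumes g: "g \<in> C m" and ij: "i < j" "j < n"
  shows "g (i, j) \<in> lat (int m)"
proof -
  have gG: "g \<in> carrier G" using C_G g by blast
  obtain k where k: "k \<in> K" "g \<star> \<mu> (dil_mat m) = \<mu> (dil_mat m) \<star> k"
    using C_intertwine[OF g, of "dil_mat m"] by (auto simp: F_def)
  have kG: "k \<in> carrier G" using k K_G by blast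
  define d :: "nat \<Rightarrow> rat" where "d i = of_nat q powi (int m * (int n - 1 - 2 * int i))" for i
  have e: "\<mu> (dil_mat m) (a, b) = (if a = b then \<iota> (d a) else \<zero>\<^bsub>QP\<^esub>)" if "a < n" "b < n" for a b
    using that by (simp add: dil_mat_def d_def \<iota>_zero)
  have "(g \<star> \<mu> (dil_mat m)) (i, j) = g (i, j) \<otimes>\<^bsub>QP\<^esub> \<mu> (dil_mat m) (j, j)"
    unfolding G_mult_entry[OF less_trans[OF ij] ij(2)]
    using ij e G_entry[OF gG] by (intro QP.finsum_single) auto
  moreover have "(\<mu> (dil_mat m) \<star> k) (i, j) = \<mu> (dil_mat m) (i, i) \<otimes>\<^bsub>QP\<^esub> k (i, j)"
    unfolding G_mult_entry[OF less_trans[OF ij] ij(2)]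
    using ij e G_entry[OF kG] by (intro QP.finsum_single) auto
  ultimately have eq: "g (i, j) \<otimes>\<^bsub>QP\<^esub> \<iota> (d j) = \<iota> (d i) \<otimes>\<^bsub>QP\<^esub> k (i, j)"
    using k ij e by simp
  have dj: "d j * inverse (d j) = 1" using q_pos by (simp add: d_def)
  have cl: "g (i, j) \<in> carrier QP" "k (i, j) \<in> carrier QP" using ij gG kG by (auto intro: G_entry)
  have "g (i, j) = g (i, j) \<otimes>\<^bsub>QP\<^esub> \<iota> (d j) \<otimes>\<^bsub>QP\<^esub> \<iota> (inverse (d j))"
    using cl dj by (simp add: QP.m_assoc \<iota>_mult[symmetric] \<iota>_one)
  also have "\<dots> = \<iota> (d i * inverse (d j)) \<otimes>\<^bsub>QP\<^esub> k (i, j)"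
    unfolding eq using cl by (simp add: \<iota>_mult QP.m_ac)
  also have "d i * inverse (d j) = of_nat q powi (2 * int m * (int j - int i))"
    unfolding d_def using q_pos
    by (simp add: power_int_minus[symmetric] power_int_add[symmetric] algebra_simps)
  finally have "g (i, j) \<in> lat (2 * int m * (int j - int i) + 0)"
    using lat_mult[OF lat_q_powi, of "k (i, j)" 0] k ij by (auto simp: K_def bounded_by_def)
  \<comment> \<open>Since j - i is at least 1, the exponent 2 * m * (j - i) is at least m.\<close>
  moreover have "int m * 1 \<le> (2 * int m) * (int j - int i)"
    using ij by (intro mult_mono) auto
  ultimately show ?thesis using lat_antimono by simp
qed

text \<open>For i < j and x = q^-2, the entry (i, j) of the intertwining relation reads u i x + g
  (i, j) = k (i, j) + x u j. Hence (u i - u j) / q^2 is integral, while u i - u j is 0, 2 or -2 and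
  q^2 is at least 4.\<close>

lemma C_diag:
  assumes g: "g \<in> C m"
  obtains e where "e \<in> signs" "\<And>i. i < n \<Longrightarrow> g (i, i) = \<iota> e"
proof -
  have gK: "g \<in> K" and gG: "g \<in> carrier G" using C_K C_G g by blast+
  obtain u where u: "\<And>i. i < n \<Longrightarrow> g (i, i) = \<iota> (u i)" "\<And>i. i < n \<Longrightarrow> u i = 1 \<or> u i = - 1"
    "(\<Prod>i<n. u i) = 1" using K_diag[OF gK] by blast
  have same: "u i = u j" if ij: "i < j" "j < n" for i j
  proof -
    have i: "i < n" using ij by simp
    obtain k where k: "k \<in> K" "g \<star> \<mu> (elem_mat i j) = \<mu> (elem_mat i j) \<star> k"
    proof (rule C_intertwine[OF g, of "elem_mat i j"])
      show "elem_mat i j \<in> F m" using ij unfolding F_def by blast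
    qed
    have kG: "k \<in> carrier G" using k K_G by blast
    let ?x = "of_nat q powi (- 2) :: rat"
    have e: "\<mu> (elem_mat i j) (a, b) = (if a = b then \<one>\<^bsub>QP\<^esub> else if a = i \<and> b = j then \<iota> ?x else \<zero>\<^bsub>QP\<^esub>)"
      if "a < n" "b < n" for a b
      using that by (simp add: elem_mat_def \<iota>_zero \<iota>_one)
    have cl: "g (i, j) \<in> carrier QP" "k (i, j) \<in> carrier QP" "k (j, j) \<in> carrier QP" "g (j, j) \<in> carrier QP"
      using ij i gG kG by (auto intro: G_entry)
    have "\<mu> (elem_mat i j) \<in> carrier G" using elem_mat_\<Gamma>[OF ij(1)] \<mu>_closed by blast
    \<comment> \<open>The entries (j, j) of the two products show that g and k have the same entry
      there.\<close>
    then have kj: "k (j, j) = \<iota> (u j)"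
      using G_mult_diag[OF gG, of "\<mu> (elem_mat i j)" j] G_mult_diag[OF _ kG, of "\<mu> (elem_mat i j)" j] k(2) ij e cl u
      by simp
    have "(g \<star> \<mu> (elem_mat i j)) (i, j) = g (i, i) \<otimes>\<^bsub>QP\<^esub> \<mu> (elem_mat i j) (i, j) \<oplus>\<^bsub>QP\<^esub> g (i, j) \<otimes>\<^bsub>QP\<^esub> \<mu> (elem_mat i j) (j, j)"
      unfolding G_mult_entry[OF i ij(2)]
      using ij i e G_entry[OF gG] by (intro QP.finsum_pair) auto
    moreover have "(\<mu> (elem_mat i j) \<star> k) (i, j) = \<mu> (elem_mat i j) (i, i) \<otimes>\<^bsub>QP\<^esub> k (i, j) \<oplus>\<^bsub>QP\<^esub> \<mu> (elem_mat i j) (i, j) \<otimes>\<^bsub>QP\<^esub> k (j, j)"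
      unfolding G_mult_entry[OF i ij(2)]
      using ij i e G_entry[OF kG] by (intro QP.finsum_pair) auto
    ultimately have "\<iota> (u i * ?x) \<oplus>\<^bsub>QP\<^esub> g (i, j) = k (i, j) \<oplus>\<^bsub>QP\<^esub> \<iota> (?x * u j)"
      using k ij i e cl kj u by (simp add: \<iota>_mult)
    then have "(\<iota> (u i * ?x) \<oplus>\<^bsub>QP\<^esub> g (i, j)) \<ominus>\<^bsub>QP\<^esub> g (i, j) \<ominus>\<^bsub>QP\<^esub> \<iota> (?x * u j) =
        (k (i, j) \<oplus>\<^bsub>QP\<^esub> \<iota> (?x * u j)) \<ominus>\<^bsub>QP\<^esub> g (i, j) \<ominus>\<^bsub>QP\<^esub> \<iota> (?x * u j)" by simp
    moreover have "(y \<oplus>\<^bsub>QP\<^esub> a) \<ominus>\<^bsub>QP\<^esub> a \<ominus>\<^bsub>QP\<^esub> z = y \<ominus>\<^bsub>QP\<^esub> z" "(b \<oplus>\<^bsub>QP\<^esub> z) \<ominus>\<^bsub>QP\<^esub> a \<ominus>\<^bsub>QP\<^esub> z = b \<ominus>\<^bsub>QP\<^esub> a"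
      if "y \<in> carrier QP" "z \<in> carrier QP" "a \<in> carrier QP" "b \<in> carrier QP" for y z a b
      using that by algebra+
    ultimately have "\<iota> (u i * ?x) \<ominus>\<^bsub>QP\<^esub> \<iota> (?x * u j) = k (i, j) \<ominus>\<^bsub>QP\<^esub> g (i, j)"
      using cl by simp
    moreover have "k (i, j) \<ominus>\<^bsub>QP\<^esub> g (i, j) \<in> lat 0"
      using k gK ij i by (intro lat_diff) (auto simp: K_def bounded_by_def)
    ultimately have "\<iota> (u i * ?x - ?x * u j) \<in> lat 0" by (simp add: \<iota>_diff)
    moreover have "u i * ?x - ?x * u j = (u i - u j) * ?x" by (simp add: algebra_simps)
    moreover have "u i - u j \<in> Zloc"
    proof -
      obtain z :: int where "u i - u j = of_int z"
        using u(2)[OF i] u(2)[OF ij(2)] that by (metis Ints_1 Ints_cases Ints_diff Ints_minus)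
      then show ?thesis using Zloc_int by simp
    qed
    then have "(u i - u j) * ?x \<in> Zloc" using Zloc_mult Zloc_q_powi by blast
    ultimately have int: "(u i - u j) * ?x \<in> \<int>" using lat_\<iota>_integral by simp
    show "u i = u j"
    proof (rule ccontr)
      assume ne: "u i \<noteq> u j"
      then have abs: "\<bar>u i - u j\<bar> = 2" using u(2)[OF i] u(2)[OF ij(2)] by auto
      have q4: "of_nat q ^ 2 \<ge> (4 :: rat)"
      proof -
        have "2 ^ 2 \<le> q ^ 2" using q_gt_1 by (intro power_mono) auto
        then have "of_nat 4 \<le> (of_nat (q ^ 2) :: rat)" by (intro of_nat_mono) simp
        then show ?thesis by simp
      qed
      have "\<bar>(u i - u j) * ?x\<bar> = 2 / of_nat q ^ 2"
        using abs by (simp add: abs_mult power_int_minus inverse_eq_divide)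
      moreover have "2 / of_nat q ^ 2 < (1 :: rat)" "0 < (2 / of_nat q ^ 2 :: rat)" using q4 q_pos by (auto simp: field_simps)
      moreover obtain z :: int where "(u i - u j) * ?x = of_int z" using int by (auto elim: Ints_cases)
      ultimately have "\<bar>of_int z\<bar> < (1 :: rat)" "0 < \<bar>of_int z :: rat\<bar>" by auto
      then show False by (simp flip: of_int_abs)
    qed
  qed
  show ?thesis
  proof (cases "n = 0")
    \<comment> \<open>For n = 0 there is no index 0 from which to read off the common value, and any
      sign will do.\<close>
    case True
    show ?thesis by (rule that[OF signs_one]) (use True in simp)
  next
    case False
    have const: "u i = u 0" if "i < n" for i
      using same[of 0 i] that by (cases "i = 0") simp_all
    have "(\<Prod>i<n. u i) = (\<Prod>i<n. u 0)"
      by (rule prod.cong[OF refl]) (rule const, simp)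
    then have "u 0 ^ n = 1" using u(3) by simp
    then have "u 0 \<in> signs" using u(2)[of 0] False by (intro signsI) auto
    then show ?thesis by (rule that) (use u(1) const in metis)
  qed
qed

lemma C_near_scal:
  assumes g: "g \<in> C m"
  obtains e where "e \<in> signs" "\<And>i. i < n \<Longrightarrow> g (i, i) = \<iota> e" "near (int m) g (scal e)"
proof -
  obtain e where e: "e \<in> signs" "\<And>i. i < n \<Longrightarrow> g (i, i) = \<iota> e" using C_diag[OF g] by blast
  have "near (int m) g (scal e)"
    unfolding near_def
  proof (intro allI impI)
    fix i j assume ij: "i < n" "j < n"
    have cl: "g (i, j) \<in> carrier QP" using C_G[OF g] ij G_entry by blast
    consider "i = j" | "i < j" | "j < i" by linarith
    then show "g (i, j) \<ominus>\<^bsub>QP\<^esub> scal e (i, j) \<in> lat (int m)"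
    proof cases
      case 2
      then show ?thesis using C_offdiag[OF g 2] ij cl by (simp add: scal_entry a_minus_def)
    next
      case 3
      then show ?thesis using G_upper[OF C_G[OF g]] ij by (simp add: scal_entry a_minus_def upper_tri_zero)
    qed (use ij e in \<open>simp add: scal_entry a_minus_def QP.r_neg\<close>)
  qed
  then show ?thesis using that e by blast
qed

text \<open>Together with \<open>C_near_scal\<close> this says that the stabilisers and the
  congruence neighbourhoods of N are cofinal in each other, so either family describes the topology
  modulo N.\<close>

lemma near_scal_C: "\<exists>M::nat. \<forall>g\<in>carrier G. \<forall>e\<in>signs. near (int M) g (scal e) \<longrightarrow> g \<in> C m"
proof -
  have "\<exists>M::nat. \<forall>g\<in>carrier G. \<forall>e\<in>signs. near (int M) g (scal e) \<longrightarrow>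
      (\<forall>c\<in>E. inv\<^bsub>G\<^esub> (\<mu> c) \<star> g \<star> \<mu> c \<in> K)" if "finite E" "E \<subseteq> carrier \<Gamma>" for E
    using that
  proof (induction E)
    case (insert c E)
    then obtain M where M: "\<forall>g\<in>carrier G. \<forall>e\<in>signs. near (int M) g (scal e) \<longrightarrow>
      (\<forall>c\<in>E. inv\<^bsub>G\<^esub> (\<mu> c) \<star> g \<star> \<mu> c \<in> K)" by auto
    obtain M' where M': "\<forall>g\<in>carrier G. \<forall>e\<in>signs. near (int M') g (scal e) \<longrightarrow>
      inv\<^bsub>G\<^esub> (\<mu> c) \<star> g \<star> \<mu> c \<in> K" using near_scal_conj[OF \<mu>_closed, of c] insert by auto
    have "\<forall>c\<in>insert c E. inv\<^bsub>G\<^esub> (\<mu> c) \<star> g \<star> \<mu> c \<in> K"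
      if "g \<in> carrier G" "e \<in> signs" "near (int (max M M')) g (scal e)" for g e
    proof -
      have "near (int M) g (scal e)" "near (int M') g (scal e)"
        using that(3) by (auto intro: near_antimono[rotated])
      then show ?thesis using M M' that by blast
    qed
    then show ?case by blast
  qed auto
  from this[OF F_finite F_sub] show ?thesis by (auto simp: C_def)
qed

end

section \<open>The Schlichting completion of \<open>\<Gamma>\<close>\<close>

context upper_adic
begin

text \<open>A matrix that fixes all cosets lies in every \<open>C m\<close>. Its diagonal is then
  one constant sign, and the entries above it are divisible by every power of q.\<close>

lemma N_eq: "N_set n P = {g \<in> carrier G. \<forall>c\<in>carrier \<Gamma>. inv\<^bsub>G\<^esub> (\<mu> c) \<star> g \<star> \<mu> c \<in> K}"
proof (intro equalityI subsetI)
  fix g assume "g \<in> N_set n P"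
  then obtain e where e: "e \<in> signs" "g = scal e" by (auto simp: N_set_eq)
  then show "g \<in> {g \<in> carrier G. \<forall>c\<in>carrier \<Gamma>. inv\<^bsub>G\<^esub> (\<mu> c) \<star> g \<star> \<mu> c \<in> K}"
    using \<mu>_closed by (simp add: scal_G conj_scal scal_K)
next
  fix g assume g: "g \<in> {g \<in> carrier G. \<forall>c\<in>carrier \<Gamma>. inv\<^bsub>G\<^esub> (\<mu> c) \<star> g \<star> \<mu> c \<in> K}"
  then have gC: "g \<in> C m" for m using F_sub[of m] by (auto simp: C_def)
  have gG: "g \<in> carrier G" using g by simp
  obtain e where e: "e \<in> signs" "\<And>i. i < n \<Longrightarrow> g (i, i) = \<iota> e" using C_diag[OF gC] by blast
  have "g = scal e"
  proof (rule G_eqI[OF gG scal_G[OF e(1)]])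
    fix i j assume ij: "i < n" "j < n"
    consider "i = j" | "i < j" | "j < i" by linarith
    then show "g (i, j) = scal e (i, j)"
    proof cases
      case 2
      then have "g (i, j) = \<zero>\<^bsub>QP\<^esub>"
        using lat_separated[of "g (i, j)" 0] C_offdiag[OF gC 2] ij gG G_entry by simp
      then show ?thesis using 2 ij by (simp add: scal_entry)
    next
      case 3
      then show ?thesis using G_upper[OF gG] ij by (simp add: scal_entry upper_tri_zero)
    qed (use ij e in \<open>simp add: scal_entry\<close>)
  qed
  then show "g \<in> N_set n P" using e by (auto simp: N_set_eq)
qed

section \<open>Density and completeness of G\<close>

lemma near_inv_mult_C:
  assumes g: "g \<in> carrier G"
  shows "\<exists>M::nat. \<forall>h\<in>carrier G. near (int M) h g \<longrightarrow> inv\<^bsub>G\<^esub> g \<star> h \<in> C m"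
proof -
  obtain b where b: "bounded_by (- int b) (inv\<^bsub>G\<^esub> g)"
    using bounded_by_exists G_Mat G.inv_closed[OF g] by blast
  obtain M where M: "\<forall>g\<in>carrier G. \<forall>e\<in>signs. near (int M) g (scal e) \<longrightarrow> g \<in> C m"
    using near_scal_C by blast
  have "inv\<^bsub>G\<^esub> g \<star> h \<in> C m" if h: "h \<in> carrier G" "near (int (M + b)) h g" for h
  proof -
    have "near (int (M + b) - int b) (inv\<^bsub>G\<^esub> g \<star> h) \<one>\<^bsub>G\<^esub>"
      by (rule near_inv_mult[OF g h(1) b h(2)])
    then have "near (int M) (inv\<^bsub>G\<^esub> g \<star> h) (scal 1)" by (simp add: G_one_scal)
    then show ?thesis using M g h signs_one by blast
  qed
  then show ?thesis by blast
qed

text \<open>The diagonal of g is copied exactly, which the defining condition of G permits, and the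
  entries above it are approximated one by one; the determinant is then one without further
  adjustment.\<close>

lemma \<mu>_dense:
  assumes g: "g \<in> carrier G"
  shows "\<exists>c\<in>carrier \<Gamma>. near (int M) (\<mu> c) g"
proof -
  obtain u where u: "\<And>i. i < n \<Longrightarrow> u i \<in> Units R" "\<And>i. i < n \<Longrightarrow> g (i, i) = \<iota> (u i)"
    and prod: "(\<Prod>i<n. u i) = 1" using G_diag[OF g] by blast
  have uZ: "u i \<in> Zloc" if "i < n" for i using u(1)[OF that] by (simp add: Units_R)
  have "\<exists>r. r \<in> Zloc \<and> g (i, j) \<ominus>\<^bsub>QP\<^esub> \<iota> r \<in> lat (int M)" if "i < n" "j < n" for i j
    using \<iota>_dense[OF G_entry[OF g that], of M] by blast
  then obtain r where r: "\<And>i j. i < n \<Longrightarrow> j < n \<Longrightarrow> r i j \<in> Zloc"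
    "\<And>i j. i < n \<Longrightarrow> j < n \<Longrightarrow> g (i, j) \<ominus>\<^bsub>QP\<^esub> \<iota> (r i j) \<in> lat (int M)" by metis
  define c where "c = (\<lambda>(i, j)\<in>{..<n} \<times> {..<n}. if i = j then u i else if i < j then r i j else 0)"
  have "(\<Prod>i<n. c (i, i)) = (\<Prod>i<n. u i)" by (rule prod.cong) (auto simp: c_def)
  moreover have "c \<in> matrices n R"
    unfolding matrices_def c_def using r(1) uZ Zloc_int[of 0] by (auto intro!: restrict_PiE_iff[THEN iffD2])
  moreover have "\<forall>i<n. \<forall>j<i. c (i, j) = 0" by (auto simp: c_def)
  ultimately have c: "c \<in> carrier \<Gamma>" using prod unfolding \<Gamma>_iff by simp
  have "near (int M) (\<mu> c) g"
    unfolding near_def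
  proof (intro allI impI)
    fix i j assume ij: "i < n" "j < n"
    have cl: "g (i, j) \<in> carrier QP" using G_entry[OF g ij] .
    consider "i = j" | "i < j" | "j < i" by linarith
    then show "\<mu> c (i, j) \<ominus>\<^bsub>QP\<^esub> g (i, j) \<in> lat (int M)"
    proof cases
      case 1
      then show ?thesis using u ij by (simp add: c_def a_minus_def QP.r_neg)
    next
      case 2
      have "\<iota> (r i j) \<ominus>\<^bsub>QP\<^esub> g (i, j) = \<ominus>\<^bsub>QP\<^esub> (g (i, j) \<ominus>\<^bsub>QP\<^esub> \<iota> (r i j))"
        using cl \<iota>_closed[of "r i j"] by algebra
      then show ?thesis using r(2)[OF ij] lat_uminus 2 ij by (simp add: c_def)
    next
      case 3
      then show ?thesis using G_upper[OF g] ij by (simp add: c_def upper_tri_zero \<iota>_zero a_minus_def)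
    qed
  qed
  then show ?thesis using c by blast
qed

lemma \<Gamma>_dense:
  assumes g: "g \<in> carrier G"
  shows "\<exists>c\<in>carrier \<Gamma>. inv\<^bsub>G\<^esub> (\<mu> c) \<star> g \<in> C m"
proof -
  obtain M where M: "\<forall>h\<in>carrier G. near (int M) h g \<longrightarrow> inv\<^bsub>G\<^esub> g \<star> h \<in> C m"
    using near_inv_mult_C[OF g] by blast
  obtain c where c: "c \<in> carrier \<Gamma>" "near (int M) (\<mu> c) g" using \<mu>_dense[OF g] by blast
  \<comment> \<open>The estimate controls the inverse of the element that is wanted, and
    \<open>C m\<close> is a group.\<close>
  then have "inv\<^bsub>G\<^esub> (inv\<^bsub>G\<^esub> g \<star> \<mu> c) \<in> C m"
    using M \<mu>_closed subgroup.m_inv_closed[OF subgroup_C] by blast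
  then show ?thesis using c g \<mu>_closed by (intro bexI[of _ c]) (auto simp: G.inv_mult_group)
qed

text \<open>The successive quotients are small only up to a sign; correcting the signs turns \<open>c\<close> into a
  sequence whose entries converge and whose diagonal is constant.\<close>

lemma C_complete:
  assumes c: "\<And>m. c m \<in> carrier \<Gamma>"
    and step: "\<And>m. inv\<^bsub>G\<^esub> (\<mu> (c m)) \<star> \<mu> (c (Suc m)) \<in> C m"
  shows "\<exists>g\<in>carrier G. \<forall>m. inv\<^bsub>G\<^esub> (\<mu> (c m)) \<star> g \<in> C m"
proof -
  define a where "a m = \<mu> (c m)" for m
  define x where "x m = inv\<^bsub>G\<^esub> (a m) \<star> a (Suc m)" for m
  have aG: "a m \<in> carrier G" for m using c \<mu>_closed by (simp add: a_def)
  have xC: "x m \<in> C m" for m using step by (simp add: x_def a_def)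
  have xG: "x m \<in> carrier G" and xK: "x m \<in> K" for m using xC C_G C_K by blast+
  have a_Suc: "a (Suc m) = a m \<star> x m" for m
    using aG by (simp add: x_def G.mult_inv_cancel)
  have "\<exists>e. e \<in> signs \<and> (\<forall>i<n. x m (i, i) = \<iota> e) \<and> near (int m) (x m) (scal e)" for m
    by (rule C_near_scal[OF xC[of m]]) blast
  then obtain e where e: "\<And>m. e m \<in> signs" "\<And>m i. i < n \<Longrightarrow> x m (i, i) = \<iota> (e m)"
    "\<And>m. near (int m) (x m) (scal (e m))"
    by metis
  \<comment> \<open>The accumulated sign: on the diagonal each step multiplies by e m, so
    \<open>a m \<star> scal (s m)\<close> has a constant diagonal.\<close>
  define s where "s m = (\<Prod>k<m. e k)" for m
  have s_signs: "s m \<in> signs" for m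
    unfolding s_def by (induction m) (auto simp: signs_mult e)
  have s_Suc: "s (Suc m) = s m * e m" for m by (simp add: s_def)
  obtain k where k: "bounded_by (- int k) (a 0)" using bounded_by_exists G_Mat aG by blast
  obtain k' where k': "bounded_by (- int k') (inv\<^bsub>G\<^esub> (a 0))"
    using bounded_by_exists G_Mat G.inv_closed[OF aG] by blast
  \<comment> \<open>All steps \<open>x m\<close> and their inverses are integral, so one bound for
    the denominators serves the whole sequence, and likewise for the inverses.\<close>
  have ba: "bounded_by (- int k) (a m)" for m
  proof (induction m)
    case (Suc m)
    then show ?case
      using bounded_G_mult[of "- int k" "a m" 0 "x m"] xK[of m] by (simp add: a_Suc K_def)
  qed (rule k)
  have bi: "bounded_by (- int k') (inv\<^bsub>G\<^esub> (a m))" for m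
  proof (induction m)
    case (Suc m)
    then show ?case
      using bounded_G_mult[of 0 "inv\<^bsub>G\<^esub> (x m)" "- int k'" "inv\<^bsub>G\<^esub> (a m)"] K_inverse[OF xK[of m]] aG xG
      by (simp add: a_Suc K_def G.inv_mult_group)
  qed (rule k')
  \<comment> \<open>The entries of \<open>a m \<star> scal (s m)\<close>, kept as rationals because
    \<open>lat_complete\<close> concerns rational sequences.\<close>
  define r where "r i j m = s m * c m (i, j)" for i j m
  have r_diag: "r i i m = c 0 (i, i)" if i: "i < n" for i m
  proof (induction m)
    case (Suc m)
    have "\<iota> (c (Suc m) (i, i)) = \<iota> (c m (i, i) * e m)"
      using G_mult_diag[OF aG xG i, of m m] i e(2)[OF i] by (simp add: a_Suc[symmetric] \<iota>_mult) (simp add: a_def)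
    then have "c (Suc m) (i, i) = c m (i, i) * e m" by (rule \<iota>_inj)
    then have "r i i (Suc m) = r i i m * (e m * e m)" by (simp add: r_def s_Suc)
    then show ?case using Suc e(1) by (simp add: signs_square)
  qed (simp add: r_def s_def)
  have r_step: "\<iota> (r i j (Suc m) - r i j m) \<in> lat (int m - int k)" if ij: "i < n" "j < n" for i j m
  proof -
    have "near (int m + - int k) (a m \<star> x m) (a m \<star> scal (e m))"
      using near_G_mult_left[OF aG xG scal_G[OF e(1)] ba e(3)] .
    then have "a (Suc m) (i, j) \<ominus>\<^bsub>QP\<^esub> a m (i, j) \<otimes>\<^bsub>QP\<^esub> \<iota> (e m) \<in> lat (int m - int k)"
      using ij aG by (simp add: near_def a_Suc[symmetric] mult_scal_entry)
    then have "\<iota> (c (Suc m) (i, j) - c m (i, j) * e m) \<in> lat (int m - int k)"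
      using ij by (simp add: a_def \<iota>_diff \<iota>_mult)
    then have "\<iota> (s (Suc m)) \<otimes>\<^bsub>QP\<^esub> \<iota> (c (Suc m) (i, j) - c m (i, j) * e m) \<in> lat (0 + (int m - int k))"
      using signs_lat[OF s_signs] by (intro lat_mult)
    moreover have "s (Suc m) * (c (Suc m) (i, j) - c m (i, j) * e m) =
        r i j (Suc m) - r i j m * (e m * e m)"
      by (simp add: r_def s_Suc algebra_simps)
    ultimately show ?thesis using e(1) by (simp add: \<iota>_mult[symmetric] signs_square)
  qed
  have "\<exists>y\<in>carrier QP. \<forall>m. y \<ominus>\<^bsub>QP\<^esub> \<iota> (r i j m) \<in> lat (int m - int k)" if "i < n" "j < n" for i j
    using lat_complete[of "r i j" "int k"] r_step[OF that] by blast
  then obtain y where y: "\<And>i j. i < n \<Longrightarrow> j < n \<Longrightarrow> y i j \<in> carrier QP"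
    "\<And>i j m. i < n \<Longrightarrow> j < n \<Longrightarrow> y i j \<ominus>\<^bsub>QP\<^esub> \<iota> (r i j m) \<in> lat (int m - int k)" by metis
  \<comment> \<open>Limits are taken only above the diagonal. The diagonal of the corrected sequence
    is that of its first term, whose rational units place g in G.\<close>
  define g where "g = (\<lambda>(i, j)\<in>{..<n} \<times> {..<n}. if i < j then y i j else \<mu> (c 0) (i, j))"
  have c0: "\<mu> (c 0) \<in> carrier G" using c \<mu>_closed by blast
  have "(\<Otimes>\<^bsub>QP\<^esub>i\<in>{..<n}. g (i, i)) = (\<Otimes>\<^bsub>QP\<^esub>i\<in>{..<n}. \<mu> (c 0) (i, i))"
    by (intro QP.finprod_cong') (auto simp: g_def)
  then have gG: "g \<in> carrier G"
    using c0 y(1) G_entry[OF c0] by (auto simp: carrier_G QP.carrier_upper_SL upper_tri_def matrices_def)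
      (auto simp: g_def)
  have gnear: "near (int m - int k) g (a m \<star> scal (s m))" for m
    unfolding near_def
  proof (intro allI impI)
    fix i j assume ij: "i < n" "j < n"
    have as: "(a m \<star> scal (s m)) (i, j) = \<iota> (r i j m)"
      unfolding mult_scal_entry[OF aG ij] using ij by (simp add: a_def r_def \<iota>_mult[symmetric] mult.commute)
    consider "i = j" | "i < j" | "j < i" by linarith
    then show "g (i, j) \<ominus>\<^bsub>QP\<^esub> (a m \<star> scal (s m)) (i, j) \<in> lat (int m - int k)"
    proof cases
      case 1
      then show ?thesis unfolding as using ij r_diag by (simp add: g_def a_minus_def QP.r_neg)
    next
      case 2
      then show ?thesis unfolding as using ij y(2) by (simp add: g_def)
    next
      case 3
      then have "c m' (i, j) = 0" for m' using c[of m'] ij by (simp add: \<Gamma>_iff)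
      then show ?thesis unfolding as using 3 ij by (simp add: g_def r_def \<iota>_zero a_minus_def)
    qed
  qed
  have tail: "inv\<^bsub>G\<^esub> (a m) \<star> a (m + d) \<in> C m" for m d
  proof (induction d)
    case 0
    show ?case using aG subgroup.one_closed[OF subgroup_C] by simp
  next
    case (Suc d)
    have "inv\<^bsub>G\<^esub> (a m) \<star> a (m + Suc d) = inv\<^bsub>G\<^esub> (a m) \<star> a (m + d) \<star> x (m + d)"
      using aG xG by (simp add: a_Suc G.m_assoc)
    moreover have "x (m + d) \<in> C m" using xC[of "m + d"] C_antimono[of m "m + d"] by auto
    ultimately show ?case using Suc subgroup.m_closed[OF subgroup_C] by simp
  qed
  have "inv\<^bsub>G\<^esub> (a m) \<star> g \<in> C m" for m
  proof -
    obtain M where M: "\<forall>g\<in>carrier G. \<forall>e\<in>signs. near (int M) g (scal e) \<longrightarrow> g \<in> C m"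
      using near_scal_C by blast
    \<comment> \<open>The approximation of g loses k powers of q and multiplication by the inverse
      of a l another k', so precision at least M remains. Since l is at least m, \<open>tail\<close>
      bridges the gap back to a m.\<close>
    define l where "l = m + (M + k + k')"
    have "near (int l - int k + - int k') (inv\<^bsub>G\<^esub> (a l) \<star> g) (inv\<^bsub>G\<^esub> (a l) \<star> (a l \<star> scal (s l)))"
      using aG gG scal_G[OF s_signs] bi gnear by (intro near_G_mult_left) auto
    then have "near (int M) (inv\<^bsub>G\<^esub> (a l) \<star> g) (scal (s l))"
      using near_antimono[of "int M" "int l - int k + - int k'"] aG scal_G[OF s_signs]
      by (simp add: G.mult_inv_cancel l_def)
    then have "inv\<^bsub>G\<^esub> (a l) \<star> g \<in> C m" using M aG gG s_signs by blast
    then have "(inv\<^bsub>G\<^esub> (a m) \<star> a l) \<star> (inv\<^bsub>G\<^esub> (a l) \<star> g) \<in> C m"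
      using tail subgroup.m_closed[OF subgroup_C] unfolding l_def by blast
    then show ?thesis using aG gG by (simp add: G.m_assoc G.mult_inv_cancel)
  qed
  then show ?thesis using gG unfolding a_def by blast
qed

lemma ball_topology_G: "ball_topology (G_topology n P) (carrier G) (\<lambda>m B A. near (int m) B A)"
proof -
  have "ball_topology (product_topology (\<lambda>_. padics_topology P) ({..<n} \<times> {..<n})) Mat
      (\<lambda>m B A. \<forall>ij\<in>{..<n} \<times> {..<n}. B ij \<ominus>\<^bsub>QP\<^esub> A ij \<in> lat (int m))"
    unfolding matrices_def by (rule ball_topology_product[OF ball_topology_padics]) simp
  then have "ball_topology (G_topology n P) (carrier G)
      (\<lambda>m B A. \<forall>ij\<in>{..<n} \<times> {..<n}. B ij \<ominus>\<^bsub>QP\<^esub> A ij \<in> lat (int m))"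
    unfolding G_topology_def by (rule ball_topology_subtopology) (auto dest: G_Mat)
  then show ?thesis by (rule ball_topology_cong) (auto simp: near_def)
qed

text \<open>The sets \<open>C m\<close> contain N and are not small neighbourhoods of the identity.
  For an N-invariant set the defect is harmless: an element of \<open>C m\<close> is multiplied by
  its sign, becomes close to the identity, and the sign is undone inside U.\<close>

lemma G_topology_open_iff:
  assumes U: "U \<subseteq> carrier G" and N: "\<And>g x. g \<in> U \<Longrightarrow> x \<in> N_set n P \<Longrightarrow> g \<star> x \<in> U"
  shows "openin (G_topology n P) U \<longleftrightarrow> (\<forall>g\<in>U. \<exists>m. \<forall>x\<in>C m. g \<star> x \<in> U)"
proof -
  have sN: "g \<star> scal e \<in> U" if "g \<in> U" "e \<in> signs" for g e
    using N that by (auto simp: N_set_eq)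
  have "(\<exists>m. \<forall>h\<in>carrier G. near (int m) h g \<longrightarrow> h \<in> U) \<longleftrightarrow> (\<exists>m. \<forall>x\<in>C m. g \<star> x \<in> U)" (is "?L \<longleftrightarrow> ?R")
    if gU: "g \<in> U" for g
  proof
    have g: "g \<in> carrier G" using U gU by blast
    {
      assume ?L
      then obtain m where m: "\<And>h. h \<in> carrier G \<Longrightarrow> near (int m) h g \<Longrightarrow> h \<in> U" by blast
      \<comment> \<open>Left multiplication by g costs k powers of q, hence the choice of
        \<open>C (m + k)\<close>.\<close>
      obtain k where k: "bounded_by (- int k) g" using bounded_by_exists G_Mat g by blast
      have "g \<star> x \<in> U" if x: "x \<in> C (m + k)" for x
      proof -
        have xG: "x \<in> carrier G" using C_G x by blast
        obtain e where e: "e \<in> signs" "near (int (m + k)) x (scal e)" using C_near_scal[OF x] by blast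
        note sG = scal_G[OF e(1)]
        have "near (int (m + k) + 0) (x \<star> scal e) (scal e \<star> scal e)"
          using xG sG e scal_bounded by (intro near_G_mult_right) auto
        then have "near (int (m + k) + 0 + - int k) (g \<star> (x \<star> scal e)) (g \<star> (scal e \<star> scal e))"
          using xG sG g k by (intro near_G_mult_left) auto
        then have "near (int m) (g \<star> (x \<star> scal e)) g"
          using g e by (simp add: scal_mult signs_square G_one_scal[symmetric])
        then have "g \<star> (x \<star> scal e) \<in> U" using m g xG sG by simp
        then have "g \<star> (x \<star> scal e) \<star> scal e \<in> U" using sN e by blast
        then show ?thesis
          using g xG sG e by (simp add: G.m_assoc scal_mult signs_square G_one_scal[symmetric])
      qed
      then show ?R by blast
    }
    {
      assume ?R
      then obtain m where m: "\<And>x. x \<in> C m \<Longrightarrow> g \<star> x \<in> U" by blast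
      obtain M where M: "\<forall>h\<in>carrier G. near (int M) h g \<longrightarrow> inv\<^bsub>G\<^esub> g \<star> h \<in> C m"
        using near_inv_mult_C[OF g] by blast
      have "h \<in> U" if "h \<in> carrier G" "near (int M) h g" for h
        using m[of "inv\<^bsub>G\<^esub> g \<star> h"] M that g by (simp add: G.mult_inv_cancel)
      then show ?L by blast
    }
  qed
  then show ?thesis
    unfolding ball_topology_openin[OF ball_topology_G] using U by simp
qed

text \<open>A rational is an integer exactly when it lies in \<open>Zloc\<close> and embeds into
  \<open>lat 0\<close>; over both rings the determinant is the same rational product.\<close>

lemma Lambda_eq: "Lambda_set n = {c \<in> carrier \<Gamma>. \<mu> c \<in> K}"
proof -
  interpret Z: cring int_ring by (rule cring_int_ring)
  have Z: "carrier int_ring = \<int>" "\<one>\<^bsub>int_ring\<^esub> = 1" "\<zero>\<^bsub>int_ring\<^esub> = 0" by (simp_all add: int_ring_def)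
  have ent: "c \<in> matrices n int_ring \<longleftrightarrow> c \<in> matrices n R \<and> (\<forall>i<n. \<forall>j<n. \<iota> (c (i, j)) \<in> lat 0)" for c
  proof -
    have "x \<in> \<int> \<longleftrightarrow> x \<in> Zloc \<and> \<iota> x \<in> lat 0" for x
      using lat_\<iota>_integral Zloc_int lat_\<iota>_int by (auto elim: Ints_cases)
    then show ?thesis unfolding matrices_def by (auto simp: Z PiE_iff)
  qed
  have "(\<Otimes>\<^bsub>int_ring\<^esub>i\<in>{..<n}. c (i, i)) = (\<Prod>i<n. c (i, i))" if "c \<in> matrices n int_ring" for c
    using matrices_entry[OF that] cring_int_ring unfolding int_ring_def
    by (intro rat_subring_finprod) auto
  then have "c \<in> Lambda_set n \<longleftrightarrow> c \<in> matrices n int_ring \<and> (\<forall>i<n. \<forall>j<i. c (i, j) = 0) \<and> (\<Prod>i<n. c (i, i)) = 1" for c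
    by (auto simp: Lambda_set_def Z.carrier_upper_SL upper_tri_def Z)
  moreover have "\<mu> c \<in> K \<longleftrightarrow> (\<forall>i<n. \<forall>j<n. \<iota> (c (i, j)) \<in> lat 0)" if "c \<in> carrier \<Gamma>" for c
    using \<mu>_closed[OF that] by (simp add: K_def bounded_by_def)
  ultimately show ?thesis by (auto simp: ent \<Gamma>_iff)
qed

sublocale model: schlichting_model \<Gamma> G \<mu> K F "G_topology n P" C "N_set n P" "Lambda_set n"
proof (intro schlichting_model.intro schlichting_model_axioms.intro)
  fix c assume c: "c \<in> carrier \<Gamma>"
  obtain M where M: "\<forall>g\<in>carrier G. \<forall>e\<in>signs. near (int M) g (scal e) \<longrightarrow>
      inv\<^bsub>G\<^esub> (\<mu> c) \<star> g \<star> \<mu> c \<in> K"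
    using near_scal_conj[OF \<mu>_closed[OF c]] by blast
  \<comment> \<open>The same M serves as index of the stabiliser, since elements of
    \<open>C M\<close> are congruent to a scalar modulo q^M.\<close>
  have "inv\<^bsub>G\<^esub> (\<mu> c) \<star> g \<star> \<mu> c \<in> K" if g: "g \<in> C M" for g
    using C_near_scal[OF g] M C_G[OF g] by metis
  then show "\<exists>m. \<forall>g\<in>C m. inv\<^bsub>G\<^esub> (\<mu> c) \<star> g \<star> \<mu> c \<in> K" by blast
qed (fact \<Gamma>.group_axioms G.group_axioms C_def \<mu>_hom subgroup_K N_eq Lambda_eq \<Gamma>_dense F_finite F_sub F_mono
  C_complete ball_topology_topspace[OF ball_topology_G] G_topology_open_iff)+

text \<open>The separating map is reduction of all entries modulo q^M, with M so large that
  conjugation by g keeps matrices congruent to 1 integral. Its target is finite, and matrices with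
  equal reduction have a quotient congruent to 1.\<close>

lemma commensurated_Lambda: "commensurated \<Gamma> (Lambda_set n)"
proof -
  have "\<exists>M::nat. \<forall>h\<in>carrier G. near (int M) h \<one>\<^bsub>G\<^esub> \<longrightarrow> inv\<^bsub>G\<^esub> (\<mu> g) \<star> h \<star> \<mu> g \<in> K" if "g \<in> carrier \<Gamma>" for g
    using near_scal_conj[OF \<mu>_closed[OF that]] signs_one unfolding G_one_scal by blast
  then obtain M where M: "\<And>g h. g \<in> carrier \<Gamma> \<Longrightarrow> h \<in> carrier G \<Longrightarrow> near (int (M g)) h \<one>\<^bsub>G\<^esub> \<Longrightarrow>
      inv\<^bsub>G\<^esub> (\<mu> g) \<star> h \<star> \<mu> g \<in> K"
    by metis
  \<comment> \<open>Elements of \<Lambda> are matrices of rationals with integer values; the floor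
    turns them into integers, for which \<open>mod\<close> yields finitely many residues.\<close>
  define f where "f g a = (\<lambda>ij\<in>{..<n} \<times> {..<n}. \<lfloor>a ij\<rfloor> mod int q ^ M g)" for g and a :: "rat matrix"
  show ?thesis
  proof (rule \<Gamma>.commensurated_of_separating_map[where f = f])
    show "subgroup (Lambda_set n) \<Gamma>" by (rule model.\<Lambda>)
    fix g assume g: "g \<in> carrier \<Gamma>"
    have "f g a \<in> ({..<n} \<times> {..<n}) \<rightarrow>\<^sub>E {0..<int q ^ M g}" for a
      unfolding f_def by (rule restrict_PiE_iff[THEN iffD2]) (use q_pos in simp)
    then have "f g ` Lambda_set n \<subseteq> ({..<n} \<times> {..<n}) \<rightarrow>\<^sub>E {0..<int q ^ M g}" by blast
    then show "finite (f g ` Lambda_set n)"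
      by (rule finite_subset) (simp add: finite_PiE)
    fix a b assume ab: "a \<in> Lambda_set n" "b \<in> Lambda_set n" "f g a = f g b"
    have ab\<Gamma>: "a \<in> carrier \<Gamma>" "b \<in> carrier \<Gamma>" and aK: "\<mu> a \<in> K" and bK: "\<mu> b \<in> K"
      using ab by (auto simp: Lambda_eq)
    have "near (int (M g)) (\<mu> b) (\<mu> a)"
      unfolding near_def
    proof (intro allI impI)
      fix i j assume ij: "i < n" "j < n"
      have Z: "a (i, j) \<in> \<int>" "b (i, j) \<in> \<int>"
        using ij ab\<Gamma> aK bK lat_\<iota>_integral \<Gamma>_entry by (auto simp: K_def bounded_by_def)
      have "\<lfloor>a (i, j)\<rfloor> mod int q ^ M g = \<lfloor>b (i, j)\<rfloor> mod int q ^ M g"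
        using fun_cong[OF ab(3), of "(i, j)"] ij by (simp add: f_def)
      then have "int q ^ M g dvd \<lfloor>b (i, j)\<rfloor> - \<lfloor>a (i, j)\<rfloor>" by (metis mod_eq_dvd_iff)
      then have "\<iota> (of_int (\<lfloor>b (i, j)\<rfloor> - \<lfloor>a (i, j)\<rfloor>)) \<in> lat (int (M g))" by (rule lat_\<iota>_int_dvd)
      moreover have "of_int (\<lfloor>b (i, j)\<rfloor> - \<lfloor>a (i, j)\<rfloor>) = b (i, j) - a (i, j)"
        using Z by (auto elim!: Ints_cases)
      ultimately have "\<iota> (b (i, j) - a (i, j)) \<in> lat (int (M g))" by (simp only:)
      then show "\<mu> b (i, j) \<ominus>\<^bsub>QP\<^esub> \<mu> a (i, j) \<in> lat (int (M g))"
        using ij by (simp add: \<iota>_diff)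
    qed
    \<comment> \<open>The inverse of a is integral as well, so multiplying by it loses no
      precision.\<close>
    then have "near (int (M g) + 0) (\<mu> b \<star> inv\<^bsub>G\<^esub> (\<mu> a)) (\<mu> a \<star> inv\<^bsub>G\<^esub> (\<mu> a))"
      using K_inverse[OF aK] ab\<Gamma> \<mu>_closed by (intro near_G_mult_right) (auto simp: K_def)
    then have "near (int (M g)) (\<mu> b \<star> inv\<^bsub>G\<^esub> (\<mu> a)) \<one>\<^bsub>G\<^esub>"
      using ab\<Gamma> \<mu>_closed by simp
    then have "inv\<^bsub>G\<^esub> (\<mu> g) \<star> (\<mu> b \<star> inv\<^bsub>G\<^esub> (\<mu> a)) \<star> \<mu> g \<in> K"
      using M[OF g] ab\<Gamma> \<mu>_closed by simp
    then show "inv\<^bsub>\<Gamma>\<^esub> g \<otimes>\<^bsub>\<Gamma>\<^esub> (b \<otimes>\<^bsub>\<Gamma>\<^esub> inv\<^bsub>\<Gamma>\<^esub> a) \<otimes>\<^bsub>\<Gamma>\<^esub> g \<in> Lambda_set n"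
      using g ab\<Gamma> by (simp add: Lambda_eq model.\<iota>.hom_mult)
  qed
qed

end

theorem proposition6p9:
  fixes n :: nat and P :: "nat set"
  assumes "finite P" and "P \<noteq> {}" and "\<And>p. p \<in> P \<Longrightarrow> prime p"
  shows "commensurated (Gamma_group n P) (Lambda_set n) \<and>
    (\<exists>\<phi>. topological_group_iso
           (G_group n P Mod N_set n P)
           (coset_topology (G_group n P) (G_topology n P) (N_set n P))
           (schlichting_completion (Gamma_group n P) (Lambda_set n))
           (schlichting_topology (Gamma_group n P) (Lambda_set n)) \<phi> \<and>
         (\<forall>\<gamma>\<in>carrier (Gamma_group n P).
            \<phi> (N_set n P #>\<^bsub>G_group n P\<^esub> mat_map n (padics_of_rat P) \<gamma>) =
              schlichting_map (Gamma_group n P) (Lambda_set n) \<gamma>))"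
proof -
  interpret upper_adic P n
    by (unfold_locales) (use assms in auto)
  have "model.completion_iso (N_set n P #>\<^bsub>G_group n P\<^esub> \<mu> \<gamma>) = schlichting_map \<Gamma> (Lambda_set n) \<gamma>"
    if "\<gamma> \<in> carrier \<Gamma>" for \<gamma>
    using that by (simp add: model.completion_iso_coset \<mu>_closed model.act_\<iota>)
  then show ?thesis
    using commensurated_Lambda model.completion_topological_group_iso by blast
qed

end
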